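(* Let $\ell\ge 2$ be an integer, let $L\ne 2$ be a prime, and let $c\ge1$ be an integer. Let $q=p^d$ range over the powers of primes $p\neq L$ such that $\delta_L(p)\mid d$ (equivalently $L\mid q-1$) and $v_L(q-1)=c$. Then $$\lim_{\substack{q\to\infty\\ v_L(q-1)=c}}\frac{|\operatorname{Per}(x^L,\mathrm{M}_\ell(q))|}{|\mathrm{M}_\ell(q)|}=\lim_{\substack{q\to\infty\\ v_L(q-1)=c}}\frac{|\operatorname{Per}(x^L,\mathrm{GL}_\ell(q))|}{|\mathrm{GL}_\ell(q)|}.$$ Further, the limiting value is contributed by the classes of regular semisimple invertible matrices; that is, if $R_\ell(q)$ denotes the set of regular semisimple matrices in $\mathrm{GL}_\ell(q)$, then $$\lim_{\substack{q\to\infty\\ v_L(q-1)=c}}\frac{|\operatorname{Per}(x^L,\mathrm{M}_\ell(q))\setminus R_\ell(q)|}{|\mathrm{M}_\ell(q)|}=0 .$$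
   Context: $\mathrm{M}_\ell(q)$ is the algebra of $\ell\times\ell$ matrices over the finite field $\mathbb{F}_q$, and $\mathrm{GL}_\ell(q)=\mathrm{M}_\ell(q)^\times$. For a set $S$ and a self-map $f:S\to S$, a point $\alpha\in S$ is periodic if $f^n(\alpha)=\alpha$ for some $n>1$, where $f^n$ is the $n$-fold composite; $\operatorname{Per}(f,S)$ is the set of periodic points. Here $x^L$ denotes the map $x\mapsto x^L$. $v_L$ is the $L$-adic valuation, and $\delta_L(p)$ is the multiplicative order of $p$ modulo $L$. A matrix in $\mathrm{GL}_\ell(q)$ is regular semisimple if its characteristic polynomial is a product of pairwise distinct irreducible polynomials over $\mathbb{F}_q$ (equivalently, it has $\ell$ distinct eigenvalues in $\overline{\mathbb{F}_q}$). *)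

theory Defs
  imports
    Complex_Main
    "HOL-Combinatorics.Permutations"
    "HOL-Number_Theory.Number_Theory"
    "HOL-Algebra.Polynomial_Divisibility"
begin

section \<open>Matrices over a ring given by a record\<close>

text \<open>
  The fields \<open>\<bbbF>\<^sub>q\<close> vary inside the statement and have different characteristics, so they are
  modelled as ring records of HOL-Algebra rather than as types.  An \<open>l \<times> l\<close> matrix is an
  extensional function on pairs of indices below \<open>l\<close>, so that equality of matrices is
  entrywise and the carrier is finite whenever the base ring is.
\<close>

definition mat_ring :: "('a, 'm) ring_scheme \<Rightarrow> nat \<Rightarrow> (nat \<times> nat \<Rightarrow> 'a) ring" where
  "mat_ring R l =
     \<lparr>carrier = ({..<l} \<times> {..<l}) \<rightarrow>\<^sub>E carrier R,
      mult = (\<lambda>A B. \<lambda>(i, j) \<in> {..<l} \<times> {..<l}. \<Oplus>\<^bsub>R\<^esub>k\<in>{..<l}. A (i, k) \<otimes>\<^bsub>R\<^esub> B (k, j)),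
      one = (\<lambda>(i, j) \<in> {..<l} \<times> {..<l}. if i = j then \<one>\<^bsub>R\<^esub> else \<zero>\<^bsub>R\<^esub>),
      ring.zero = (\<lambda>(i, j) \<in> {..<l} \<times> {..<l}. \<zero>\<^bsub>R\<^esub>),
      ring.add = (\<lambda>A B. \<lambda>(i, j) \<in> {..<l} \<times> {..<l}. A (i, j) \<oplus>\<^bsub>R\<^esub> B (i, j))\<rparr>"

abbreviation Mat :: "nat \<Rightarrow> ('a, 'm) ring_scheme \<Rightarrow> (nat \<times> nat \<Rightarrow> 'a) set" where
  "Mat l R \<equiv> carrier (mat_ring R l)"

abbreviation GL :: "nat \<Rightarrow> ('a, 'm) ring_scheme \<Rightarrow> (nat \<times> nat \<Rightarrow> 'a) set" where
  "GL l R \<equiv> Units (mat_ring R l)"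

definition mat_det :: "('a, 'm) ring_scheme \<Rightarrow> nat \<Rightarrow> (nat \<times> nat \<Rightarrow> 'a) \<Rightarrow> 'a" where
  "mat_det R l A =
     (\<Oplus>\<^bsub>R\<^esub>\<sigma>\<in>{\<sigma>. \<sigma> permutes {..<l}}. add_pow R (sign \<sigma>) (\<Otimes>\<^bsub>R\<^esub>i\<in>{..<l}. A (i, \<sigma> i)))"

text \<open>
  \<open>det (X \<cdot> I - A)\<close>, computed in the polynomial ring \<open>R[X]\<close>, whose elements are lists of
  coefficients with the leading coefficient first.
\<close>

definition mat_char_poly :: "('a, 'm) ring_scheme \<Rightarrow> nat \<Rightarrow> (nat \<times> nat \<Rightarrow> 'a) \<Rightarrow> 'a list" where
  "mat_char_poly R l A =
     mat_det (poly_ring R) l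
       (\<lambda>(i, j). (if i = j then X\<^bsub>R\<^esub> else \<zero>\<^bsub>poly_ring R\<^esub>) \<ominus>\<^bsub>poly_ring R\<^esub> ring.poly_of_const R (A (i, j)))"

text \<open>
  The irreducible factors are taken monic.  Otherwise ``pairwise distinct'' would be
  meaningless: \<open>a X\<close> and \<open>a\<^sup>-\<^sup>1 X\<close> may be distinct although their product is \<open>X\<^sup>2\<close>.
\<close>

definition regular_semisimple :: "('a, 'm) ring_scheme \<Rightarrow> nat \<Rightarrow> (nat \<times> nat \<Rightarrow> 'a) set" where
  "regular_semisimple R l =
     {A \<in> GL l R. \<exists>S. finite S \<and>
        (\<forall>f\<in>S. f \<in> carrier (poly_ring R) \<and> pirreducible\<^bsub>R\<^esub> (carrier R) f \<and> lead_coeff f = \<one>\<^bsub>R\<^esub>) \<and>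
        mat_char_poly R l A = (\<Otimes>\<^bsub>poly_ring R\<^esub>f\<in>S. f)}"


section \<open>Periodic points\<close>

definition Per :: "('s \<Rightarrow> 's) \<Rightarrow> 's set \<Rightarrow> 's set" where
  "Per f S = {\<alpha> \<in> S. \<exists>n>1. (f ^^ n) \<alpha> = \<alpha>}"

definition mat_pow_map ::
  "('a, 'm) ring_scheme \<Rightarrow> nat \<Rightarrow> nat \<Rightarrow> (nat \<times> nat \<Rightarrow> 'a) \<Rightarrow> (nat \<times> nat \<Rightarrow> 'a)" where
  "mat_pow_map R l L A = A [^]\<^bsub>mat_ring R l\<^esub> L"


section \<open>The range of \<open>q\<close>\<close>

definition admissible_q :: "nat \<Rightarrow> nat \<Rightarrow> nat set" where
  "admissible_q L c =
     {q. \<exists>p d. Factorial_Ring.prime p \<and> p \<noteq> L \<and> d > 0 \<and> q = p ^ d \<and> ord L p dvd d \<and> multiplicity L (q - 1) = c}"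

text \<open>The limit \<open>q \<rightarrow> \<infinity>\<close> along the admissible values of \<open>q\<close>.\<close>

definition q_to_infinity :: "nat \<Rightarrow> nat \<Rightarrow> nat filter" where
  "q_to_infinity L c = inf at_top (principal (admissible_q L c))"

text \<open>There are infinitely many admissible \<open>q\<close>, so limits along this filter are unique.\<close>

lemma infinite_admissible_q:
  assumes L: "Factorial_Ring.prime L" "L \<noteq> 2" and c: "c \<ge> 1"
  shows "infinite (admissible_q L c)"
proof -
  define T where "T = totient (L ^ c)"
  have L1: "L > 1" using L prime_gt_1_nat by blast
  have T: "T > 0" unfolding T_def using L1 by simp
  have "odd L" using L prime_odd_nat prime_ge_2_nat[OF L(1)] by (metis le_neq_implies_less)
  obtain g where g: "\<forall>k>0. residue_primroot (L ^ k) g"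
    using residue_primroot_odd_prime_power_exists[OF L(1) \<open>odd L\<close>] by blast
  have T_lt: "T < totient (L ^ Suc c)"
  proof -
    obtain k where k: "c = Suc k" using c by (cases c) auto
    show ?thesis
      unfolding T_def k using L1 totient_prime_power_Suc[OF L(1)] by (simp del: power_Suc)
  qed
  have gT: "[g ^ T \<noteq> 1] (mod L ^ Suc c)"
  proof
    assume "[g ^ T = 1] (mod L ^ Suc c)"
    then have "totient (L ^ Suc c) dvd T"
      using g by (metis ord_divides residue_primroot_def zero_less_Suc)
    then show False using T T_lt by (auto dest: dvd_imp_le)
  qed
  have cop: "coprime g L" using g[rule_format, of 1] by (simp add: residue_primroot_def coprime_commute)
  have g0: "g > 0" using cop L1 by (cases "g = 0") auto
  have "\<exists>p\<in>prime_factors g. [p ^ T \<noteq> 1] (mod L ^ Suc c)"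
  proof (rule ccontr)
    assume *: "\<not> ?thesis"
    have "[(\<Prod>p\<in>prime_factors g. (p ^ T) ^ multiplicity p g) =
           (\<Prod>p\<in>prime_factors g. 1)] (mod L ^ Suc c)"
    proof (rule cong_prod)
      fix p assume "p \<in> prime_factors g"
      then have "[(p ^ T) ^ multiplicity p g = 1 ^ multiplicity p g] (mod L ^ Suc c)"
        using * by (intro cong_pow) auto
      then show "[(p ^ T) ^ multiplicity p g = 1] (mod L ^ Suc c)" by simp
    qed
    also have "(\<Prod>p\<in>prime_factors g. (p ^ T) ^ multiplicity p g) =
               (\<Prod>p\<in>prime_factors g. p ^ multiplicity p g) ^ T"
      unfolding prod_power_distrib by (intro prod.cong refl) (metis power_mult mult.commute)
    also have "\<dots> = g ^ T" using prime_factorization_nat[OF g0] by simp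
    finally show False using gT by simp
  qed
  then obtain p where p: "p \<in> prime_factors g" "[p ^ T \<noteq> 1] (mod L ^ Suc c)" by blast
  have pp: "Factorial_Ring.prime p" and pg: "p dvd g" using p by auto
  have copp: "coprime p L" using cop pg by (meson coprime_divisors dvd_refl)
  have pL: "p \<noteq> L" using copp L1 by auto
  have p1: "p > 1" using pp prime_gt_1_nat by blast
  define h where "h m = T * (1 + totient (L ^ Suc c) * m)" for m
  have mem: "p ^ h m \<in> admissible_q L c" for m
  proof -
    have h0: "h m > 0" using T by (simp add: h_def)
    have lo: "[p ^ h m = 1] (mod L ^ c)"
    proof -
      have "[(p ^ T) ^ (1 + totient (L ^ Suc c) * m) = 1 ^ (1 + totient (L ^ Suc c) * m)] (mod L ^ c)"
        unfolding T_def using copp by (intro cong_pow euler_theorem) simp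
      then show ?thesis by (simp only: h_def power_mult power_one)
    qed
    have hi: "[p ^ h m \<noteq> 1] (mod L ^ Suc c)"
    proof
      assume a: "[p ^ h m = 1] (mod L ^ Suc c)"
      have e: "p ^ h m = p ^ T * (p ^ totient (L ^ Suc c)) ^ (m * T)"
      proof -
        have "h m = T + totient (L ^ Suc c) * (m * T)" by (simp add: h_def distrib_left mult_ac)
        then show ?thesis by (simp only: power_add power_mult)
      qed
      have "[(p ^ totient (L ^ Suc c)) ^ (m * T) = 1 ^ (m * T)] (mod L ^ Suc c)"
        using copp by (intro cong_pow euler_theorem) simp
      then have "[p ^ h m = p ^ T * 1] (mod L ^ Suc c)"
        unfolding e by (intro cong_mult) (simp_all only: power_one cong_refl)
      then have "[p ^ T = 1] (mod L ^ Suc c)" using a by (metis cong_sym cong_trans mult.right_neutral)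
      then show False using p by blast
    qed
    have ge: "1 \<le> p ^ h m" using p1 by simp
    have d1: "L ^ c dvd p ^ h m - 1" using lo ge cong_altdef_nat by (metis cong_sym cong_to_1_nat)
    have d2: "\<not> L ^ Suc c dvd p ^ h m - 1"
      using hi ge by (metis cong_altdef_nat)
    have "multiplicity L (p ^ h m - 1) = c" using d1 d2 by (intro multiplicity_eqI) auto
    moreover have "ord L p dvd h m"
    proof -
      have "L dvd L ^ c" using c by (simp add: dvd_power)
      then have "[p ^ h m = 1] (mod L)" using lo by (rule cong_dvd_modulus_nat [rotated])
      then show ?thesis by (rule iffD1 [OF ord_divides])
    qed
    ultimately show ?thesis unfolding admissible_q_def using pp pL h0 by blast
  qed
  have "inj (\<lambda>m. p ^ h m)"
  proof (rule injI)
    fix m n assume "p ^ h m = p ^ h n"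
    then have "h m = h n" using p1 by (rule_tac power_inject_exp [THEN iffD1])
    then show "m = n" using T L1 by (auto simp: h_def)
  qed
  then have "infinite (range (\<lambda>m. p ^ h m))" using finite_imageD by blast
  moreover have "range (\<lambda>m. p ^ h m) \<subseteq> admissible_q L c" using mem by auto
  ultimately show ?thesis using finite_subset by blast
qed

lemma q_to_infinity_neq_bot:
  assumes "Factorial_Ring.prime L" "L \<noteq> 2" "c \<ge> 1"
  shows "q_to_infinity L c \<noteq> bot"
proof
  assume "q_to_infinity L c = bot"
  then have "eventually (\<lambda>q. q \<notin> admissible_q L c) at_top"
    by (simp add: q_to_infinity_def trivial_limit_def eventually_inf_principal)
  then obtain N where "\<forall>q\<ge>N. q \<notin> admissible_q L c" by (auto simp: eventually_at_top_linorder)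
  then have "admissible_q L c \<subseteq> {..<N}" by (meson lessThan_iff not_le subsetI)
  then show False using infinite_admissible_q[OF assms] finite_subset by blast
qed

end

theory Submission
  imports Defs "HOL-Algebra.Multiplicative_Group"
begin

text \<open>
  For monic \<open>f\<close> of degree \<open>l\<close> the conjugacy class of the companion matrix of \<open>f\<close> has at least
  \<open>|GL| / q\<^sup>l\<close> elements, since the centralizer of a companion matrix has at most \<open>q\<^sup>l\<close>, and all of
  them have characteristic polynomial \<open>f\<close>.  As almost all matrices are invertible and
  almost all of the \<open>q\<^sup>l\<close> monic \<open>f\<close> are squarefree and prime to \<open>X\<close>, these classes exhaust all
  but \<open>o(1)\<close> of the matrices.  For such \<open>f\<close> a matrix in the class is periodic under the \<open>L\<close>-th
  power map iff \<open>f\<close> divides some \<open>X\<^sup>N - 1\<close> with \<open>N\<close> prime to \<open>L\<close>.  So all three limits are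
  governed by the proportion of sets of monic irreducibles of total degree \<open>l\<close> whose roots have
  order prime to \<open>L\<close>.  If \<open>N\<^sub>d\<close> is the number of such irreducibles of degree \<open>d\<close>, factoring
  \<open>X\<^sup>n - 1\<close>, where \<open>n\<close> is the part of \<open>q\<^sup>m - 1\<close> prime to \<open>L\<close>, shows that the sum of \<open>d N\<^sub>d\<close> over the
  divisors \<open>d\<close> of \<open>m\<close> is \<open>n\<close>.  Lifting the exponent gives \<open>v\<^sub>L(q\<^sup>m - 1) = c + v\<^sub>L(m)\<close>, so each
  \<open>N\<^sub>d / q\<^sup>d\<close> converges, and with it the proportion of such sets.
\<close>

section \<open>Weighted finite sets and their asymptotic count\<close>

text \<open>Class sizes are bounded only from below, yet upper bounds result as well: the classes of
  distinct \<open>f\<close> are disjoint, so the classes of non-periodic matrices also fill at least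
  their share of all matrices and thereby cap the number of periodic ones. Both caps leave a gap of
  order 1/q, which comes from singular matrices and from polynomials that are not squarefree or are
  divisible by X. The characteristic polynomial serves to separate the classes and to certify
  regular semisimplicity. For a conjugate of a companion matrix it is identified by divisibility:
  the determinant is linear in a row and vanishes on equal rows, which makes \<open>f\<close> divide
  it, and two monic polynomials of equal degree with this property coincide. The obstacle to
  convergence is that the part of q^m - 1 prime to L could jump with q. Fixing c removes it, because
  the valuation c + v_L(m) no longer depends on q; the oddness of L enters in this formula. Matrices
  in M and in GL then share one limit because singular matrices have proportion at most l/q.\<close>

definition wsets :: "'b set \<Rightarrow> ('b \<Rightarrow> nat) \<Rightarrow> nat \<Rightarrow> nat \<Rightarrow> 'b set set" where
  "wsets P w D n = {S. finite S \<and> S \<subseteq> {x \<in> P. w x \<in> {1..D}} \<and> sum w S = n}"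

lemma finite_wsets:
  assumes "\<And>d. d \<ge> 1 \<Longrightarrow> finite {x \<in> P. w x = d}"
  shows "finite (wsets P w D n)"
proof -
  have "{x \<in> P. w x \<in> {1..D}} = (\<Union>d\<in>{1..D}. {x \<in> P. w x = d})" by auto
  then have "finite {x \<in> P. w x \<in> {1..D}}" using assms by auto
  then show ?thesis
    by (rule finite_subset[rotated, OF finite_Pow_iff[THEN iffD2]]) (auto simp: wsets_def)
qed

lemma card_wsets_0: "card (wsets P w 0 n) = (if n = 0 then 1 else 0)"
proof -
  have "wsets P w 0 n = (if n = 0 then {{}} else {})" by (auto simp: wsets_def)
  then show ?thesis by simp
qed

text \<open>A set splits into its k elements of top weight \<open>Suc D\<close> and a set with
  weights at most \<open>D\<close>. This is coefficient extraction from the product of (1 +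
  x^d)^(N_d), one factor at a time, which is why \<open>wsets\<close> carries the cap
  \<open>D\<close>.\<close>

lemma card_wsets_Suc:
  assumes fin: "\<And>d. d \<ge> 1 \<Longrightarrow> finite {x \<in> P. w x = d}"
  shows "card (wsets P w (Suc D) n) =
    (\<Sum>k\<le>n div Suc D. (card {x \<in> P. w x = Suc D} choose k) * card (wsets P w D (n - k * Suc D)))"
proof -
  let ?T = "{x \<in> P. w x = Suc D}"
  have finT: "finite ?T" using fin by simp
  let ?B = "SIGMA k:{..n div Suc D}. {T. T \<subseteq> ?T \<and> card T = k} \<times> wsets P w D (n - k * Suc D)"
  have sumT: "sum w T = card T * Suc D" if "T \<subseteq> ?T" for T
  proof -
    have "sum w T = sum (\<lambda>_. Suc D) T" using that by (intro sum.cong) auto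
    then show ?thesis by simp
  qed
  have "bij_betw (\<lambda>S. (card (S \<inter> ?T), S \<inter> ?T, S - ?T)) (wsets P w (Suc D) n) ?B"
  proof (rule bij_betw_byWitness[where f' = "\<lambda>(k, T, S). T \<union> S"])
    show "\<forall>S\<in>wsets P w (Suc D) n. (\<lambda>(k, T, S). T \<union> S) (card (S \<inter> ?T), S \<inter> ?T, S - ?T) = S" by auto
    show "\<forall>a\<in>?B. (\<lambda>S. (card (S \<inter> ?T), S \<inter> ?T, S - ?T)) ((\<lambda>(k, T, S). T \<union> S) a) = a"
    proof
      fix a assume "a \<in> ?B"
      then obtain T S where a: "a = (card T, T, S)" "T \<subseteq> ?T" "S \<subseteq> {x \<in> P. w x \<in> {1..D}}"
        by (auto simp: wsets_def)
      then have "(T \<union> S) \<inter> ?T = T" "(T \<union> S) - ?T = S" by auto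
      then show "(\<lambda>S. (card (S \<inter> ?T), S \<inter> ?T, S - ?T)) ((\<lambda>(k, T, S). T \<union> S) a) = a"
        using a by simp
    qed
    show "(\<lambda>S. (card (S \<inter> ?T), S \<inter> ?T, S - ?T)) ` wsets P w (Suc D) n \<subseteq> ?B"
    proof (rule image_subsetI)
      fix S assume S: "S \<in> wsets P w (Suc D) n"
      then have f: "finite S" and s: "S \<subseteq> {x \<in> P. w x \<in> {1..Suc D}}" and n: "sum w S = n"
        by (auto simp: wsets_def)
      have "n = sum w (S \<inter> ?T) + sum w (S - ?T)"
        using sum.Int_Diff[OF f, of w ?T] n by simp
      then have n': "n = card (S \<inter> ?T) * Suc D + sum w (S - ?T)" using sumT[of "S \<inter> ?T"] by simp
      then have "card (S \<inter> ?T) \<le> n div Suc D"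
        by (metis le_add1 less_eq_div_iff_mult_less_eq zero_less_Suc)
      moreover have "S - ?T \<in> wsets P w D (n - card (S \<inter> ?T) * Suc D)"
        using n' f s by (fastforce simp: wsets_def)
      ultimately show "(card (S \<inter> ?T), S \<inter> ?T, S - ?T) \<in> ?B" by simp
    qed
    show "(\<lambda>(k, T, S). T \<union> S) ` ?B \<subseteq> wsets P w (Suc D) n"
    proof (rule image_subsetI)
      fix a assume "a \<in> ?B"
      then obtain T S where a: "a = (card T, T, S)" "card T \<le> n div Suc D" "T \<subseteq> ?T"
          "S \<in> wsets P w D (n - card T * Suc D)" by auto
      then have S: "finite S" "S \<subseteq> {x \<in> P. w x \<in> {1..D}}" "sum w S = n - card T * Suc D"
        by (auto simp: wsets_def)
      have le: "card T * Suc D \<le> n" using a(2) by (simp add: less_eq_div_iff_mult_less_eq)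
      have "sum w (T \<union> S) = sum w T + sum w S"
        using finite_subset[OF a(3) finT] S(1,2) a(3) by (intro sum.union_disjoint) fastforce+
      then have "sum w (T \<union> S) = n" using S(3) le sumT[OF a(3)] by simp
      moreover have "T \<union> S \<subseteq> {x \<in> P. w x \<in> {1..Suc D}}" using a(3) S(2) by auto
      ultimately have "T \<union> S \<in> wsets P w (Suc D) n"
        using finite_subset[OF a(3) finT] S(1) by (simp add: wsets_def)
      then show "(\<lambda>(k, T, S). T \<union> S) a \<in> wsets P w (Suc D) n" using a(1) by simp
    qed
  qed
  then have "card (wsets P w (Suc D) n) = card ?B" by (rule bij_betw_same_card)
  also have "\<dots> = (\<Sum>k\<le>n div Suc D. card ({T. T \<subseteq> ?T \<and> card T = k} \<times> wsets P w D (n - k * Suc D)))"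
    using finT finite_wsets[OF fin] by (intro card_SigmaI) auto
  also have "\<dots> = (\<Sum>k\<le>n div Suc D. (card ?T choose k) * card (wsets P w D (n - k * Suc D)))"
    by (simp add: card_cartesian_product n_subsets[OF finT])
  finally show ?thesis .
qed

lemma tendsto_inverse_power_at_top:
  fixes Q :: "'i \<Rightarrow> real"
  assumes Q: "filterlim Q at_top G" and "k > 0"
  shows "((\<lambda>i. 1 / Q i ^ k) \<longlongrightarrow> 0) G"
proof -
  have "((\<lambda>i. inverse (Q i) ^ k) \<longlongrightarrow> 0 ^ k) G"
    by (intro tendsto_power filterlim_compose[OF tendsto_inverse_0_at_top Q] )
       (auto intro: filterlim_ident)
  then show ?thesis using \<open>k > 0\<close> by (simp add: divide_inverse power_inverse zero_power)
qed

text \<open>The falling factorial N(N-1)...(N-k+1) has k factors, and each of them over Q^d tends to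
  \<nu>, since the shift j / Q^d vanishes in the limit.\<close>

lemma binomial_tendsto:
  fixes Q :: "'i \<Rightarrow> real" and N :: "'i \<Rightarrow> nat"
  assumes Q: "filterlim Q at_top G" and "d > 0"
    and N: "((\<lambda>i. N i / Q i ^ d) \<longlongrightarrow> \<nu>) G"
  shows "((\<lambda>i. real (N i choose k) / Q i ^ (k * d)) \<longlongrightarrow> \<nu> ^ k / fact k) G"
proof -
  have "((\<lambda>i. N i / Q i ^ d - real j * (1 / Q i ^ d)) \<longlongrightarrow> \<nu> - real j * 0) G" for j
    by (intro tendsto_diff tendsto_mult tendsto_const N tendsto_inverse_power_at_top Q \<open>d > 0\<close>)
  then have "((\<lambda>i. (\<Prod>j = 0..<k. N i / Q i ^ d - real j * (1 / Q i ^ d)) / fact k)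
      \<longlongrightarrow> (\<Prod>j = 0..<k. \<nu> - real j * 0) / fact k) G"
    by (intro tendsto_divide tendsto_prod tendsto_const) auto
  moreover have "(\<Prod>j = 0..<k. N i / Q i ^ d - real j * (1 / Q i ^ d)) / fact k
      = real (N i choose k) / Q i ^ (k * d)" for i
  proof -
    have "(\<Prod>j = 0..<k. N i / Q i ^ d - real j * (1 / Q i ^ d))
        = (\<Prod>j = 0..<k. (real (N i) - real j) / Q i ^ d)"
      by (simp add: diff_divide_distrib)
    also have "\<dots> = (\<Prod>j = 0..<k. real (N i) - real j) / Q i ^ (k * d)"
      by (simp add: prod_dividef power_mult mult.commute)
    finally show ?thesis by (simp add: binomial_gbinomial gbinomial_prod_rev)
  qed
  ultimately show ?thesis by simp
qed

text \<open>The recurrence in \<open>D\<close> has a number of summands independent of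
  \<open>i\<close>, and Q^n = Q^(k(D+1)) Q^(n-k(D+1)) distributes the normalisation over the two
  factors of each summand, so limits can be taken termwise.\<close>

lemma card_wsets_tendsto:
  fixes Q :: "'i \<Rightarrow> real"
  assumes Q: "filterlim Q at_top G"
    and fin: "\<forall>\<^sub>F i in G. \<forall>d\<ge>1. finite {x \<in> P i. w x = d}"
    and N: "\<And>d. d \<ge> 1 \<Longrightarrow> \<exists>\<nu>. ((\<lambda>i. card {x \<in> P i. w x = d} / Q i ^ d) \<longlongrightarrow> \<nu>) G"
  shows "\<exists>\<Lambda>. ((\<lambda>i. card (wsets (P i) w D n) / Q i ^ n) \<longlongrightarrow> \<Lambda>) G"
proof (induction D arbitrary: n)
  case 0
  have "((\<lambda>i. card (wsets (P i) w 0 n) / Q i ^ n) \<longlongrightarrow> (if n = 0 then 1 else 0)) G"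
    by (auto simp: card_wsets_0)
  then show ?case by blast
next
  case (Suc D)
  then obtain \<Lambda> where \<Lambda>: "\<And>n. ((\<lambda>i. card (wsets (P i) w D n) / Q i ^ n) \<longlongrightarrow> \<Lambda> n) G"
    by metis
  from N[of "Suc D"] obtain \<nu>
    where \<nu>: "((\<lambda>i. card {x \<in> P i. w x = Suc D} / Q i ^ Suc D) \<longlongrightarrow> \<nu>) G" by auto
  let ?N = "\<lambda>i. card {x \<in> P i. w x = Suc D}"
  have Q0: "\<forall>\<^sub>F i in G. Q i > 0" using Q by (simp add: filterlim_at_top_dense)
  have b: "((\<lambda>i. real (?N i choose k) / Q i ^ (k * Suc D)) \<longlongrightarrow> \<nu> ^ k / fact k) G" for k
    by (rule binomial_tendsto[OF Q _ \<nu>]) simp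
  have lim: "((\<lambda>i. \<Sum>k\<le>n div Suc D. real (?N i choose k) / Q i ^ (k * Suc D) *
        (card (wsets (P i) w D (n - k * Suc D)) / Q i ^ (n - k * Suc D)))
      \<longlongrightarrow> (\<Sum>k\<le>n div Suc D. \<nu> ^ k / fact k * \<Lambda> (n - k * Suc D))) G"
    by (intro tendsto_sum tendsto_mult b \<Lambda>)
  have eq: "\<forall>\<^sub>F i in G. (\<Sum>k\<le>n div Suc D. real (?N i choose k) / Q i ^ (k * Suc D) *
        (card (wsets (P i) w D (n - k * Suc D)) / Q i ^ (n - k * Suc D)))
      = card (wsets (P i) w (Suc D) n) / Q i ^ n"
    using fin Q0
  proof eventually_elim
    case (elim i)
    have "real (card (wsets (P i) w (Suc D) n)) / Q i ^ n = (\<Sum>k\<le>n div Suc D.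
        real (?N i choose k) * card (wsets (P i) w D (n - k * Suc D)) / Q i ^ n)"
      using card_wsets_Suc[of "P i" w D n] elim by (simp add: sum_divide_distrib)
    also have "\<dots> = (\<Sum>k\<le>n div Suc D. real (?N i choose k) / Q i ^ (k * Suc D) *
        (card (wsets (P i) w D (n - k * Suc D)) / Q i ^ (n - k * Suc D)))"
    proof (rule sum.cong[OF refl])
      fix k assume "k \<in> {..n div Suc D}"
      then have "k * Suc D \<le> n" by (simp add: less_eq_div_iff_mult_less_eq)
      then have "Q i ^ n = Q i ^ (k * Suc D) * Q i ^ (n - k * Suc D)"
        by (simp flip: power_add)
      then show "real (?N i choose k) * card (wsets (P i) w D (n - k * Suc D)) / Q i ^ n =
        real (?N i choose k) / Q i ^ (k * Suc D) *
        (card (wsets (P i) w D (n - k * Suc D)) / Q i ^ (n - k * Suc D))" by simp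
    qed
    finally show ?case by simp
  qed
  show ?case by (rule exI, rule Lim_transform_eventually[OF lim eq])
qed

text \<open>Strong induction on m: a proper divisor d contributes N_d = O(Q^d), negligible against
  Q^m, so only d = m survives and the limit is 1 / (m r(m)).\<close>

lemma divisor_sum_inversion_tendsto:
  fixes Q :: "'i \<Rightarrow> real" and N :: "'i \<Rightarrow> nat \<Rightarrow> nat" and r :: "nat \<Rightarrow> real"
  assumes Q: "filterlim Q at_top G"
    and N: "\<And>m. m \<ge> 1 \<Longrightarrow> \<forall>\<^sub>F i in G. real (\<Sum>d | d dvd m. d * N i d) = (Q i ^ m - 1) / r m"
    and "m \<ge> 1"
  shows "\<exists>\<nu>. ((\<lambda>i. N i m / Q i ^ m) \<longlongrightarrow> \<nu>) G"
  using \<open>m \<ge> 1\<close>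
proof (induction m rule: less_induct)
  case (less m)
  have Q0: "\<forall>\<^sub>F i in G. Q i > 0" using Q by (simp add: filterlim_at_top_dense)
  let ?D = "{d. d dvd m} - {m}"
  have finD: "finite ?D" using less.prems by simp
  have small: "((\<lambda>i. N i d / Q i ^ m) \<longlongrightarrow> 0) G" if "d \<in> ?D" for d
  proof -
    have d: "d < m" "d \<ge> 1" using that less.prems by (auto dest: dvd_imp_le intro: Suc_leI dvd_pos_nat)
    obtain \<nu> where "((\<lambda>i. N i d / Q i ^ d) \<longlongrightarrow> \<nu>) G" using less.IH[OF d] by blast
    then have "((\<lambda>i. N i d / Q i ^ d * (1 / Q i ^ (m - d))) \<longlongrightarrow> \<nu> * 0) G"
      using d by (intro tendsto_intros tendsto_inverse_power_at_top Q) auto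
    moreover have "N i d / Q i ^ d * (1 / Q i ^ (m - d)) = N i d / Q i ^ m" for i
      using d by (simp flip: power_add)
    ultimately show ?thesis by (simp only: mult_zero_right)
  qed
  have lim: "((\<lambda>i. ((1 - 1 / Q i ^ m) / r m - (\<Sum>d\<in>?D. real d * (N i d / Q i ^ m))) / real m)
      \<longlongrightarrow> ((1 - 0) / r m - (\<Sum>d\<in>?D. real d * 0)) / real m) G"
    unfolding divide_inverse[of _ "r m"]
    using less.prems by (intro tendsto_intros tendsto_inverse_power_at_top Q small) auto
  have eq: "\<forall>\<^sub>F i in G. ((1 - 1 / Q i ^ m) / r m - (\<Sum>d\<in>?D. real d * (N i d / Q i ^ m))) / real m
      = N i m / Q i ^ m"
    using N[OF less.prems] Q0
  proof eventually_elim
    case (elim i)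
    have "(\<Sum>d | d dvd m. d * N i d) = m * N i m + (\<Sum>d\<in>?D. d * N i d)"
      using less.prems by (intro sum.remove) auto
    then have "real m * N i m = (Q i ^ m - 1) / r m - (\<Sum>d\<in>?D. real d * N i d)"
      using elim(1) by simp
    then have "real m * N i m / Q i ^ m = (Q i ^ m - 1) / r m / Q i ^ m - (\<Sum>d\<in>?D. real d * N i d) / Q i ^ m"
      by (simp add: diff_divide_distrib)
    also have "\<dots> = (1 - 1 / Q i ^ m) / r m - (\<Sum>d\<in>?D. real d * (N i d / Q i ^ m))"
      using elim(2) by (simp add: sum_divide_distrib diff_divide_distrib)
    finally show ?case using less.prems by (simp add: field_simps)
  qed
  show ?case by (rule exI, rule Lim_transform_eventually[OF lim eq])
qed

section \<open>Lifting the exponent: the L-adic valuation of q^m - 1\<close>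

lemma one_plus_power_mod_square: "\<exists>k. (1 + a) ^ i = 1 + i * a + k * a\<^sup>2" for a :: nat
proof (induction i)
  case (Suc i)
  then obtain k where "(1 + a) ^ i = 1 + i * a + k * a\<^sup>2" by blast
  then have "(1 + a) ^ Suc i = 1 + Suc i * a + (i + k + k * a) * a\<^sup>2"
    by (simp add: algebra_simps power2_eq_square)
  then show ?case by blast
qed (auto intro: exI[of _ 0])

lemma power_minus_one_eq: "q ^ m - 1 = (q - 1) * (\<Sum>i<m. q ^ i)" if "q \<ge> 1" for q :: nat
proof -
  have "int (q ^ m - 1) = int ((q - 1) * (\<Sum>i<m. q ^ i))"
    using that power_diff_1_eq[of "int q" m] by (simp add: of_nat_diff)
  then show ?thesis using of_nat_eq_iff by blast
qed

text \<open>As q = 1 modulo L, the cofactor 1 + q + ... + q^(m-1) of q - 1 is congruent to m and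
  hence prime to L.\<close>

lemma multiplicity_power_minus_one_coprime:
  fixes q L m :: nat
  assumes L: "Factorial_Ring.prime L" and q: "q > 1" "L dvd q - 1" and m: "\<not> L dvd m"
  shows "multiplicity L (q ^ m - 1) = multiplicity L (q - 1)"
proof -
  have "[q = 1] (mod L)" using q by (simp add: cong_altdef_nat)
  then have "[(\<Sum>i<m. q ^ i) = (\<Sum>i<m. 1 ^ i)] (mod L)" by (intro cong_sum cong_pow)
  then have "[(\<Sum>i<m. q ^ i) = m] (mod L)" by simp
  then have "\<not> L dvd (\<Sum>i<m. q ^ i)" using m cong_dvd_iff by blast
  then have "multiplicity L (\<Sum>i<m. q ^ i) = 0" by (rule not_dvd_imp_multiplicity_0)
  moreover have "(\<Sum>i<m. q ^ i) \<noteq> 0" using \<open>\<not> L dvd (\<Sum>i<m. q ^ i)\<close> by (metis dvd_0_right)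
  ultimately show ?thesis
    using power_minus_one_eq[of q m] q L by (simp add: prime_elem_multiplicity_mult_distrib)
qed

text \<open>With q = 1 + L b the cofactor of q - 1 is L + (L b) L (L - 1)/2 modulo L^2. As L is odd,
  (L - 1)/2 is an integer, so the cofactor is L times a number congruent to 1 modulo L. For L = 2
  this fails: with q = 3, q - 1 = 2 has valuation 1 but q^2 - 1 = 8 has valuation 3.\<close>

lemma multiplicity_power_prime_minus_one:
  fixes q L :: nat
  assumes L: "Factorial_Ring.prime L" "L \<noteq> 2" and q: "q > 1" "L dvd q - 1"
  shows "multiplicity L (q ^ L - 1) = Suc (multiplicity L (q - 1))"
proof -
  obtain b where "q - 1 = L * b" using q by (elim dvdE)
  then have b: "q = 1 + L * b" using q by simp
  obtain k where k: "\<And>i. q ^ i = 1 + i * (L * b) + k i * (L * b)\<^sup>2"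
  proof -
    have "\<exists>k. \<forall>i. q ^ i = 1 + i * (L * b) + k i * (L * b)\<^sup>2"
      unfolding b by (rule choice) (use one_plus_power_mod_square in blast)
    then show ?thesis using that by blast
  qed
  have "odd L" using L prime_odd_nat prime_ge_2_nat[OF L(1)] by (metis le_neq_implies_less)
  then obtain h where h: "L = 2 * h + 1" by (auto elim: oddE)
  have s: "(\<Sum>i<L. i) = L * h"
  proof -
    have "(\<Sum>i<2 * h + 1. i) = (2 * h + 1) * h" for h :: nat by (induction h) auto
    then show ?thesis using h by simp
  qed
  let ?s = "1 + L * (b * h + b\<^sup>2 * (\<Sum>i<L. k i))"
  have "(\<Sum>i<L. q ^ i) = L + (\<Sum>i<L. i) * (L * b) + (\<Sum>i<L. k i) * (L * b)\<^sup>2"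
    by (simp only: k sum.distrib sum_distrib_right sum_constant card_lessThan mult_1_right of_nat_id)
  also have "\<dots> = L * ?s"
    unfolding s by (simp add: algebra_simps power2_eq_square)
  finally have S: "(\<Sum>i<L. q ^ i) = L * ?s" .
  have "\<not> L dvd ?s"
    using L(1) by (metis dvd_add_times_triv_right_iff mult.commute not_prime_unit)
  then have "multiplicity L ?s = 0" by (rule not_dvd_imp_multiplicity_0)
  then have "multiplicity L (L * ?s) = 1"
    using L(1) prime_gt_0_nat[OF L(1)] by (subst prime_elem_multiplicity_mult_distrib) auto
  moreover have "L * ?s \<noteq> 0" using prime_gt_0_nat[OF L(1)] by simp
  ultimately show ?thesis
    using power_minus_one_eq[of q L] q L(1) S by (simp add: prime_elem_multiplicity_mult_distrib del: add_is_0)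
qed

text \<open>Induction removes one factor L of m at a time: for m = L m' the prime step is applied to
  the base q^m', which is again 1 modulo L.\<close>

lemma multiplicity_power_minus_one:
  fixes q L m :: nat
  assumes L: "Factorial_Ring.prime L" "L \<noteq> 2" and q: "q > 1" "L dvd q - 1" and "m > 0"
  shows "multiplicity L (q ^ m - 1) = multiplicity L (q - 1) + multiplicity L m"
  using \<open>m > 0\<close>
proof (induction m rule: less_induct)
  case (less m)
  show ?case
  proof (cases "L dvd m")
    case True
    then obtain m' where m': "m = L * m'" by blast
    have m'0: "m' > 0" "m' < m" using less.prems m' prime_gt_1_nat[OF L(1)] by auto
    have "q ^ m' > 1" using q m'0 by (intro one_less_power)
    moreover have "L dvd q ^ m' - 1" using power_minus_one_eq[of q m'] q by simp
    ultimately have "multiplicity L ((q ^ m') ^ L - 1) = Suc (multiplicity L (q ^ m' - 1))"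
      by (rule multiplicity_power_prime_minus_one[OF L])
    moreover have "multiplicity L m = Suc (multiplicity L m')"
      using m' m'0 L(1) by (simp add: prime_elem_multiplicity_mult_distrib prime_gt_0_nat)
    ultimately show ?thesis using less.IH[OF m'0(2,1)] m'
      by (simp add: mult.commute flip: power_mult)
  next
    case False
    then show ?thesis
      using multiplicity_power_minus_one_coprime[OF L(1) q False] by (simp add: not_dvd_imp_multiplicity_0)
  qed
qed

section \<open>Determinants over a commutative ring\<close>

lemma finite_permutes: "finite {\<sigma>. \<sigma> permutes {..<l::nat}}"
  by (rule finite_permutations) simp

context cring
begin

lemma finsum_uminus:
  assumes "finite A" "f \<in> A \<rightarrow> carrier R"
  shows "(\<Oplus>x\<in>A. \<ominus> f x) = \<ominus> (\<Oplus>x\<in>A. f x)"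
proof -
  have "(\<Oplus>x\<in>A. \<ominus> f x) \<oplus> (\<Oplus>x\<in>A. f x) = (\<Oplus>x\<in>A. \<ominus> f x \<oplus> f x)"
    using assms by (intro finsum_addf[symmetric]) auto
  also have "\<dots> = (\<Oplus>x\<in>A. \<zero>)" using assms by (intro finsum_cong') (auto simp: l_neg Pi_iff)
  finally have "(\<Oplus>x\<in>A. \<ominus> f x) \<oplus> (\<Oplus>x\<in>A. f x) = \<zero>" by simp
  then show ?thesis using assms by (intro minus_equality[symmetric]) (auto intro!: finsum_closed)
qed

lemma finsum_swap:
  assumes "finite A" "finite B" "\<And>x y. x \<in> A \<Longrightarrow> y \<in> B \<Longrightarrow> f x y \<in> carrier R"
  shows "(\<Oplus>x\<in>A. \<Oplus>y\<in>B. f x y) = (\<Oplus>y\<in>B. \<Oplus>x\<in>A. f x y)"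
  using assms(1,3)
proof (induction A rule: finite_induct)
  case (insert a A)
  have c: "(\<lambda>y. f a y) \<in> B \<rightarrow> carrier R" "(\<lambda>y. \<Oplus>x\<in>A. f x y) \<in> B \<rightarrow> carrier R"
    using insert.prems by (auto intro!: finsum_closed)
  have "(\<Oplus>x\<in>insert a A. \<Oplus>y\<in>B. f x y) = (\<Oplus>y\<in>B. f a y) \<oplus> (\<Oplus>y\<in>B. \<Oplus>x\<in>A. f x y)"
    using insert by (subst finsum_insert) (auto intro!: finsum_closed)
  also have "\<dots> = (\<Oplus>y\<in>B. f a y \<oplus> (\<Oplus>x\<in>A. f x y))"
    using c by (simp add: finsum_addf)
  also have "\<dots> = (\<Oplus>y\<in>B. \<Oplus>x\<in>insert a A. f x y)"
    using insert by (intro finsum_cong') (auto intro!: finsum_closed)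
  finally show ?case .
qed (simp add: finsum_zero)

lemma add_pow_sign:
  assumes "x \<in> carrier R"
  shows "add_pow R (sign \<sigma>) x = (if evenperm \<sigma> then x else \<ominus> x)"
  using assms add.int_pow_1[of x] add.int_pow_neg[of x 1] by (simp add: sign_def)

definition replace_row :: "(nat \<times> nat \<Rightarrow> 'a) \<Rightarrow> nat \<Rightarrow> (nat \<Rightarrow> 'a) \<Rightarrow> nat \<times> nat \<Rightarrow> 'a" where
  "replace_row N k r = (\<lambda>(i, j). if i = k then r j else N (i, j))"

text \<open>A single signed term of the Leibniz formula with the factor of row \<open>k\<close>
  removed, hence one summand of a cofactor. Keeping the index \<sigma> instead of grouping by the
  value \<sigma> k makes the determinant a plain finite sum that is visibly linear in row
  \<open>k\<close>.\<close>

definition row_cofactor :: "nat \<Rightarrow> (nat \<times> nat \<Rightarrow> 'a) \<Rightarrow> nat \<Rightarrow> (nat \<Rightarrow> nat) \<Rightarrow> 'a" where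
  "row_cofactor l N k \<sigma> = add_pow R (sign \<sigma>) (\<Otimes>i\<in>{..<l} - {k}. N (i, \<sigma> i))"

lemma row_cofactor_closed:
  assumes "\<And>i j. i < l \<Longrightarrow> j < l \<Longrightarrow> N (i, j) \<in> carrier R" "\<sigma> permutes {..<l}"
  shows "row_cofactor l N k \<sigma> \<in> carrier R"
proof -
  have "\<sigma> i < l" if "i < l" for i using assms(2) that permutes_in_image by fastforce
  then have "(\<Otimes>i\<in>{..<l} - {k}. N (i, \<sigma> i)) \<in> carrier R" using assms(1) by (intro finprod_closed) auto
  then show ?thesis unfolding row_cofactor_def by (simp add: add_pow_sign)
qed

lemma mat_det_replace_row:
  assumes N: "\<And>i j. i < l \<Longrightarrow> j < l \<Longrightarrow> N (i, j) \<in> carrier R"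
    and r: "\<And>j. j < l \<Longrightarrow> r j \<in> carrier R" and k: "k < l"
  shows "mat_det R l (replace_row N k r) =
    (\<Oplus>\<sigma>\<in>{\<sigma>. \<sigma> permutes {..<l}}. r (\<sigma> k) \<otimes> row_cofactor l N k \<sigma>)"
  unfolding mat_det_def
proof (rule finsum_cong'[OF refl])
  show "(\<lambda>\<sigma>. r (\<sigma> k) \<otimes> row_cofactor l N k \<sigma>) \<in> {\<sigma>. \<sigma> permutes {..<l}} \<rightarrow> carrier R"
    using r k row_cofactor_closed[of l N, OF N] permutes_in_image by (fastforce intro!: m_closed)
next
  fix \<sigma> assume "\<sigma> \<in> {\<sigma>. \<sigma> permutes {..<l}}"
  then have \<sigma>: "\<And>i. i < l \<Longrightarrow> \<sigma> i < l" using permutes_in_image by fastforce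
  have c: "(\<Otimes>i\<in>{..<l} - {k}. N (i, \<sigma> i)) \<in> carrier R" using N \<sigma> by (intro finprod_closed) auto
  have "(\<Otimes>i\<in>{..<l}. replace_row N k r (i, \<sigma> i)) = (\<Otimes>i\<in>insert k ({..<l} - {k}). replace_row N k r (i, \<sigma> i))"
    using k by (simp add: insert_absorb)
  also have "\<dots> = r (\<sigma> k) \<otimes> (\<Otimes>i\<in>{..<l} - {k}. replace_row N k r (i, \<sigma> i))"
    using N r k \<sigma> by (subst finprod_insert) (auto simp: replace_row_def)
  also have "(\<Otimes>i\<in>{..<l} - {k}. replace_row N k r (i, \<sigma> i)) = (\<Otimes>i\<in>{..<l} - {k}. N (i, \<sigma> i))"
    using N \<sigma> by (intro finprod_cong') (auto simp: replace_row_def)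
  finally show "add_pow R (sign \<sigma>) (\<Otimes>i\<in>{..<l}. replace_row N k r (i, \<sigma> i)) = r (\<sigma> k) \<otimes> row_cofactor l N k \<sigma>"
    using c r[OF \<sigma>[OF k]] by (simp add: row_cofactor_def add_pow_sign r_minus)
qed

lemma mat_det_closed:
  assumes "\<And>i j. i < l \<Longrightarrow> j < l \<Longrightarrow> N (i, j) \<in> carrier R"
  shows "mat_det R l N \<in> carrier R"
  unfolding mat_det_def
proof (rule finsum_closed, rule Pi_I)
  fix \<sigma> assume "\<sigma> \<in> {\<sigma>. \<sigma> permutes {..<l}}"
  then have \<sigma>: "\<And>i. i < l \<Longrightarrow> \<sigma> i < l" using permutes_in_image by fastforce
  have "(\<Otimes>i\<in>{..<l}. N (i, \<sigma> i)) \<in> carrier R" using assms \<sigma> by (intro finprod_closed) auto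
  then show "add_pow R (sign \<sigma>) (\<Otimes>i\<in>{..<l}. N (i, \<sigma> i)) \<in> carrier R" by (simp add: add_pow_sign)
qed

text \<open>Composition with the transposition of i and k matches even with odd permutations, and
  matched terms cancel. The cancellation is termwise, so it also holds in characteristic 2, where
  det = - det says nothing.\<close>

lemma mat_det_equal_rows:
  assumes N: "\<And>i j. i < l \<Longrightarrow> j < l \<Longrightarrow> N (i, j) \<in> carrier R"
    and ik: "i < l" "k < l" "i \<noteq> k" and eq: "\<And>j. j < l \<Longrightarrow> N (i, j) = N (k, j)"
  shows "mat_det R l N = \<zero>"
proof -
  let ?t = "\<lambda>\<sigma>. add_pow R (sign \<sigma>) (\<Otimes>i\<in>{..<l}. N (i, \<sigma> i))"
  let ?\<tau> = "Transposition.transpose i k"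
  let ?E = "{\<sigma>. \<sigma> permutes {..<l} \<and> evenperm \<sigma>}"
  let ?O = "{\<sigma>. \<sigma> permutes {..<l} \<and> \<not> evenperm \<sigma>}"
  have \<tau>: "?\<tau> permutes {..<l}" using ik by (intro permutes_swap_id) auto
  have prod_closed: "(\<Otimes>i\<in>{..<l}. N (i, \<sigma> i)) \<in> carrier R" if "\<sigma> permutes {..<l}" for \<sigma>
    using that N permutes_in_image by (fastforce intro!: finprod_closed)
  then have t_closed: "?t \<sigma> \<in> carrier R" if "\<sigma> permutes {..<l}" for \<sigma>
    using that by (simp add: add_pow_sign)
  have flip: "?t (\<sigma> \<circ> ?\<tau>) = \<ominus> ?t \<sigma>" and parity: "evenperm (\<sigma> \<circ> ?\<tau>) \<longleftrightarrow> \<not> evenperm \<sigma>"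
    if \<sigma>: "\<sigma> permutes {..<l}" for \<sigma>
  proof -
    have "permutation \<sigma>" using \<sigma> by (auto intro: permutes_imp_permutation)
    then show par: "evenperm (\<sigma> \<circ> ?\<tau>) \<longleftrightarrow> \<not> evenperm \<sigma>"
      using ik by (simp add: evenperm_comp permutation_swap_id evenperm_swap)
    have lt: "\<sigma> j < l" if "j < l" for j using that \<sigma> permutes_in_image by fastforce
    have lt': "?\<tau> j < l" if "j < l" for j using that \<tau> permutes_in_image by fastforce
    \<comment> \<open>Rows i and k agree, so row j may be replaced by row \<tau> j; after reindexing
      by \<tau> the product for \<sigma> \<circ> \<tau> is the one for \<sigma>.\<close>
    have "(\<Otimes>j\<in>{..<l}. N (j, (\<sigma> \<circ> ?\<tau>) j)) = (\<Otimes>j\<in>{..<l}. N (?\<tau> j, \<sigma> (?\<tau> j)))"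
    proof (rule finprod_cong'[OF refl])
      show "(\<lambda>j. N (?\<tau> j, \<sigma> (?\<tau> j))) \<in> {..<l} \<rightarrow> carrier R" using N lt lt' by auto
      fix j assume "j \<in> {..<l}"
      then have "\<sigma> (?\<tau> j) < l" using lt lt' by simp
      then show "N (j, (\<sigma> \<circ> ?\<tau>) j) = N (?\<tau> j, \<sigma> (?\<tau> j))"
        using eq by (auto simp: Transposition.transpose_def)
    qed
    also have "\<dots> = (\<Otimes>j\<in>?\<tau> ` {..<l}. N (j, \<sigma> j))"
      using N lt lt' by (intro finprod_reindex[symmetric] inj_on_transpose) auto
    also have "?\<tau> ` {..<l} = {..<l}" using \<tau> by (rule permutes_image)
    finally show "?t (\<sigma> \<circ> ?\<tau>) = \<ominus> ?t \<sigma>"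
      using prod_closed[OF \<sigma>] par by (simp add: add_pow_sign)
  qed
  have fin: "finite ?E" "finite ?O" using finite_permutes by (auto intro: finite_subset[rotated])
  have O: "?O = (\<lambda>\<sigma>. \<sigma> \<circ> ?\<tau>) ` ?E"
  proof (intro equalityI subsetI)
    fix \<sigma> assume "\<sigma> \<in> ?O"
    then have "\<sigma> = (\<sigma> \<circ> ?\<tau>) \<circ> ?\<tau>" "\<sigma> \<circ> ?\<tau> \<in> ?E"
      using parity permutes_compose[OF \<tau>] by (auto simp: o_assoc[symmetric])
    then show "\<sigma> \<in> (\<lambda>\<sigma>. \<sigma> \<circ> ?\<tau>) ` ?E" by blast
  next
    fix \<sigma> assume "\<sigma> \<in> (\<lambda>\<sigma>. \<sigma> \<circ> ?\<tau>) ` ?E"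
    then show "\<sigma> \<in> ?O" using parity permutes_compose[OF \<tau>] by auto
  qed
  have inj: "inj_on (\<lambda>\<sigma>. \<sigma> \<circ> ?\<tau>) ?E"
    by (rule inj_onI) (metis comp_assoc transpose_comp_involutory comp_id)
  have "mat_det R l N = (\<Oplus>\<sigma>\<in>?E \<union> ?O. ?t \<sigma>)"
    unfolding mat_det_def by (rule arg_cong[where f = "finsum R _"]) auto
  also have "\<dots> = (\<Oplus>\<sigma>\<in>?E. ?t \<sigma>) \<oplus> (\<Oplus>\<sigma>\<in>?O. ?t \<sigma>)"
    using fin t_closed by (intro finsum_Un_disjoint) auto
  also have "(\<Oplus>\<sigma>\<in>?O. ?t \<sigma>) = (\<Oplus>\<sigma>\<in>?E. ?t (\<sigma> \<circ> ?\<tau>))"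
    unfolding O using t_closed permutes_compose[OF \<tau>] inj by (intro finsum_reindex) auto
  also have "\<dots> = (\<Oplus>\<sigma>\<in>?E. \<ominus> ?t \<sigma>)"
    using t_closed flip by (intro finsum_cong') auto
  also have "\<dots> = \<ominus> (\<Oplus>\<sigma>\<in>?E. ?t \<sigma>)"
    using fin t_closed by (intro finsum_uminus) auto
  finally show ?thesis using t_closed by (simp add: r_neg finsum_closed Pi_iff)
qed

text \<open>Expanding linearly in row k, every summand with i \<noteq> k has two equal rows and
  vanishes. It serves as a form of Cramer's rule: if all entries of the row w N are divisible by f,
  then so is w_k det N.\<close>

lemma mat_det_row_combination:
  assumes N: "\<And>i j. i < l \<Longrightarrow> j < l \<Longrightarrow> N (i, j) \<in> carrier R"
    and w: "\<And>i. i < l \<Longrightarrow> w i \<in> carrier R" and k: "k < l"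
  shows "w k \<otimes> mat_det R l N = mat_det R l (replace_row N k (\<lambda>j. \<Oplus>i\<in>{..<l}. w i \<otimes> N (i, j)))"
proof -
  let ?P = "{\<sigma>. \<sigma> permutes {..<l}}"
  have lt: "\<sigma> j < l" if "\<sigma> \<in> ?P" "j < l" for \<sigma> j using that permutes_in_image by fastforce
  have cof: "row_cofactor l N k \<sigma> \<in> carrier R" if "\<sigma> \<in> ?P" for \<sigma>
    using row_cofactor_closed[of l N, OF N] that by auto
  have row: "mat_det R l (replace_row N k (\<lambda>j. N (i, j))) = (if i = k then mat_det R l N else \<zero>)"
    if "i < l" for i
  proof (cases "i = k")
    case True
    then have "replace_row N k (\<lambda>j. N (i, j)) = N" by (auto simp: replace_row_def fun_eq_iff)
    then show ?thesis using True by simp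
  next
    case False
    then show ?thesis using that k N
      by (subst mat_det_equal_rows[of l _ i k]) (auto simp: replace_row_def)
  qed
  have "mat_det R l (replace_row N k (\<lambda>j. \<Oplus>i\<in>{..<l}. w i \<otimes> N (i, j)))
      = (\<Oplus>\<sigma>\<in>?P. (\<Oplus>i\<in>{..<l}. w i \<otimes> N (i, \<sigma> k)) \<otimes> row_cofactor l N k \<sigma>)"
    using N w k by (intro mat_det_replace_row) (auto intro!: finsum_closed)
  also have "\<dots> = (\<Oplus>\<sigma>\<in>?P. \<Oplus>i\<in>{..<l}. w i \<otimes> (N (i, \<sigma> k) \<otimes> row_cofactor l N k \<sigma>))"
  proof (rule finsum_cong'[OF refl])
    fix \<sigma> assume s: "\<sigma> \<in> ?P"
    have "(\<Oplus>i\<in>{..<l}. w i \<otimes> N (i, \<sigma> k)) \<otimes> row_cofactor l N k \<sigma>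
        = (\<Oplus>i\<in>{..<l}. (w i \<otimes> N (i, \<sigma> k)) \<otimes> row_cofactor l N k \<sigma>)"
      using N w lt[OF s k] cof[OF s] by (intro finsum_ldistr) auto
    also have "\<dots> = (\<Oplus>i\<in>{..<l}. w i \<otimes> (N (i, \<sigma> k) \<otimes> row_cofactor l N k \<sigma>))"
      using N w lt[OF s k] cof[OF s] by (intro finsum_cong') (auto simp: m_assoc)
    finally show "(\<Oplus>i\<in>{..<l}. w i \<otimes> N (i, \<sigma> k)) \<otimes> row_cofactor l N k \<sigma>
        = (\<Oplus>i\<in>{..<l}. w i \<otimes> (N (i, \<sigma> k) \<otimes> row_cofactor l N k \<sigma>))" .
  qed (use N w k lt cof in \<open>auto intro!: finsum_closed\<close>)
  also have "\<dots> = (\<Oplus>i\<in>{..<l}. \<Oplus>\<sigma>\<in>?P. w i \<otimes> (N (i, \<sigma> k) \<otimes> row_cofactor l N k \<sigma>))"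
    using N w k lt cof finite_permutes by (intro finsum_swap) auto
  also have "\<dots> = (\<Oplus>i\<in>{..<l}. if i = k then w k \<otimes> mat_det R l N else \<zero>)"
  proof (rule finsum_cong'[OF refl])
    fix i assume i: "i \<in> {..<l}"
    have "(\<Oplus>\<sigma>\<in>?P. w i \<otimes> (N (i, \<sigma> k) \<otimes> row_cofactor l N k \<sigma>))
        = w i \<otimes> (\<Oplus>\<sigma>\<in>?P. N (i, \<sigma> k) \<otimes> row_cofactor l N k \<sigma>)"
      using N w i k lt cof finite_permutes by (intro finsum_rdistr[symmetric]) auto
    also have "(\<Oplus>\<sigma>\<in>?P. N (i, \<sigma> k) \<otimes> row_cofactor l N k \<sigma>)
        = mat_det R l (replace_row N k (\<lambda>j. N (i, j)))"
      using N i k by (intro mat_det_replace_row[symmetric]) auto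
    also have "\<dots> = (if i = k then mat_det R l N else \<zero>)" using row i by simp
    finally show "(\<Oplus>\<sigma>\<in>?P. w i \<otimes> (N (i, \<sigma> k) \<otimes> row_cofactor l N k \<sigma>))
        = (if i = k then w k \<otimes> mat_det R l N else \<zero>)" using w i by simp
  qed (use w k mat_det_closed[of l N, OF N] in auto)
  also have "\<dots> = w k \<otimes> mat_det R l N"
    using finsum_singleton[of k "{..<l}" "\<lambda>_. w k \<otimes> mat_det R l N"] w k mat_det_closed[of l N, OF N]
    by (simp add: eq_commute cong: if_cong)
  finally show ?thesis by simp
qed

end

section \<open>Matrices acting on rows\<close>

lemma mat_ring_simps:
  "carrier (mat_ring R l) = ({..<l} \<times> {..<l}) \<rightarrow>\<^sub>E carrier R"
  "mult (mat_ring R l) A B = (\<lambda>(i, j) \<in> {..<l} \<times> {..<l}. \<Oplus>\<^bsub>R\<^esub>k\<in>{..<l}. A (i, k) \<otimes>\<^bsub>R\<^esub> B (k, j))"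
  "one (mat_ring R l) = (\<lambda>(i, j) \<in> {..<l} \<times> {..<l}. if i = j then \<one>\<^bsub>R\<^esub> else \<zero>\<^bsub>R\<^esub>)"
  by (simp_all add: mat_ring_def)

lemma mat_mult_entry:
  "i < l \<Longrightarrow> j < l \<Longrightarrow> mult (mat_ring R l) A B (i, j) = (\<Oplus>\<^bsub>R\<^esub>k\<in>{..<l}. A (i, k) \<otimes>\<^bsub>R\<^esub> B (k, j))"
  by (simp add: mat_ring_simps)

lemma mat_one_entry:
  "i < l \<Longrightarrow> j < l \<Longrightarrow> one (mat_ring R l) (i, j) = (if i = j then \<one>\<^bsub>R\<^esub> else \<zero>\<^bsub>R\<^esub>)"
  by (simp add: mat_ring_simps)

lemma mat_entry_closed:
  "A \<in> Mat l R \<Longrightarrow> i < l \<Longrightarrow> j < l \<Longrightarrow> A (i, j) \<in> carrier R"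
  by (auto simp: mat_ring_simps PiE_def Pi_def)

lemma mat_eqI:
  assumes "A \<in> Mat l R" "B \<in> Mat l R" "\<And>i j. i < l \<Longrightarrow> j < l \<Longrightarrow> A (i, j) = B (i, j)"
  shows "A = B"
  using assms by (intro PiE_ext[of A "{..<l} \<times> {..<l}"]) (auto simp: mat_ring_simps)

text \<open>A row vector over \<open>S\<close> times a matrix over \<open>R\<close>, with the
  entries transported by \<open>h\<close>. It is used with \<open>id\<close> for linear algebra over
  the field and with \<open>poly_of_const\<close>, where the row (1, X, ..., X^(l-1)) turns the
  columns of a matrix into polynomials.\<close>

definition row_act :: "('b, 'm) ring_scheme \<Rightarrow> ('a \<Rightarrow> 'b) \<Rightarrow> nat \<Rightarrow> (nat \<Rightarrow> 'b) \<Rightarrow> (nat \<times> nat \<Rightarrow> 'a) \<Rightarrow> nat \<Rightarrow> 'b" where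
  "row_act S h l v M j = (\<Oplus>\<^bsub>S\<^esub>i\<in>{..<l}. v i \<otimes>\<^bsub>S\<^esub> h (M (i, j)))"

context ring_hom_cring
begin

lemma row_act_closed:
  assumes "\<And>i. i < l \<Longrightarrow> v i \<in> carrier S" "M \<in> Mat l R" "j < l"
  shows "row_act S h l v M j \<in> carrier S"
  unfolding row_act_def using assms by (intro S.finsum_closed) (auto dest: mat_entry_closed)

lemma row_act_cong:
  assumes "\<And>i. i < l \<Longrightarrow> v i = w i" "\<And>i. i < l \<Longrightarrow> w i \<in> carrier S" "M \<in> Mat l R" "j < l"
  shows "row_act S h l v M j = row_act S h l w M j"
  unfolding row_act_def using assms by (intro S.finsum_cong') (auto dest: mat_entry_closed)

lemma row_act_add:
  assumes v: "\<And>i. i < l \<Longrightarrow> v i \<in> carrier S" and w: "\<And>i. i < l \<Longrightarrow> w i \<in> carrier S"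
    and "M \<in> Mat l R" "j < l"
  shows "row_act S h l (\<lambda>i. v i \<oplus>\<^bsub>S\<^esub> w i) M j = row_act S h l v M j \<oplus>\<^bsub>S\<^esub> row_act S h l w M j"
proof -
  have "row_act S h l (\<lambda>i. v i \<oplus>\<^bsub>S\<^esub> w i) M j
      = (\<Oplus>\<^bsub>S\<^esub>i\<in>{..<l}. v i \<otimes>\<^bsub>S\<^esub> h (M (i, j)) \<oplus>\<^bsub>S\<^esub> w i \<otimes>\<^bsub>S\<^esub> h (M (i, j)))"
    unfolding row_act_def using assms by (intro S.finsum_cong') (auto simp: S.l_distr dest: mat_entry_closed)
  then show ?thesis
    unfolding row_act_def using assms by (subst (asm) S.finsum_addf) (auto dest: mat_entry_closed)
qed

lemma row_act_scale:
  assumes v: "\<And>i. i < l \<Longrightarrow> v i \<in> carrier S" and "c \<in> carrier S" "M \<in> Mat l R" "j < l"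
  shows "row_act S h l (\<lambda>i. c \<otimes>\<^bsub>S\<^esub> v i) M j = c \<otimes>\<^bsub>S\<^esub> row_act S h l v M j"
proof -
  have "row_act S h l (\<lambda>i. c \<otimes>\<^bsub>S\<^esub> v i) M j = (\<Oplus>\<^bsub>S\<^esub>i\<in>{..<l}. c \<otimes>\<^bsub>S\<^esub> (v i \<otimes>\<^bsub>S\<^esub> h (M (i, j))))"
    unfolding row_act_def using assms by (intro S.finsum_cong') (auto simp: S.m_assoc dest: mat_entry_closed)
  then show ?thesis
    unfolding row_act_def using assms by (subst (asm) S.finsum_rdistr[symmetric]) (auto dest: mat_entry_closed)
qed

lemma row_act_single:
  assumes "c \<in> carrier S" "M \<in> Mat l R" "j < l" "k < l"
  shows "row_act S h l (\<lambda>i. if i = k then c else \<zero>\<^bsub>S\<^esub>) M j = c \<otimes>\<^bsub>S\<^esub> h (M (k, j))"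
proof -
  have "row_act S h l (\<lambda>i. if i = k then c else \<zero>\<^bsub>S\<^esub>) M j
      = (\<Oplus>\<^bsub>S\<^esub>i\<in>{..<l}. if k = i then c \<otimes>\<^bsub>S\<^esub> h (M (k, j)) else \<zero>\<^bsub>S\<^esub>)"
    unfolding row_act_def using assms by (intro S.finsum_cong') (auto dest: mat_entry_closed)
  also have "\<dots> = c \<otimes>\<^bsub>S\<^esub> h (M (k, j))"
    using assms by (intro S.finsum_singleton) (auto dest: mat_entry_closed)
  finally show ?thesis .
qed

lemma row_act_mult:
  assumes v: "\<And>i. i < l \<Longrightarrow> v i \<in> carrier S" and M: "M \<in> Mat l R" and N: "N \<in> Mat l R" and j: "j < l"
  shows "row_act S h l v (M \<otimes>\<^bsub>mat_ring R l\<^esub> N) j = row_act S h l (row_act S h l v M) N j"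
proof -
  note cl = v mat_entry_closed[OF M] mat_entry_closed[OF N]
  have "row_act S h l v (M \<otimes>\<^bsub>mat_ring R l\<^esub> N) j
      = (\<Oplus>\<^bsub>S\<^esub>i\<in>{..<l}. \<Oplus>\<^bsub>S\<^esub>k\<in>{..<l}. v i \<otimes>\<^bsub>S\<^esub> h (M (i, k)) \<otimes>\<^bsub>S\<^esub> h (N (k, j)))"
    unfolding row_act_def
  proof (rule S.finsum_cong'[OF refl])
    fix i assume "i \<in> {..<l}"
    then have i: "i < l" by simp
    have "h ((M \<otimes>\<^bsub>mat_ring R l\<^esub> N) (i, j)) = (\<Oplus>\<^bsub>S\<^esub>k\<in>{..<l}. h (M (i, k)) \<otimes>\<^bsub>S\<^esub> h (N (k, j)))"
      using i j cl by (subst mat_mult_entry) (auto simp: hom_finsum intro!: S.finsum_cong')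
    then have "v i \<otimes>\<^bsub>S\<^esub> h ((M \<otimes>\<^bsub>mat_ring R l\<^esub> N) (i, j))
        = (\<Oplus>\<^bsub>S\<^esub>k\<in>{..<l}. v i \<otimes>\<^bsub>S\<^esub> (h (M (i, k)) \<otimes>\<^bsub>S\<^esub> h (N (k, j))))"
      using i j cl by (simp add: S.finsum_rdistr Pi_iff)
    also have "\<dots> = (\<Oplus>\<^bsub>S\<^esub>k\<in>{..<l}. v i \<otimes>\<^bsub>S\<^esub> h (M (i, k)) \<otimes>\<^bsub>S\<^esub> h (N (k, j)))"
      using i j cl by (intro S.finsum_cong') (auto simp: S.m_assoc)
    finally show "v i \<otimes>\<^bsub>S\<^esub> h ((M \<otimes>\<^bsub>mat_ring R l\<^esub> N) (i, j))
        = (\<Oplus>\<^bsub>S\<^esub>k\<in>{..<l}. v i \<otimes>\<^bsub>S\<^esub> h (M (i, k)) \<otimes>\<^bsub>S\<^esub> h (N (k, j)))" .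
  qed (use j cl in \<open>auto intro!: S.finsum_closed\<close>)
  also have "\<dots> = (\<Oplus>\<^bsub>S\<^esub>k\<in>{..<l}. \<Oplus>\<^bsub>S\<^esub>i\<in>{..<l}. v i \<otimes>\<^bsub>S\<^esub> h (M (i, k)) \<otimes>\<^bsub>S\<^esub> h (N (k, j)))"
    using j cl by (intro S.finsum_swap) auto
  also have "\<dots> = row_act S h l (row_act S h l v M) N j"
    unfolding row_act_def using j cl
    by (intro S.finsum_cong') (auto simp: S.finsum_ldistr Pi_iff intro!: S.finsum_closed)
  finally show ?thesis .
qed

end

context cring
begin

lemma id_hom: "ring_hom_cring R R id"
  by (intro ring_hom_cring.intro ring_hom_cring_axioms.intro is_cring) (auto simp: ring_hom_def)

lemma mat_mult_row:
  "i < l \<Longrightarrow> j < l \<Longrightarrow> (A \<otimes>\<^bsub>mat_ring R l\<^esub> B) (i, j) = row_act R id l (\<lambda>k. A (i, k)) B j"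
  by (simp add: mat_mult_entry row_act_def)

lemma mat_mult_closed:
  assumes "A \<in> Mat l R" "B \<in> Mat l R"
  shows "A \<otimes>\<^bsub>mat_ring R l\<^esub> B \<in> Mat l R"
proof -
  have "A (i, k) \<otimes> B (k, j) \<in> carrier R" if "i < l" "j < l" "k < l" for i j k
    using assms that by (auto dest: mat_entry_closed)
  then show ?thesis by (auto simp: mat_ring_simps intro!: finsum_closed)
qed

text \<open>Associativity is the compatibility of the row action with products, applied to each row
  of A.\<close>

lemma mat_monoid: "Group.monoid (mat_ring R l)"
proof
  interpret id: ring_hom_cring R R id by (rule id_hom)
  fix A B C assume A: "A \<in> Mat l R" and B: "B \<in> Mat l R" and C: "C \<in> Mat l R"
  show "A \<otimes>\<^bsub>mat_ring R l\<^esub> B \<in> Mat l R" using A B by (rule mat_mult_closed)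
  show "A \<otimes>\<^bsub>mat_ring R l\<^esub> B \<otimes>\<^bsub>mat_ring R l\<^esub> C = A \<otimes>\<^bsub>mat_ring R l\<^esub> (B \<otimes>\<^bsub>mat_ring R l\<^esub> C)"
  proof (rule mat_eqI)
    fix i j assume ij: "i < l" "j < l"
    have "(A \<otimes>\<^bsub>mat_ring R l\<^esub> B \<otimes>\<^bsub>mat_ring R l\<^esub> C) (i, j)
        = row_act R id l (row_act R id l (\<lambda>k. A (i, k)) B) C j"
      using ij A B C unfolding mat_mult_row[OF ij]
      by (intro id.row_act_cong) (auto simp: mat_mult_row intro!: id.row_act_closed dest: mat_entry_closed)
    also have "\<dots> = (A \<otimes>\<^bsub>mat_ring R l\<^esub> (B \<otimes>\<^bsub>mat_ring R l\<^esub> C)) (i, j)"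
      using ij A B C by (auto simp: mat_mult_row intro!: id.row_act_mult[symmetric] dest: mat_entry_closed)
    finally show "(A \<otimes>\<^bsub>mat_ring R l\<^esub> B \<otimes>\<^bsub>mat_ring R l\<^esub> C) (i, j)
      = (A \<otimes>\<^bsub>mat_ring R l\<^esub> (B \<otimes>\<^bsub>mat_ring R l\<^esub> C)) (i, j)" .
  qed (use A B C in \<open>auto intro!: mat_mult_closed\<close>)
next
  interpret id: ring_hom_cring R R id by (rule id_hom)
  show one: "\<one>\<^bsub>mat_ring R l\<^esub> \<in> Mat l R" by (auto simp: mat_ring_simps)
  fix A assume A: "A \<in> Mat l R"
  show "\<one>\<^bsub>mat_ring R l\<^esub> \<otimes>\<^bsub>mat_ring R l\<^esub> A = A"
  proof (rule mat_eqI)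
    fix i j assume ij: "i < l" "j < l"
    have "(\<one>\<^bsub>mat_ring R l\<^esub> \<otimes>\<^bsub>mat_ring R l\<^esub> A) (i, j) = row_act R id l (\<lambda>k. if k = i then \<one> else \<zero>) A j"
      unfolding mat_mult_row[OF ij] using ij A by (intro id.row_act_cong) (auto simp: mat_one_entry)
    then show "(\<one>\<^bsub>mat_ring R l\<^esub> \<otimes>\<^bsub>mat_ring R l\<^esub> A) (i, j) = A (i, j)"
      using ij A id.row_act_single[of \<one> A l j i] by (simp add: mat_entry_closed)
  qed (use A one in \<open>auto intro!: mat_mult_closed\<close>)
  show "A \<otimes>\<^bsub>mat_ring R l\<^esub> \<one>\<^bsub>mat_ring R l\<^esub> = A"
  proof (rule mat_eqI)
    fix i j assume ij: "i < l" "j < l"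
    have "(A \<otimes>\<^bsub>mat_ring R l\<^esub> \<one>\<^bsub>mat_ring R l\<^esub>) (i, j) = (\<Oplus>k\<in>{..<l}. if j = k then A (i, k) else \<zero>)"
      unfolding mat_mult_entry[OF ij] using ij A
      by (intro finsum_cong') (auto simp: mat_one_entry mat_entry_closed)
    also have "\<dots> = A (i, j)" using ij A by (intro finsum_singleton) (auto simp: mat_entry_closed)
    finally show "(A \<otimes>\<^bsub>mat_ring R l\<^esub> \<one>\<^bsub>mat_ring R l\<^esub>) (i, j) = A (i, j)" .
  qed (use A one in \<open>auto intro!: mat_mult_closed\<close>)
qed

end

section \<open>Counting singular matrices\<close>

lemma card_Mat: "finite (carrier R) \<Longrightarrow> card (Mat l R) = card (carrier R) ^ (l * l)"
  by (simp add: mat_ring_simps card_PiE power_mult prod_constant)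

lemma finite_Mat: "finite (carrier R) \<Longrightarrow> finite (Mat l R)"
  by (simp add: mat_ring_simps finite_PiE)

context field
begin

text \<open>On the finite set of rows an injective self-map is onto, so the unit rows have
  preimages, and these are the rows of a left inverse.\<close>

lemma mat_Units_if_trivial_kernel:
  assumes fin: "finite (carrier R)" and M: "M \<in> Mat l R"
    and ker: "\<And>v. (\<And>i. i < l \<Longrightarrow> v i \<in> carrier R) \<Longrightarrow> (\<And>j. j < l \<Longrightarrow> row_act R id l v M j = \<zero>) \<Longrightarrow>
        (\<And>i. i < l \<Longrightarrow> v i = \<zero>)"
  shows "M \<in> GL l R"
proof -
  interpret id: ring_hom_cring R R id by (rule id_hom)
  interpret MM: Group.monoid "mat_ring R l" by (rule mat_monoid)
  have inj: "v i = w i" if v: "\<And>i. i < l \<Longrightarrow> v i \<in> carrier R" and w: "\<And>i. i < l \<Longrightarrow> w i \<in> carrier R"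
    and eq: "\<And>j. j < l \<Longrightarrow> row_act R id l v M j = row_act R id l w M j" and i: "i < l" for v w i
  proof -
    \<comment> \<open>The difference v - w is written with the scalar -1 so that
      \<open>row_act_add\<close> and \<open>row_act_scale\<close> apply.\<close>
    let ?u = "\<lambda>i. v i \<oplus> \<ominus> \<one> \<otimes> w i"
    have "row_act R id l ?u M j = \<zero>" if j: "j < l" for j
    proof -
      have "row_act R id l ?u M j = row_act R id l v M j \<oplus> \<ominus> \<one> \<otimes> row_act R id l w M j"
        using id.row_act_add[where v = v and w = "\<lambda>i. \<ominus> \<one> \<otimes> w i", OF v _ M j]
          id.row_act_scale[where c = "\<ominus> \<one>", OF w _ M j] w
        by simp
      also have "\<dots> = \<zero>" using eq[OF j] id.row_act_closed[OF w M j] by (simp add: l_minus r_neg)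
      finally show ?thesis .
    qed
    moreover have "?u i \<in> carrier R" if "i < l" for i using v w that by auto
    ultimately have "?u i = \<zero>" by (rule ker[of ?u, OF _ _ i, rotated])
    then have "v i \<ominus> w i = \<zero>" using w[OF i] by (simp add: l_minus a_minus_def)
    then show ?thesis using v[OF i] w[OF i] r_right_minus_eq by blast
  qed
  let ?V = "{..<l} \<rightarrow>\<^sub>E carrier R"
  let ?T = "\<lambda>v. restrict (row_act R id l v M) {..<l}"
  have "?T ` ?V = ?V"
  proof (rule endo_inj_surj)
    show "finite ?V" using fin by (simp add: finite_PiE)
    have "row_act R id l v M j \<in> carrier R" if "v \<in> ?V" "j < l" for v j
      by (rule id.row_act_closed[OF _ M \<open>j < l\<close>]) (use that in auto)
    then show "?T ` ?V \<subseteq> ?V" by (simp only: image_subset_iff restrict_PiE_iff lessThan_iff) blast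
    show "inj_on ?T ?V"
    proof (rule inj_onI)
      fix v w assume vw: "v \<in> ?V" "w \<in> ?V" and eq: "?T v = ?T w"
      have *: "row_act R id l v M j = row_act R id l w M j" if "j < l" for j
        using fun_cong[OF eq, of j] that by simp
      have "v i = w i" if "i < l" for i
        by (rule inj[OF _ _ * that]) (use vw in auto)
      then show "v = w" using vw by (intro PiE_ext[OF vw]) auto
    qed
  qed
  then have "\<exists>w\<in>?V. ?T w = (\<lambda>j\<in>{..<l}. \<one>\<^bsub>mat_ring R l\<^esub> (i, j))" if "i < l" for i
  proof -
    have "(\<lambda>j\<in>{..<l}. \<one>\<^bsub>mat_ring R l\<^esub> (i, j)) \<in> ?V" using that by (auto simp: mat_one_entry)
    then have "(\<lambda>j\<in>{..<l}. \<one>\<^bsub>mat_ring R l\<^esub> (i, j)) \<in> ?T ` ?V" using \<open>?T ` ?V = ?V\<close> by simp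
    then show ?thesis by (auto simp: image_iff eq_commute)
  qed
  then obtain w where w: "\<And>i. i < l \<Longrightarrow> w i \<in> ?V"
    "\<And>i. i < l \<Longrightarrow> ?T (w i) = (\<lambda>j\<in>{..<l}. \<one>\<^bsub>mat_ring R l\<^esub> (i, j))" by metis
  let ?W = "\<lambda>(i, j)\<in>{..<l} \<times> {..<l}. w i j"
  have W: "?W \<in> Mat l R" using w(1) by (fastforce simp: mat_ring_simps PiE_iff)
  have WM: "?W \<otimes>\<^bsub>mat_ring R l\<^esub> M = \<one>\<^bsub>mat_ring R l\<^esub>"
  proof (rule mat_eqI)
    fix i j assume ij: "i < l" "j < l"
    have "(?W \<otimes>\<^bsub>mat_ring R l\<^esub> M) (i, j) = row_act R id l (w i) M j"
      unfolding mat_mult_row[OF ij] using ij w(1)[of i] M by (intro id.row_act_cong) auto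
    then show "(?W \<otimes>\<^bsub>mat_ring R l\<^esub> M) (i, j) = \<one>\<^bsub>mat_ring R l\<^esub> (i, j)"
      using fun_cong[OF w(2)[OF ij(1)], of j] ij by simp
  qed (use W M in auto)
  \<comment> \<open>The products (M W) M and 1 M agree; injectivity of the row action of M, applied
    row by row, cancels M on the right.\<close>
  have MW: "M \<otimes>\<^bsub>mat_ring R l\<^esub> ?W = \<one>\<^bsub>mat_ring R l\<^esub>"
  proof (rule mat_eqI)
    have eq: "(M \<otimes>\<^bsub>mat_ring R l\<^esub> ?W) \<otimes>\<^bsub>mat_ring R l\<^esub> M = \<one>\<^bsub>mat_ring R l\<^esub> \<otimes>\<^bsub>mat_ring R l\<^esub> M"
      using W M WM by (simp add: MM.m_assoc)
    fix i j assume ij: "i < l" "j < l"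
    show "(M \<otimes>\<^bsub>mat_ring R l\<^esub> ?W) (i, j) = \<one>\<^bsub>mat_ring R l\<^esub> (i, j)"
    proof (rule inj[of "\<lambda>j. (M \<otimes>\<^bsub>mat_ring R l\<^esub> ?W) (i, j)" "\<lambda>j. \<one>\<^bsub>mat_ring R l\<^esub> (i, j)"])
      fix k assume k: "k < l"
      show "row_act R id l (\<lambda>j. (M \<otimes>\<^bsub>mat_ring R l\<^esub> ?W) (i, j)) M k
          = row_act R id l (\<lambda>j. \<one>\<^bsub>mat_ring R l\<^esub> (i, j)) M k"
        using fun_cong[OF eq, of "(i, k)"] ij k by (simp only: mat_mult_row)
    qed (use ij W M in \<open>auto intro!: mat_entry_closed[of _ R l] MM.m_closed\<close>)
  qed (use W M in auto)
  show ?thesis using M W WM MW unfolding Units_def by blast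
qed

text \<open>Some row i of a singular matrix is a combination of the others. There are l choices of
  i, q^(l-1) of the coefficients and q^((l-1)l) of the other rows, and (l-1) + (l-1)l = l^2 -
  1.\<close>

lemma card_nonunits_le:
  assumes fin: "finite (carrier R)" and "l \<ge> 1"
  shows "card (Mat l R - GL l R) \<le> l * card (carrier R) ^ (l * l - 1)"
proof -
  interpret id: ring_hom_cring R R id by (rule id_hom)
  let ?q = "card (carrier R)"
  let ?I = "\<lambda>i. {..<l} - {i}"
  let ?B = "\<lambda>i v. {M \<in> Mat l R. \<forall>j<l. M (i, j) = \<ominus> (\<Oplus>k\<in>?I i. v k \<otimes> M (k, j))}"
  have B: "card (?B i v) \<le> ?q ^ ((l - 1) * l)" if i: "i < l" and v: "v \<in> ?I i \<rightarrow>\<^sub>E carrier R" for i v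
  proof -
    let ?D = "?I i \<times> {..<l}"
    have "card (?B i v) \<le> card (?D \<rightarrow>\<^sub>E carrier R)"
    proof (rule card_inj_on_le)
      show "finite (?D \<rightarrow>\<^sub>E carrier R)" using fin by (simp add: finite_PiE)
      show "(\<lambda>M. restrict M ?D) ` ?B i v \<subseteq> ?D \<rightarrow>\<^sub>E carrier R"
        by (auto simp only: restrict_PiE_iff mem_Collect_eq image_subset_iff mem_Sigma_iff mat_entry_closed Diff_iff lessThan_iff)
      show "inj_on (\<lambda>M. restrict M ?D) (?B i v)"
      proof (rule inj_onI)
        fix M N assume M: "M \<in> ?B i v" and N: "N \<in> ?B i v" and eq: "restrict M ?D = restrict N ?D"
        have off: "M (k, j) = N (k, j)" if "k < l" "j < l" "k \<noteq> i" for k j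
          using fun_cong[OF eq, of "(k, j)"] that by simp
        have "M (i, j) = N (i, j)" if "j < l" for j
        proof -
          have "(\<Oplus>k\<in>?I i. v k \<otimes> M (k, j)) = (\<Oplus>k\<in>?I i. v k \<otimes> N (k, j))"
            using off that v N by (intro finsum_cong') (auto simp: mat_entry_closed)
          then show ?thesis using M N that by auto
        qed
        then have "M (k, j) = N (k, j)" if "k < l" "j < l" for k j
          using off that by (cases "k = i") auto
        then show "M = N" using M N by (intro mat_eqI[of M R l N]) auto
      qed
    qed
    also have "\<dots> = ?q ^ ((l - 1) * l)" using i fin by (simp add: card_PiE prod_constant)
    finally show ?thesis .
  qed
  have "Mat l R - GL l R \<subseteq> (\<Union>i\<in>{..<l}. \<Union>v\<in>?I i \<rightarrow>\<^sub>E carrier R. ?B i v)"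
  proof
    fix M assume "M \<in> Mat l R - GL l R"
    then have M: "M \<in> Mat l R" "M \<notin> GL l R" by auto
    then obtain v i where v: "\<And>i. i < l \<Longrightarrow> v i \<in> carrier R"
      and z: "\<And>j. j < l \<Longrightarrow> row_act R id l v M j = \<zero>" and i: "i < l" "v i \<noteq> \<zero>"
      using mat_Units_if_trivial_kernel[OF fin M(1)] by blast
    \<comment> \<open>Dividing the kernel vector by its nonzero entry v i normalises it, so that
      only l - 1 coefficients remain free.\<close>
    let ?c = "inv (v i)"
    let ?u = "restrict (\<lambda>k. ?c \<otimes> v k) (?I i)"
    have c: "?c \<in> carrier R" "?c \<otimes> v i = \<one>" using v[OF i(1)] i(2) field_Units by auto
    have "M (i, j) = \<ominus> (\<Oplus>k\<in>?I i. ?u k \<otimes> M (k, j))" if j: "j < l" for j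
    proof -
      note m = mat_entry_closed[OF M(1) _ j]
      have "\<zero> = row_act R id l (\<lambda>k. ?c \<otimes> v k) M j"
        using v c z[OF j] M(1) j by (subst id.row_act_scale) auto
      also have "\<dots> = (\<Oplus>k\<in>insert i (?I i). ?c \<otimes> v k \<otimes> M (k, j))"
        using i by (simp add: row_act_def insert_absorb)
      also have "\<dots> = M (i, j) \<oplus> (\<Oplus>k\<in>?I i. ?c \<otimes> v k \<otimes> M (k, j))"
        using i v c m by (subst finsum_insert) auto
      also have "(\<Oplus>k\<in>?I i. ?c \<otimes> v k \<otimes> M (k, j)) = (\<Oplus>k\<in>?I i. ?u k \<otimes> M (k, j))"
        using v c m by (intro finsum_cong') auto
      finally have "M (i, j) \<oplus> (\<Oplus>k\<in>?I i. ?u k \<otimes> M (k, j)) = \<zero>" by simp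
      then show ?thesis using v c m i by (intro minus_equality[symmetric]) (auto intro!: finsum_closed)
    qed
    moreover have "?u \<in> ?I i \<rightarrow>\<^sub>E carrier R" using v c by auto
    ultimately show "M \<in> (\<Union>i\<in>{..<l}. \<Union>v\<in>?I i \<rightarrow>\<^sub>E carrier R. ?B i v)"
      using M(1) i(1) by (intro UN_I[of i] UN_I[of ?u]) auto
  qed
  then have "card (Mat l R - GL l R) \<le> card (\<Union>i\<in>{..<l}. \<Union>v\<in>?I i \<rightarrow>\<^sub>E carrier R. ?B i v)"
    using finite_Mat[OF fin, of l] by (intro card_mono finite_subset[OF _ finite_Mat[OF fin, of l]]) auto
  also have "\<dots> \<le> (\<Sum>i\<in>{..<l}. card (\<Union>v\<in>?I i \<rightarrow>\<^sub>E carrier R. ?B i v))"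
    by (rule card_UN_le) simp
  also have "\<dots> \<le> (\<Sum>i\<in>{..<l}. ?q ^ (l * l - 1))"
  proof (rule sum_mono)
    fix i assume "i \<in> {..<l}"
    then have i: "i < l" by simp
    have "card (\<Union>v\<in>?I i \<rightarrow>\<^sub>E carrier R. ?B i v) \<le> (\<Sum>v\<in>?I i \<rightarrow>\<^sub>E carrier R. card (?B i v))"
      using fin by (intro card_UN_le finite_PiE) auto
    also have "\<dots> \<le> (\<Sum>v\<in>?I i \<rightarrow>\<^sub>E carrier R. ?q ^ ((l - 1) * l))" by (intro sum_mono B[OF i])
    also have "\<dots> = ?q ^ (l - 1) * ?q ^ ((l - 1) * l)" using i by (simp add: card_PiE prod_constant)
    also have "\<dots> = ?q ^ (l * l - 1)"
    proof -
      have "l - 1 + (l - 1) * l = l * l - 1" using i by (cases l) auto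
      then show ?thesis by (simp flip: power_add)
    qed
    finally show "card (\<Union>v\<in>?I i \<rightarrow>\<^sub>E carrier R. ?B i v) \<le> ?q ^ (l * l - 1)" .
  qed
  finally show ?thesis by simp
qed

end

section \<open>Monic polynomials over a field\<close>

text \<open>Length is used because \<open>degree\<close> is 0 for the empty list, which is the zero
  polynomial, as well as for constants.\<close>

definition monic :: "('a, 'm) ring_scheme \<Rightarrow> nat \<Rightarrow> 'a list \<Rightarrow> bool" where
  "monic R n p \<longleftrightarrow> p \<in> carrier (poly_ring R) \<and> length p = Suc n \<and> lead_coeff p = \<one>\<^bsub>R\<^esub>"

context field
begin

abbreviation RX where "RX \<equiv> poly_ring R"

abbreviation mult_RX (infixl \<open>\<otimes>\<^sub>X\<close> 70) where "p \<otimes>\<^sub>X q \<equiv> p \<otimes>\<^bsub>RX\<^esub> q"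
abbreviation add_RX (infixl \<open>\<oplus>\<^sub>X\<close> 65) where "p \<oplus>\<^sub>X q \<equiv> p \<oplus>\<^bsub>RX\<^esub> q"
abbreviation minus_RX (infixl \<open>\<ominus>\<^sub>X\<close> 65) where "p \<ominus>\<^sub>X q \<equiv> p \<ominus>\<^bsub>RX\<^esub> q"
abbreviation divides_RX (infix \<open>divides\<^sub>X\<close> 65) where "p divides\<^sub>X q \<equiv> p divides\<^bsub>RX\<^esub> q"
abbreviation one_RX (\<open>\<one>\<^sub>X\<close>) where "\<one>\<^sub>X \<equiv> \<one>\<^bsub>RX\<^esub>"
abbreviation zero_RX (\<open>\<zero>\<^sub>X\<close>) where "\<zero>\<^sub>X \<equiv> \<zero>\<^bsub>RX\<^esub>"
abbreviation X_pow :: "nat \<Rightarrow> 'a list" where "X_pow n \<equiv> X [^]\<^bsub>RX\<^esub> n"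

interpretation UP: principal_domain RX
  by (rule univ_poly_is_principal[OF carrier_is_subfield])

lemma poly_of_const_hom: "ring_hom_cring R RX poly_of_const"
  using canonical_embedding_ring_hom[OF carrier_is_subring]
  by (intro ring_hom_cring.intro ring_hom_cring_axioms.intro is_cring UP.is_cring)
     (simp add: ring_hom_ring_def ring_hom_ring_axioms_def)

interpretation const: ring_hom_cring R RX poly_of_const
  by (rule poly_of_const_hom)

lemma RX_polynomial: "p \<in> carrier RX \<Longrightarrow> polynomial (carrier R) p"
  by (simp add: univ_poly_carrier)

lemma RX_set: "p \<in> carrier RX \<Longrightarrow> set p \<subseteq> carrier R"
  by (rule polynomial_incl[OF RX_polynomial])

lemma coeff_closed: "p \<in> carrier RX \<Longrightarrow> coeff p i \<in> carrier R"
  using RX_set by (rule coeff_in_carrier)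

lemma X_closed: "X \<in> carrier RX" by (rule var_closed(1)[OF carrier_is_subring])

lemma coeff_add:
  "p \<in> carrier RX \<Longrightarrow> q \<in> carrier RX \<Longrightarrow> coeff (p \<oplus>\<^sub>X q) i = coeff p i \<oplus> coeff q i"
  using poly_add_coeff[of p q] RX_set by (simp add: univ_poly_add)

lemma coeff_zero: "coeff \<zero>\<^sub>X i = \<zero>" by (simp add: univ_poly_zero)

lemma coeff_finsum:
  assumes "finite A" "\<And>x. x \<in> A \<Longrightarrow> p x \<in> carrier RX"
  shows "coeff (\<Oplus>\<^bsub>RX\<^esub>x\<in>A. p x) i = (\<Oplus>x\<in>A. coeff (p x) i)"
  using assms
proof (induction A rule: finite_induct)
  case (insert a A)
  then show ?case
    by (subst UP.finsum_insert, simp_all add: coeff_add Pi_iff UP.finsum_closed)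
       (subst finsum_insert, simp_all add: coeff_closed Pi_iff)
qed (simp add: coeff_zero UP.finsum_empty finsum_empty)

lemma coeff_X_pow_const:
  assumes a: "a \<in> carrier R"
  shows "coeff (X_pow n \<otimes>\<^sub>X poly_of_const a) i = (if i = n then a else \<zero>)"
proof (cases "a = \<zero>")
  case True
  then have "poly_of_const a = \<zero>\<^sub>X" by (simp add: const.hom_zero)
  then show ?thesis using True X_closed by (simp add: coeff_zero)
next
  case False
  then have "poly_of_const a = [a]" by (simp add: poly_of_const_def)
  then have "X_pow n \<otimes>\<^sub>X poly_of_const a = monom a n"
    using monom_eq_var_pow[OF carrier_is_subring, of a n] a False X_closed const.hom_closed[OF a]
    by (simp add: UP.m_comm)
  then show ?thesis by (simp add: monom_coeff)
qed

lemma poly_eqI: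
  "p \<in> carrier RX \<Longrightarrow> q \<in> carrier RX \<Longrightarrow> (\<And>i. coeff p i = coeff q i) \<Longrightarrow> p = q"
  using coeff_iff_polynomial_cond[of "carrier R" p q] RX_polynomial by blast

lemma coeff_eq_zero: "length p \<le> i \<Longrightarrow> coeff p i = \<zero>" by (rule coeff_length)

lemma length_leI:
  assumes p: "p \<in> carrier RX" and z: "\<And>i. i \<ge> n \<Longrightarrow> coeff p i = \<zero>"
  shows "length p \<le> n"
proof (rule ccontr)
  assume "\<not> ?thesis"
  then have "p \<noteq> []" "degree p \<ge> n" by auto
  then have "lead_coeff p = \<zero>" using z[of "degree p"] lead_coeff_simp[of p] by metis
  then show False using \<open>p \<noteq> []\<close> RX_polynomial[OF p] by (simp add: polynomial_def)
qed

lemma coeff_X_sum: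
  assumes "\<And>i. i < n \<Longrightarrow> a i \<in> carrier R"
  shows "coeff (\<Oplus>\<^bsub>RX\<^esub>i\<in>{..<n}. X_pow i \<otimes>\<^sub>X poly_of_const (a i)) j = (if j < n then a j else \<zero>)"
proof -
  have "coeff (\<Oplus>\<^bsub>RX\<^esub>i\<in>{..<n}. X_pow i \<otimes>\<^sub>X poly_of_const (a i)) j
      = (\<Oplus>i\<in>{..<n}. coeff (X_pow i \<otimes>\<^sub>X poly_of_const (a i)) j)"
    using assms X_closed by (intro coeff_finsum) auto
  also have "\<dots> = (\<Oplus>i\<in>{..<n}. if j = i then a i else \<zero>)"
    using assms by (intro finsum_cong') (auto simp: coeff_X_pow_const)
  also have "\<dots> = (if j < n then a j else \<zero>)"
  proof (cases "j < n")
    case True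
    then show ?thesis using assms by (subst finsum_singleton) auto
  next
    case False
    then have "(\<Oplus>i\<in>{..<n}. if j = i then a i else \<zero>) = (\<Oplus>i\<in>{..<n}. \<zero>)"
      by (intro finsum_cong') auto
    then show ?thesis using False by (simp add: finsum_zero)
  qed
  finally show ?thesis .
qed

lemma X_sum_closed:
  assumes "\<And>i. i < (n::nat) \<Longrightarrow> a i \<in> carrier R"
  shows "(\<Oplus>\<^bsub>RX\<^esub>i\<in>{..<n}. X_pow i \<otimes>\<^sub>X poly_of_const (a i)) \<in> carrier RX"
  using assms X_closed
  by (intro UP.finsum_closed Pi_I UP.m_closed UP.nat_pow_closed const.hom_closed) auto

lemma length_X_sum:
  assumes "\<And>i. i < (n::nat) \<Longrightarrow> a i \<in> carrier R"
  shows "length (\<Oplus>\<^bsub>RX\<^esub>i\<in>{..<n}. X_pow i \<otimes>\<^sub>X poly_of_const (a i)) \<le> n"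
  using assms by (intro length_leI X_sum_closed) (auto simp: coeff_X_sum)

lemma length_add_le:
  "length p \<le> n \<Longrightarrow> length q \<le> n \<Longrightarrow> length (p \<oplus>\<^sub>X q) \<le> n"
  using poly_add_length_le[of p q] by (simp add: univ_poly_add)

lemma length_minus_le:
  "p \<in> carrier RX \<Longrightarrow> q \<in> carrier RX \<Longrightarrow> length p \<le> n \<Longrightarrow> length q \<le> n \<Longrightarrow> length (p \<ominus>\<^sub>X q) \<le> n"
  unfolding a_minus_def
  by (intro length_add_le) (simp_all add: univ_poly_a_inv_length[OF carrier_is_subring])

lemma length_finsum_le:
  assumes "finite A" "\<And>x. x \<in> A \<Longrightarrow> p x \<in> carrier RX" "\<And>x. x \<in> A \<Longrightarrow> length (p x) \<le> n"
  shows "length (\<Oplus>\<^bsub>RX\<^esub>x\<in>A. p x) \<le> n"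
  using assms
proof (induction A rule: finite_induct)
  case (insert a A)
  then show ?case by (subst UP.finsum_insert) (auto intro!: length_add_le)
qed (simp add: UP.finsum_empty univ_poly_zero)

lemma length_mult:
  assumes "p \<in> carrier RX" "q \<in> carrier RX" "p \<noteq> []" "q \<noteq> []"
  shows "Suc (length (p \<otimes>\<^sub>X q)) = length p + length q"
proof -
  have ne: "p \<otimes>\<^sub>X q \<noteq> []"
    using UP.integral[of p q] assms by (auto simp: univ_poly_zero)
  have "degree (p \<otimes>\<^sub>X q) = degree p + degree q"
    using poly_mult_degree_eq[OF carrier_is_subring RX_polynomial RX_polynomial] assms
    by (simp add: univ_poly_mult)
  moreover have "length p > 0" "length q > 0" "length (p \<otimes>\<^sub>X q) > 0" using assms ne by simp_all
  ultimately show ?thesis by linarith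
qed

lemma length_mult_le:
  assumes "p \<in> carrier RX" "q \<in> carrier RX" "length p \<le> Suc m" "length q \<le> Suc n"
  shows "length (p \<otimes>\<^sub>X q) \<le> Suc (m + n)"
proof (cases "p = [] \<or> q = []")
  case True
  then have "p \<otimes>\<^sub>X q = []" using assms UP.l_null[of q] UP.r_null[of p] by (auto simp: univ_poly_zero)
  then show ?thesis by simp
next
  case False
  then show ?thesis using length_mult[of p q] assms by simp
qed

lemma length_finprod_le:
  assumes "finite A" "\<And>x. x \<in> A \<Longrightarrow> p x \<in> carrier RX" "\<And>x. x \<in> A \<Longrightarrow> length (p x) \<le> Suc (b x)"
  shows "length (\<Otimes>\<^bsub>RX\<^esub>x\<in>A. p x) \<le> Suc (\<Sum>x\<in>A. b x)"
  using assms
proof (induction A rule: finite_induct)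
  case (insert a A)
  then show ?case by (subst UP.finprod_insert) (auto intro!: length_mult_le)
qed (simp add: univ_poly_one)

lemma monic_nonzero: "monic R n p \<Longrightarrow> p \<noteq> []" by (auto simp: monic_def)

lemma monic_closed: "monic R n p \<Longrightarrow> p \<in> carrier RX" by (simp add: monic_def)

lemma monic_mult:
  assumes p: "monic R m p" and q: "monic R n q"
  shows "monic R (m + n) (p \<otimes>\<^sub>X q)"
proof -
  have "lead_coeff (p \<otimes>\<^sub>X q) = lead_coeff p \<otimes> lead_coeff q"
    using poly_mult_lead_coeff[OF carrier_is_subring RX_polynomial RX_polynomial] assms monic_nonzero
    by (simp add: univ_poly_mult monic_def)
  then show ?thesis
    using length_mult[of p q] assms monic_nonzero by (auto simp: monic_def)
qed

lemma monic_one: "monic R 0 \<one>\<^sub>X" by (auto simp: monic_def univ_poly_one[symmetric]) (simp_all add: univ_poly_one)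

lemma monic_finprod:
  assumes "finite A" "\<And>x. x \<in> A \<Longrightarrow> monic R (n x) (p x)"
  shows "monic R (\<Sum>x\<in>A. n x) (\<Otimes>\<^bsub>RX\<^esub>x\<in>A. p x)"
  using assms
proof (induction A rule: finite_induct)
  case (insert a A)
  then show ?case using monic_closed by (subst UP.finprod_insert) (auto intro!: monic_mult)
qed (simp add: monic_one)

lemma monic_iff_coeff:
  assumes p: "p \<in> carrier RX"
  shows "monic R n p \<longleftrightarrow> coeff p n = \<one> \<and> (\<forall>i>n. coeff p i = \<zero>)"
proof
  assume m: "monic R n p"
  then have "coeff p n = \<one>" using lead_coeff_simp[OF monic_nonzero[OF m]] by (simp add: monic_def)
  then show "coeff p n = \<one> \<and> (\<forall>i>n. coeff p i = \<zero>)" using m by (auto simp: monic_def intro!: coeff_eq_zero)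
next
  assume c: "coeff p n = \<one> \<and> (\<forall>i>n. coeff p i = \<zero>)"
  then have "length p \<le> Suc n" by (intro length_leI p) auto
  moreover have "length p > n" using c coeff_eq_zero[of p n] by (metis not_le one_not_zero)
  ultimately have l: "length p = Suc n" by simp
  then have "lead_coeff p = \<one>" using lead_coeff_simp[of p] c by (cases p) auto
  then show "monic R n p" using p l by (simp add: monic_def)
qed

lemma monic_add:
  assumes p: "monic R n p" and q: "q \<in> carrier RX" "length q \<le> n"
  shows "monic R n (p \<oplus>\<^sub>X q)"
proof -
  note pc = monic_closed[OF p]
  have "coeff q i = \<zero>" if "i \<ge> n" for i using q that by (intro coeff_eq_zero) auto
  then show ?thesis
    using p pc q monic_iff_coeff[OF pc, of n] by (subst monic_iff_coeff) (auto simp: coeff_add)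
qed

lemma monic_X_pow: "monic R n (X_pow n)"
proof -
  have "X_pow n = X_pow n \<otimes>\<^sub>X poly_of_const \<one>" using X_closed const.hom_one by simp
  then show ?thesis using X_closed coeff_X_pow_const[of \<one> n] by (subst monic_iff_coeff) auto
qed

text \<open>Reduction of X^n modulo p: the remainder has the negated coefficients of p, which form
  the last column of the companion matrix.\<close>

lemma monic_expand:
  assumes p: "monic R n p"
  shows "X_pow n = p \<oplus>\<^sub>X (\<Oplus>\<^bsub>RX\<^esub>i\<in>{..<n}. X_pow i \<otimes>\<^sub>X poly_of_const (\<ominus> coeff p i))"
proof (rule poly_eqI)
  note pc = monic_closed[OF p]
  have c: "\<And>i. i < n \<Longrightarrow> \<ominus> coeff p i \<in> carrier R" using coeff_closed[OF pc] by simp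
  have X: "coeff (X_pow n) i = (if i = n then \<one> else \<zero>)" for i
    using coeff_X_pow_const[of \<one> n i] X_closed const.hom_one by simp
  show "coeff (X_pow n) i = coeff (p \<oplus>\<^sub>X
      (\<Oplus>\<^bsub>RX\<^esub>i\<in>{..<n}. X_pow i \<otimes>\<^sub>X poly_of_const (\<ominus> coeff p i))) i" for i
    using p monic_iff_coeff[OF pc, of n] coeff_closed[OF pc, of i]
    by (simp add: coeff_add[OF pc X_sum_closed[OF c]] X coeff_X_sum[of n "\<lambda>i. \<ominus> coeff p i"] coeff_closed[OF pc] r_neg not_less del: const.hom_a_inv)
  show "p \<oplus>\<^sub>X (\<Oplus>\<^bsub>RX\<^esub>i\<in>{..<n}. X_pow i \<otimes>\<^sub>X poly_of_const (\<ominus> coeff p i)) \<in> carrier RX"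
    using pc X_sum_closed[OF c] by (rule UP.a_closed)
qed (use X_closed in simp)

text \<open>Equal lengths force a constant quotient, and the leading coefficients make it 1.\<close>

lemma monic_divides_eq:
  assumes p: "monic R n p" and q: "monic R n q" and d: "p divides\<^sub>X q"
  shows "p = q"
proof -
  from d obtain g where g: "g \<in> carrier RX" "q = p \<otimes>\<^sub>X g" by (auto simp: factor_def)
  have "g \<noteq> []" using g UP.r_null[OF monic_closed[OF p]] monic_nonzero[OF q] by (auto simp: univ_poly_zero)
  then have "length g = 1" using length_mult[of p g] g p q monic_nonzero[OF p] by (auto simp: monic_def)
  then obtain a where a: "g = [a]" by (cases g) auto
  have "lead_coeff q = lead_coeff p \<otimes> lead_coeff g"
    using poly_mult_lead_coeff[OF carrier_is_subring RX_polynomial RX_polynomial, of p g] p g \<open>g \<noteq> []\<close> monic_nonzero[OF p]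
    by (simp add: univ_poly_mult monic_def)
  then have "a = \<one>" using p q a RX_set[OF g(1)] by (simp add: monic_def)
  then show ?thesis using g a monic_closed[OF p] UP.r_one[of p] by (simp add: univ_poly_one)
qed

lemma monic_divides_small:
  assumes p: "monic R n p" and q: "q \<in> carrier RX" "length q \<le> n" and d: "p divides\<^sub>X q"
  shows "q = \<zero>\<^sub>X"
proof (rule ccontr)
  assume "q \<noteq> \<zero>\<^sub>X"
  then have "q \<noteq> []" by (simp add: univ_poly_zero)
  from d obtain g where g: "g \<in> carrier RX" "q = p \<otimes>\<^sub>X g" by (auto simp: factor_def)
  have "g \<noteq> []" using g UP.r_null[OF monic_closed[OF p]] \<open>q \<noteq> []\<close> by (auto simp: univ_poly_zero)
  then show False using length_mult[of p g] g p q monic_nonzero[OF p]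
    by (cases g) (auto simp: monic_def)
qed

lemma card_monic:
  assumes "finite (carrier R)"
  shows "card {p. monic R n p} = card (carrier R) ^ n"
proof -
  have "{p. monic R n p} = (#) \<one> ` {xs. set xs \<subseteq> carrier R \<and> length xs = n}"
  proof (intro equalityI subsetI)
    fix p assume "p \<in> {p. monic R n p}"
    then have p: "p \<in> carrier RX" "length p = Suc n" "lead_coeff p = \<one>" by (auto simp: monic_def)
    then obtain xs where "p = \<one> # xs" by (cases p) auto
    then show "p \<in> (#) \<one> ` {xs. set xs \<subseteq> carrier R \<and> length xs = n}" using p RX_set[OF p(1)] by auto
  next
    fix p assume "p \<in> (#) \<one> ` {xs. set xs \<subseteq> carrier R \<and> length xs = n}"
    then show "p \<in> {p. monic R n p}"
      by (auto simp: monic_def univ_poly_carrier[symmetric] polynomial_def)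
  qed
  then have "card {p. monic R n p} = card {xs. set xs \<subseteq> carrier R \<and> length xs = n}"
    by (simp add: card_image)
  then show ?thesis using card_lists_length_eq[OF assms, of n] by simp
qed

lemma finite_monic: "finite (carrier R) \<Longrightarrow> finite {p. monic R n p}"
  by (rule finite_subset[of _ "{xs. set xs \<subseteq> carrier R \<and> length xs = Suc n}"])
     (auto simp: monic_def dest: RX_set intro: finite_lists_length_eq)

text \<open>Padding with leading zeros up to length n is inverse to \<open>normalize\<close>, so
  these polynomials correspond to all lists of length n over the field.\<close>

lemma card_length_le:
  assumes "finite (carrier R)"
  shows "card {p \<in> carrier RX. length p \<le> n} = card (carrier R) ^ n"
proof -
  have "bij_betw (\<lambda>p. replicate (n - length p) \<zero> @ p) {p \<in> carrier RX. length p \<le> n}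
      {xs. set xs \<subseteq> carrier R \<and> length xs = n}"
  proof (rule bij_betw_byWitness[where f' = normalize])
    show "\<forall>p\<in>{p \<in> carrier RX. length p \<le> n}. normalize (replicate (n - length p) \<zero> @ p) = p"
      using normalize_replicate_zero normalize_polynomial[OF RX_polynomial] by auto
    show "\<forall>xs\<in>{xs. set xs \<subseteq> carrier R \<and> length xs = n}.
        replicate (n - length (normalize xs)) \<zero> @ normalize xs = xs"
      using normalize_trick by auto
    show "(\<lambda>p. replicate (n - length p) \<zero> @ p) ` {p \<in> carrier RX. length p \<le> n}
        \<subseteq> {xs. set xs \<subseteq> carrier R \<and> length xs = n}"
      by (auto dest: RX_set[THEN subsetD])
    show "normalize ` {xs. set xs \<subseteq> carrier R \<and> length xs = n} \<subseteq> {p \<in> carrier RX. length p \<le> n}"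
      using normalize_gives_polynomial[of _ "carrier R"] normalize_length_le
      by (auto simp: univ_poly_carrier[symmetric])
  qed
  then have "card {p \<in> carrier RX. length p \<le> n} = card {xs. set xs \<subseteq> carrier R \<and> length xs = n}"
    by (rule bij_betw_same_card)
  then show ?thesis using card_lists_length_eq[OF assms, of n] by simp
qed

end

section \<open>Conjugacy classes of companion matrices\<close>

lemma (in ring_hom_cring) row_act_one:
  assumes v: "\<And>i. i < l \<Longrightarrow> v i \<in> carrier S" and j: "j < l"
  shows "row_act S h l v \<one>\<^bsub>mat_ring R l\<^esub> j = v j"
proof -
  have "row_act S h l v \<one>\<^bsub>mat_ring R l\<^esub> j = (\<Oplus>\<^bsub>S\<^esub>i\<in>{..<l}. if j = i then v i else \<zero>\<^bsub>S\<^esub>)"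
    unfolding row_act_def using v j by (intro S.finsum_cong') (auto simp: mat_one_entry)
  also have "\<dots> = v j" using v j by (intro S.finsum_singleton) auto
  finally show ?thesis .
qed

lemma (in abelian_group) add_diff_add:
  assumes "a \<in> carrier G" "b \<in> carrier G" "c \<in> carrier G" "d \<in> carrier G"
  shows "(a \<oplus> b) \<ominus> (c \<oplus> d) = (a \<ominus> c) \<oplus> (b \<ominus> d)"
  using assms by (simp add: minus_eq minus_add a_ac)

lemma (in abelian_group) diff_eq_diff_if_add_eq_add:
  assumes cl: "a \<in> carrier G" "b \<in> carrier G" "c \<in> carrier G" "d \<in> carrier G"
    and eq: "a \<oplus> b = c \<oplus> d"
  shows "a \<ominus> c = d \<ominus> b"
proof -
  have "(a \<ominus> c) \<oplus> (b \<ominus> d) = \<zero>"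
    using add_diff_add[OF cl] eq cl by (simp add: minus_eq r_neg)
  then have "a \<ominus> c = \<ominus> (b \<ominus> d)" using cl by (intro minus_equality[symmetric]) auto
  then show ?thesis using cl by (simp add: minus_eq minus_add a_comm)
qed

lemma (in cring) diff_distrib:
  assumes "a \<in> carrier R" "b \<in> carrier R" "c \<in> carrier R"
  shows "a \<otimes> (b \<ominus> c) = a \<otimes> b \<ominus> a \<otimes> c" "(b \<ominus> c) \<otimes> a = b \<otimes> a \<ominus> c \<otimes> a"
  using assms by (simp_all add: a_minus_def r_distr l_distr r_minus l_minus)

section \<open>Conjugation in a monoid\<close>

lemma (in Group.monoid) conj_pow:
  assumes Q: "Q \<in> Units G" and D: "D \<in> carrier G"
  shows "(inv Q \<otimes> D \<otimes> Q) [^] (n::nat) = inv Q \<otimes> D [^] n \<otimes> Q"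
proof (induction n)
  case 0
  then show ?case using Q D by (simp add: Units_inv_closed)
next
  case (Suc n)
  note cl = Units_closed[OF Q] Units_inv_closed[OF Q] D nat_pow_closed[OF D]
  have "inv Q \<otimes> D [^] n \<otimes> Q \<otimes> (inv Q \<otimes> D \<otimes> Q) = inv Q \<otimes> D [^] n \<otimes> (Q \<otimes> inv Q) \<otimes> D \<otimes> Q"
    using cl by (simp add: m_assoc del: Units_r_inv Units_l_inv)
  also have "\<dots> = inv Q \<otimes> D [^] Suc n \<otimes> Q" using cl Q by (simp add: m_assoc)
  finally show ?case using Suc by simp
qed

lemma (in Group.monoid) conj_cancel:
  assumes Q: "Q \<in> Units G" and M: "M \<in> carrier G" "M' \<in> carrier G"
    and eq: "inv Q \<otimes> M \<otimes> Q = inv Q \<otimes> M' \<otimes> Q"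
  shows "M = M'"
proof -
  note cl = Units_closed[OF Q] Units_inv_closed[OF Q]
  have c: "Q \<otimes> (inv Q \<otimes> M \<otimes> Q) \<otimes> inv Q = M" if "M \<in> carrier G" for M
  proof -
    have "Q \<otimes> (inv Q \<otimes> M \<otimes> Q) \<otimes> inv Q = (Q \<otimes> inv Q) \<otimes> M \<otimes> (Q \<otimes> inv Q)"
      using cl that by (simp add: m_assoc del: Units_r_inv Units_l_inv)
    then show ?thesis using Q cl that by simp
  qed
  have "M = Q \<otimes> (inv Q \<otimes> M \<otimes> Q) \<otimes> inv Q" by (rule c[OF M(1), symmetric])
  also have "\<dots> = M'" unfolding eq by (rule c[OF M(2)])
  finally show ?thesis .
qed

text \<open>Two units in one fibre of Q \<mapsto> Q^(-1) D Q differ by an element of the centralizer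
  of D, so a fibre is no larger than the centralizer.\<close>

lemma (in Group.monoid) conj_eq_imp_commute:
  assumes P: "P \<in> Units G" and Q: "Q \<in> Units G" and D: "D \<in> carrier G"
    and eq: "inv P \<otimes> D \<otimes> P = inv Q \<otimes> D \<otimes> Q"
  shows "(Q \<otimes> inv P) \<otimes> D = D \<otimes> (Q \<otimes> inv P)"
proof -
  note cl = Units_closed[OF P] Units_closed[OF Q] Units_inv_closed[OF P] Units_inv_closed[OF Q] D
  have "(Q \<otimes> inv P) \<otimes> D = Q \<otimes> (inv P \<otimes> D \<otimes> P) \<otimes> inv P" using cl P by (simp add: m_assoc)
  also have "\<dots> = (Q \<otimes> inv Q) \<otimes> D \<otimes> (Q \<otimes> inv P)"
    unfolding eq using cl by (simp add: m_assoc del: Units_r_inv Units_l_inv)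
  also have "\<dots> = D \<otimes> (Q \<otimes> inv P)" using cl Q by simp
  finally show ?thesis .
qed

lemma card_le_card_image_mult:
  assumes "finite A" "\<And>y. y \<in> f ` A \<Longrightarrow> card {x \<in> A. f x = y} \<le> k"
  shows "card A \<le> card (f ` A) * k"
proof -
  have "card A = card (\<Union>y\<in>f ` A. {x \<in> A. f x = y})" by (rule arg_cong[where f = card]) auto
  also have "\<dots> \<le> (\<Sum>y\<in>f ` A. card {x \<in> A. f x = y})" using assms(1) by (intro card_UN_le) simp
  also have "\<dots> \<le> (\<Sum>y\<in>f ` A. k)" by (intro sum_mono assms(2))
  finally show ?thesis by simp
qed

context field
begin

interpretation UP: principal_domain RX
  by (rule univ_poly_is_principal[OF carrier_is_subfield])

interpretation const: ring_hom_cring R RX poly_of_const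
  by (rule poly_of_const_hom)

text \<open>Oriented for row vectors: the row (1, X, ..., X^(l-1)) times this matrix is (X, X^2,
  ..., X^l) with X^l reduced modulo f, when f is monic of degree l.\<close>

definition companion :: "nat \<Rightarrow> 'a list \<Rightarrow> nat \<times> nat \<Rightarrow> 'a" where
  "companion l f = (\<lambda>(i, j) \<in> {..<l} \<times> {..<l}.
     if Suc j = l then \<ominus> coeff f i else if i = Suc j then \<one> else \<zero>)"

definition companion_class :: "nat \<Rightarrow> 'a list \<Rightarrow> (nat \<times> nat \<Rightarrow> 'a) set" where
  "companion_class l f =
     (\<lambda>Q. inv\<^bsub>mat_ring R l\<^esub> Q \<otimes>\<^bsub>mat_ring R l\<^esub> companion l f \<otimes>\<^bsub>mat_ring R l\<^esub> Q) ` GL l R"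

abbreviation act where "act \<equiv> row_act RX poly_of_const"

lemma X_pow_closed: "X_pow i \<in> carrier RX" using X_closed by simp

lemma companion_closed: "f \<in> carrier RX \<Longrightarrow> companion l f \<in> Mat l R"
  by (auto simp: companion_def mat_ring_simps coeff_closed)

lemma act_X_row_companion:
  assumes f: "monic R l f" and j: "j < l"
  shows "act l X_pow (companion l f) j =
    X \<otimes>\<^sub>X X_pow j \<oplus>\<^sub>X \<ominus>\<^bsub>RX\<^esub> f \<otimes>\<^sub>X (if j = l - 1 then \<one>\<^sub>X else \<zero>\<^sub>X)"
proof (cases "Suc j = l")
  case True
  note fc = monic_closed[OF f]
  let ?s = "\<Oplus>\<^bsub>RX\<^esub>i\<in>{..<l}. X_pow i \<otimes>\<^sub>X poly_of_const (\<ominus> coeff f i)"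
  have sc: "?s \<in> carrier RX" using coeff_closed[OF fc] by (intro X_sum_closed) auto
  have "act l X_pow (companion l f) j = ?s"
    unfolding row_act_def using True coeff_closed[OF fc] X_pow_closed
    by (intro UP.finsum_cong') (auto simp: companion_def intro!: UP.m_closed)
  also have "\<dots> = (f \<oplus>\<^sub>X ?s) \<oplus>\<^sub>X \<ominus>\<^bsub>RX\<^esub> f" using fc sc by (simp add: UP.a_ac UP.r_neg2)
  also have "f \<oplus>\<^sub>X ?s = X_pow l" using monic_expand[OF f] by simp
  also have "X_pow l = X \<otimes>\<^sub>X X_pow j" using True X_closed by (auto simp: UP.m_comm)
  finally show ?thesis using True fc by auto
next
  case False
  have "act l X_pow (companion l f) j = (\<Oplus>\<^bsub>RX\<^esub>i\<in>{..<l}. if Suc j = i then X_pow i else \<zero>\<^sub>X)"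
    unfolding row_act_def using False X_pow_closed j
    by (intro UP.finsum_cong') (auto simp: companion_def)
  also have "\<dots> = X_pow (Suc j)" using False j X_pow_closed by (intro UP.finsum_singleton) auto
  also have "\<dots> = X \<otimes>\<^sub>X X_pow j" using X_closed by (simp add: UP.m_comm)
  finally show ?thesis using False j X_closed monic_closed[OF f] by auto
qed

text \<open>Each factor of the companion matrix multiplies the row by X modulo f, so column j of the
  n-th power represents X^(n+j). The multiples of f are kept explicit, so that the identity holds in
  the polynomial ring itself, where coefficients can be compared.\<close>

lemma act_X_row_companion_pow:
  assumes f: "monic R l f"
  shows "\<exists>g. (\<forall>j<l. g j \<in> carrier RX) \<and>
    (\<forall>j<l. act l X_pow (companion l f [^]\<^bsub>mat_ring R l\<^esub> (n::nat)) j = X_pow n \<otimes>\<^sub>X X_pow j \<oplus>\<^sub>X f \<otimes>\<^sub>X g j)"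
proof (induction n)
  case 0
  have "act l X_pow \<one>\<^bsub>mat_ring R l\<^esub> j = X_pow 0 \<otimes>\<^sub>X X_pow j \<oplus>\<^sub>X f \<otimes>\<^sub>X \<zero>\<^sub>X" if "j < l" for j
    using const.row_act_one[of l X_pow j] X_pow_closed that monic_closed[OF f] by simp
  then show ?case by (intro exI[of _ "\<lambda>_. \<zero>\<^sub>X"]) simp
next
  case (Suc n)
  interpret MM: Group.monoid "mat_ring R l" by (rule mat_monoid)
  note fc = monic_closed[OF f] and Dc = companion_closed[OF monic_closed[OF f], of l]
  let ?D = "companion l f"
  let ?\<delta> = "\<lambda>j. if j = l - 1 then \<one>\<^sub>X else \<zero>\<^sub>X"
  obtain g where g: "\<And>j. j < l \<Longrightarrow> g j \<in> carrier RX"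
    and eq: "\<And>j. j < l \<Longrightarrow> act l X_pow (?D [^]\<^bsub>mat_ring R l\<^esub> n) j = X_pow n \<otimes>\<^sub>X X_pow j \<oplus>\<^sub>X f \<otimes>\<^sub>X g j"
    using Suc by blast
  let ?g = "\<lambda>j. \<ominus>\<^bsub>RX\<^esub> (X_pow n \<otimes>\<^sub>X ?\<delta> j) \<oplus>\<^sub>X act l g ?D j"
  have gc: "act l g ?D j \<in> carrier RX" if "j < l" for j
    by (rule const.row_act_closed[OF g Dc that])
  have "act l X_pow (?D [^]\<^bsub>mat_ring R l\<^esub> Suc n) j = X_pow (Suc n) \<otimes>\<^sub>X X_pow j \<oplus>\<^sub>X f \<otimes>\<^sub>X ?g j"
    if j: "j < l" for j
  proof -
    have "act l X_pow (?D [^]\<^bsub>mat_ring R l\<^esub> Suc n) j = act l (act l X_pow (?D [^]\<^bsub>mat_ring R l\<^esub> n)) ?D j"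
      using const.row_act_mult[of l X_pow, OF X_pow_closed MM.nat_pow_closed[OF Dc] Dc j] by simp
    also have "\<dots> = act l (\<lambda>j. X_pow n \<otimes>\<^sub>X X_pow j \<oplus>\<^sub>X f \<otimes>\<^sub>X g j) ?D j"
      by (rule const.row_act_cong[OF eq _ Dc j]) (use g fc X_pow_closed in auto)
    also have "\<dots> = act l (\<lambda>j. X_pow n \<otimes>\<^sub>X X_pow j) ?D j \<oplus>\<^sub>X act l (\<lambda>j. f \<otimes>\<^sub>X g j) ?D j"
      by (rule const.row_act_add[OF _ _ Dc j]) (use g fc X_pow_closed in auto)
    also have "act l (\<lambda>j. X_pow n \<otimes>\<^sub>X X_pow j) ?D j = X_pow n \<otimes>\<^sub>X act l X_pow ?D j"
      by (rule const.row_act_scale[OF X_pow_closed X_pow_closed Dc j])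
    also have "act l (\<lambda>j. f \<otimes>\<^sub>X g j) ?D j = f \<otimes>\<^sub>X act l g ?D j"
      by (rule const.row_act_scale[OF g fc Dc j])
    also have "act l X_pow ?D j = X \<otimes>\<^sub>X X_pow j \<oplus>\<^sub>X \<ominus>\<^bsub>RX\<^esub> f \<otimes>\<^sub>X ?\<delta> j"
      by (rule act_X_row_companion[OF f j])
    finally have "act l X_pow (?D [^]\<^bsub>mat_ring R l\<^esub> Suc n) j
        = X_pow n \<otimes>\<^sub>X (X \<otimes>\<^sub>X X_pow j \<oplus>\<^sub>X \<ominus>\<^bsub>RX\<^esub> f \<otimes>\<^sub>X ?\<delta> j) \<oplus>\<^sub>X f \<otimes>\<^sub>X act l g ?D j" .
    also have "\<dots> = X_pow (Suc n) \<otimes>\<^sub>X X_pow j \<oplus>\<^sub>X f \<otimes>\<^sub>X ?g j"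
      using fc X_closed X_pow_closed gc[OF j]
      by (simp add: UP.r_distr UP.l_distr UP.l_minus UP.r_minus UP.m_ac UP.a_ac)
    finally show ?thesis .
  qed
  moreover have "?g j \<in> carrier RX" if "j < l" for j using gc[OF that] X_closed by simp
  ultimately show ?case by (intro exI[of _ ?g]) blast
qed

text \<open>Entry j of the image row is column j of M read as a polynomial of degree below l, so
  equality of these polynomials is equality of matrices.\<close>

lemma coeff_act_X_row:
  assumes "M \<in> Mat l R" "i < l" "j < l"
  shows "coeff (act l X_pow M j) i = M (i, j)"
  unfolding row_act_def using assms coeff_X_sum[of l "\<lambda>i. M (i, j)" i] by (simp add: mat_entry_closed)

lemma length_act_X_row:
  "M \<in> Mat l R \<Longrightarrow> j < l \<Longrightarrow> length (act l X_pow M j) \<le> l"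
  unfolding row_act_def by (intro length_X_sum) (simp add: mat_entry_closed)

text \<open>Column j of the m-th power is the remainder of X^(m+j) modulo f, so the power is
  determined by the residue of X^m and determines it.\<close>

lemma companion_pow_eq_iff:
  assumes f: "monic R l f" and l: "l \<ge> 1"
  shows "companion l f [^]\<^bsub>mat_ring R l\<^esub> (m::nat) = companion l f [^]\<^bsub>mat_ring R l\<^esub> (n::nat)
    \<longleftrightarrow> f divides\<^sub>X (X_pow m \<ominus>\<^sub>X X_pow n)" (is "?D m = ?D n \<longleftrightarrow> _")
proof -
  interpret MM: Group.monoid "mat_ring R l" by (rule mat_monoid)
  note fc = monic_closed[OF f]
  have Dc: "?D k \<in> Mat l R" for k :: nat using companion_closed[OF fc] by simp
  have "\<forall>k. \<exists>g. (\<forall>j<l. g j \<in> carrier RX) \<and>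
      (\<forall>j<l. act l X_pow (?D k) j = X_pow k \<otimes>\<^sub>X X_pow j \<oplus>\<^sub>X f \<otimes>\<^sub>X g j)"
    by (intro allI act_X_row_companion_pow[OF f])
  from choice[OF this] obtain g where g: "\<And>k j. j < l \<Longrightarrow> g k j \<in> carrier RX"
    and eq: "\<And>k j. j < l \<Longrightarrow> act l X_pow (?D k) j = X_pow k \<otimes>\<^sub>X X_pow j \<oplus>\<^sub>X f \<otimes>\<^sub>X g k j"
    by blast
  show ?thesis
  proof
    assume "?D m = ?D n"
    \<comment> \<open>Column 0 already suffices, because X^0 = 1.\<close>
    then have e: "X_pow m \<oplus>\<^sub>X f \<otimes>\<^sub>X g m 0 = X_pow n \<oplus>\<^sub>X f \<otimes>\<^sub>X g n 0"
      using eq[of 0 m] eq[of 0 n] l X_pow_closed by simp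
    have "X_pow m \<ominus>\<^sub>X X_pow n = f \<otimes>\<^sub>X g n 0 \<ominus>\<^sub>X f \<otimes>\<^sub>X g m 0"
      using X_pow_closed fc g l by (intro UP.diff_eq_diff_if_add_eq_add[OF _ _ _ _ e]) auto
    also have "\<dots> = f \<otimes>\<^sub>X (g n 0 \<ominus>\<^sub>X g m 0)"
      using fc g l by (intro UP.diff_distrib(1)[symmetric]) auto
    finally show "f divides\<^sub>X (X_pow m \<ominus>\<^sub>X X_pow n)"
      by (rule dividesI[rotated]) (use g l in auto)
  next
    assume "f divides\<^sub>X (X_pow m \<ominus>\<^sub>X X_pow n)"
    then obtain h where h: "h \<in> carrier RX" "X_pow m \<ominus>\<^sub>X X_pow n = f \<otimes>\<^sub>X h"
      by (auto simp: factor_def)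
    have act_eq: "act l X_pow (?D m) j = act l X_pow (?D n) j" if j: "j < l" for j
    proof -
      let ?p = "act l X_pow (?D m) j" and ?q = "act l X_pow (?D n) j"
      have pc: "?p \<in> carrier RX" "?q \<in> carrier RX"
        by (rule const.row_act_closed[OF X_pow_closed Dc j])+
      have "?p \<ominus>\<^sub>X ?q = (X_pow m \<otimes>\<^sub>X X_pow j \<ominus>\<^sub>X X_pow n \<otimes>\<^sub>X X_pow j) \<oplus>\<^sub>X
          (f \<otimes>\<^sub>X g m j \<ominus>\<^sub>X f \<otimes>\<^sub>X g n j)"
        unfolding eq[OF j] using X_pow_closed fc g[OF j]
        by (intro UP.add_diff_add UP.m_closed) auto
      also have "\<dots> = (X_pow m \<ominus>\<^sub>X X_pow n) \<otimes>\<^sub>X X_pow j \<oplus>\<^sub>X f \<otimes>\<^sub>X (g m j \<ominus>\<^sub>X g n j)"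
        using UP.diff_distrib(1)[OF fc g[OF j] g[OF j], of m n]
          UP.diff_distrib(2)[OF X_pow_closed X_pow_closed X_pow_closed, of m n j] by simp
      also have "\<dots> = f \<otimes>\<^sub>X (h \<otimes>\<^sub>X X_pow j) \<oplus>\<^sub>X f \<otimes>\<^sub>X (g m j \<ominus>\<^sub>X g n j)"
        unfolding h(2) using UP.m_assoc[OF fc h(1) X_pow_closed] by simp
      also have "\<dots> = f \<otimes>\<^sub>X (h \<otimes>\<^sub>X X_pow j \<oplus>\<^sub>X (g m j \<ominus>\<^sub>X g n j))"
        by (rule UP.r_distr[symmetric]) (use fc h(1) X_pow_closed g[OF j] in auto)
      finally have "f divides\<^sub>X (?p \<ominus>\<^sub>X ?q)"
        by (rule dividesI[rotated]) (use h(1) X_pow_closed g[OF j] in auto)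
      \<comment> \<open>Both polynomials have degree below l, so a difference divisible by f must
        vanish.\<close>
      moreover have "length (?p \<ominus>\<^sub>X ?q) \<le> l"
        using pc length_act_X_row[OF Dc j] by (intro length_minus_le) auto
      ultimately have "?p \<ominus>\<^sub>X ?q = \<zero>\<^sub>X" using pc by (intro monic_divides_small[OF f]) auto
      then show ?thesis using pc UP.r_right_minus_eq by blast
    qed
    show "?D m = ?D n"
    proof (rule mat_eqI[OF Dc Dc])
      fix i j assume ij: "i < l" "j < l"
      show "?D m (i, j) = ?D n (i, j)"
        using coeff_act_X_row[OF Dc ij, of m] coeff_act_X_row[OF Dc ij, of n] act_eq[OF ij(2)] by simp
    qed
  qed
qed

text \<open>For j + 1 < l the j-th column of the companion matrix D is the basis vector with index j
  + 1. So column j + 1 of K is column j of K D = D K, that is, D applied to column j of K, and the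
  first column determines all others.\<close>

lemma companion_commuting_eq:
  assumes f: "f \<in> carrier RX" and M: "M \<in> Mat l R" and N: "N \<in> Mat l R"
    and comm: "M \<otimes>\<^bsub>mat_ring R l\<^esub> companion l f = companion l f \<otimes>\<^bsub>mat_ring R l\<^esub> M"
      "N \<otimes>\<^bsub>mat_ring R l\<^esub> companion l f = companion l f \<otimes>\<^bsub>mat_ring R l\<^esub> N"
    and col: "\<And>i. i < l \<Longrightarrow> M (i, 0) = N (i, 0)"
  shows "M = N"
proof (rule mat_eqI[OF M N])
  note Dc = companion_closed[OF f, of l]
  have step: "K (i, Suc j) = (\<Oplus>k\<in>{..<l}. companion l f (i, k) \<otimes> K (k, j))"
    if K: "K \<in> Mat l R" and comm: "K \<otimes>\<^bsub>mat_ring R l\<^esub> companion l f = companion l f \<otimes>\<^bsub>mat_ring R l\<^esub> K"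
      and ij: "i < l" "Suc j < l" for K i j
  proof -
    have "K (i, Suc j) = (\<Oplus>k\<in>{..<l}. if Suc j = k then K (i, k) else \<zero>)"
      using K ij by (intro finsum_singleton[symmetric]) (auto simp: mat_entry_closed)
    also have "\<dots> = (\<Oplus>k\<in>{..<l}. K (i, k) \<otimes> companion l f (k, j))"
      using K ij mat_entry_closed[OF K ij(1)] mat_entry_closed[OF Dc]
      by (intro finsum_cong') (auto simp: companion_def)
    also have "\<dots> = (companion l f \<otimes>\<^bsub>mat_ring R l\<^esub> K) (i, j)"
      using ij comm mat_mult_entry[of i l j R K "companion l f"] by simp
    finally show ?thesis using ij by (simp add: mat_mult_entry)
  qed
  have "M (i, j) = N (i, j)" if "i < l" "j < l" for i j
    using that
  proof (induction j arbitrary: i)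
    case 0
    then show ?case by (intro col)
  next
    case (Suc j)
    have "(\<Oplus>k\<in>{..<l}. companion l f (i, k) \<otimes> M (k, j)) = (\<Oplus>k\<in>{..<l}. companion l f (i, k) \<otimes> N (k, j))"
      using Suc mat_entry_closed[OF Dc] mat_entry_closed[OF N] by (intro finsum_cong') auto
    then show ?case using step[OF M comm(1)] step[OF N comm(2)] Suc.prems by simp
  qed
  then show "\<And>i j. i < l \<Longrightarrow> j < l \<Longrightarrow> M (i, j) = N (i, j)" .
qed

lemma companion_classE:
  assumes "A \<in> companion_class l f" "f \<in> carrier RX"
  obtains Q where "Q \<in> GL l R" "A = inv\<^bsub>mat_ring R l\<^esub> Q \<otimes>\<^bsub>mat_ring R l\<^esub> companion l f \<otimes>\<^bsub>mat_ring R l\<^esub> Q"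
  using assms by (auto simp: companion_class_def)

lemma companion_class_closed:
  assumes "f \<in> carrier RX"
  shows "companion_class l f \<subseteq> Mat l R"
proof -
  interpret MM: Group.monoid "mat_ring R l" by (rule mat_monoid)
  show ?thesis using companion_closed[OF assms] by (auto simp: companion_class_def)
qed

lemma companion_class_pow_eq_iff:
  assumes A: "A \<in> companion_class l f" and f: "monic R l f" and l: "l \<ge> 1"
  shows "A [^]\<^bsub>mat_ring R l\<^esub> (m::nat) = A [^]\<^bsub>mat_ring R l\<^esub> (n::nat)
    \<longleftrightarrow> f divides\<^sub>X (X_pow m \<ominus>\<^sub>X X_pow n)"
proof -
  interpret MM: Group.monoid "mat_ring R l" by (rule mat_monoid)
  note Dc = companion_closed[OF monic_closed[OF f], of l]
  obtain Q where Q: "Q \<in> GL l R" "A = inv\<^bsub>mat_ring R l\<^esub> Q \<otimes>\<^bsub>mat_ring R l\<^esub> companion l f \<otimes>\<^bsub>mat_ring R l\<^esub> Q"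
    using companion_classE[OF A monic_closed[OF f]] .
  have "A [^]\<^bsub>mat_ring R l\<^esub> m = A [^]\<^bsub>mat_ring R l\<^esub> n \<longleftrightarrow>
      companion l f [^]\<^bsub>mat_ring R l\<^esub> m = companion l f [^]\<^bsub>mat_ring R l\<^esub> n"
    unfolding Q(2) MM.conj_pow[OF Q(1) Dc] using MM.conj_cancel[OF Q(1)] Dc by auto
  then show ?thesis using companion_pow_eq_iff[OF f l] by simp
qed


text \<open>
  A matrix commuting with the companion matrix is determined by its first column, so the fibres of
  \<open>Q \<mapsto> Q\<^sup>-\<^sup>1 D Q\<close> have at most \<open>q\<^sup>l\<close> elements.
\<close>

lemma card_GL_le_companion_class:
  assumes fin: "finite (carrier R)" and f: "f \<in> carrier RX" and l: "l \<ge> 1"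
  shows "card (GL l R) \<le> card (companion_class l f) * card (carrier R) ^ l"
  unfolding companion_class_def
proof (rule card_le_card_image_mult)
  interpret MM: Group.monoid "mat_ring R l" by (rule mat_monoid)
  have sub: "GL l R \<subseteq> Mat l R" by (auto simp: Units_def)
  then show "finite (GL l R)" using finite_Mat[OF fin] finite_subset by blast
  let ?D = "companion l f"
  let ?c = "\<lambda>Q. inv\<^bsub>mat_ring R l\<^esub> Q \<otimes>\<^bsub>mat_ring R l\<^esub> ?D \<otimes>\<^bsub>mat_ring R l\<^esub> Q"
  note Dc = companion_closed[OF f, of l]
  fix A assume "A \<in> ?c ` GL l R"
  then obtain Q0 where Q0: "Q0 \<in> GL l R" "A = ?c Q0" by blast
  let ?M = "\<lambda>Q. Q \<otimes>\<^bsub>mat_ring R l\<^esub> inv\<^bsub>mat_ring R l\<^esub> Q0"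
  let ?v = "\<lambda>Q. \<lambda>i\<in>{..<l}. ?M Q (i, 0)"
  have comm: "?M Q \<otimes>\<^bsub>mat_ring R l\<^esub> ?D = ?D \<otimes>\<^bsub>mat_ring R l\<^esub> ?M Q" if Q: "Q \<in> GL l R" "?c Q = A" for Q
    using MM.conj_eq_imp_commute[OF Q0(1) Q(1) Dc] Q(2) Q0(2) by (simp only:)
  have "card {Q \<in> GL l R. ?c Q = A} \<le> card ({..<l} \<rightarrow>\<^sub>E carrier R)"
  proof (rule card_inj_on_le)
    show "finite ({..<l} \<rightarrow>\<^sub>E carrier R)" using fin by (simp add: finite_PiE)
    have Mc: "?M Q \<in> Mat l R" if "Q \<in> GL l R" for Q using that Q0 by (simp add: MM.Units_closed)
    show "?v ` {Q \<in> GL l R. ?c Q = A} \<subseteq> {..<l} \<rightarrow>\<^sub>E carrier R"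
      unfolding image_subset_iff restrict_PiE_iff
    proof (intro ballI)
      fix Q i assume "Q \<in> {Q \<in> GL l R. ?c Q = A}" "i \<in> {..<l}"
      then show "?M Q (i, 0) \<in> carrier R" using l by (intro mat_entry_closed[OF Mc]) auto
    qed
    show "inj_on ?v {Q \<in> GL l R. ?c Q = A}"
    proof (rule inj_onI)
      fix P Q assume "P \<in> {Q \<in> GL l R. ?c Q = A}" "Q \<in> {Q \<in> GL l R. ?c Q = A}" and v: "?v P = ?v Q"
      then have P: "P \<in> GL l R" "?c P = A" and Q: "Q \<in> GL l R" "?c Q = A" by auto
      have "?M P (i, 0) = ?M Q (i, 0)" if "i < l" for i using fun_cong[OF v, of i] that by simp
      then have "?M P = ?M Q"
        by (rule companion_commuting_eq[OF f Mc[OF P(1)] Mc[OF Q(1)] comm[OF P] comm[OF Q]])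
      then have "?M P \<otimes>\<^bsub>mat_ring R l\<^esub> Q0 = ?M Q \<otimes>\<^bsub>mat_ring R l\<^esub> Q0" by simp
      then show "P = Q"
        using MM.Units_closed[OF P(1)] MM.Units_closed[OF Q(1)] Q0(1) MM.Units_closed[OF Q0(1)] MM.Units_inv_closed[OF Q0(1)]
        by (simp add: MM.m_assoc)
    qed
  qed
  then show "card {Q \<in> GL l R. ?c Q = A} \<le> card (carrier R) ^ l"
    by (simp add: card_PiE prod_constant)
qed

end

section \<open>Characteristic polynomials\<close>

context field
begin

interpretation UP: principal_domain RX
  by (rule univ_poly_is_principal[OF carrier_is_subfield])

interpretation const: ring_hom_cring R RX poly_of_const
  by (rule poly_of_const_hom)

abbreviation char_mat :: "(nat \<times> nat \<Rightarrow> 'a) \<Rightarrow> nat \<times> nat \<Rightarrow> 'a list" where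
  "char_mat A \<equiv> (\<lambda>(i, j). (if i = j then X else \<zero>\<^sub>X) \<ominus>\<^sub>X poly_of_const (A (i, j)))"

lemma mat_char_poly_eq: "mat_char_poly R l A = mat_det RX l (char_mat A)"
  by (simp add: mat_char_poly_def)

lemma char_mat_closed:
  "A \<in> Mat l R \<Longrightarrow> i < l \<Longrightarrow> j < l \<Longrightarrow> char_mat A (i, j) \<in> carrier RX"
  using X_closed by (auto simp: mat_entry_closed)

lemma length_poly_of_const: "length (poly_of_const a) \<le> 1"
  by (simp add: poly_of_const_def)

lemma length_char_mat_offdiag:
  assumes "A \<in> Mat l R" "i < l" "j < l" "i \<noteq> j"
  shows "length (char_mat A (i, j)) \<le> 1"
  using assms length_poly_of_const[of "A (i, j)"]
  by (auto simp: mat_entry_closed univ_poly_zero intro!: length_minus_le)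

lemma monic_char_mat_diag:
  assumes "A \<in> Mat l R" "i < l"
  shows "monic R 1 (char_mat A (i, i))"
proof -
  have X: "monic R 1 X" using monic_X_pow[of 1] X_closed by simp
  have c: "poly_of_const (A (i, i)) \<in> carrier RX" using assms by (simp add: mat_entry_closed)
  have "monic R 1 (X \<oplus>\<^sub>X \<ominus>\<^bsub>RX\<^esub> poly_of_const (A (i, i)))"
    using c length_poly_of_const[of "A (i, i)"]
    by (intro monic_add[OF X]) (simp_all only: UP.a_inv_closed univ_poly_a_inv_length[OF carrier_is_subring])
  then show ?thesis by (simp add: a_minus_def)
qed

text \<open>The identity permutation contributes a product of l monic linear factors. Any other
  permutation moves some k, where the entry is a constant, so its product has degree below l and
  does not touch the leading term.\<close>

lemma monic_mat_char_poly:
  assumes A: "A \<in> Mat l R" and l: "l \<ge> 1"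
  shows "monic R l (mat_char_poly R l A)"
proof -
  let ?P = "{\<sigma>. \<sigma> permutes {..<l}}"
  let ?p = "\<lambda>\<sigma>. \<Otimes>\<^bsub>RX\<^esub>i\<in>{..<l}. char_mat A (i, \<sigma> i)"
  let ?t = "\<lambda>\<sigma>. add_pow RX (sign \<sigma>) (?p \<sigma>)"
  have lt: "\<sigma> i < l" if "\<sigma> \<in> ?P" "i < l" for \<sigma> i using that permutes_in_image by fastforce
  have pc: "?p \<sigma> \<in> carrier RX" if "\<sigma> \<in> ?P" for \<sigma>
    by (rule UP.finprod_closed, rule Pi_I, rule char_mat_closed[OF A]) (use lt[OF that] in auto)
  then have tc: "?t \<sigma> \<in> carrier RX" if "\<sigma> \<in> ?P" for \<sigma>
    using that by (simp add: UP.add_pow_sign)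
  have short: "length (?t \<sigma>) \<le> l" if s: "\<sigma> \<in> ?P - {id}" for \<sigma>
  proof -
    from s obtain k where k: "\<sigma> k \<noteq> k" by (auto simp: fun_eq_iff)
    then have kl: "k < l" using s permutes_not_in[of \<sigma> "{..<l}" k] by auto
    let ?b = "\<lambda>i. if \<sigma> i = i then 1 else 0 :: nat"
    have "length (?p \<sigma>) \<le> Suc (\<Sum>i\<in>{..<l}. ?b i)"
    proof (rule length_finprod_le)
      fix i assume "i \<in> {..<l}"
      then have i: "i < l" "\<sigma> i < l" using lt s by auto
      show "char_mat A (i, \<sigma> i) \<in> carrier RX" by (rule char_mat_closed[OF A i])
      show "length (char_mat A (i, \<sigma> i)) \<le> Suc (?b i)"
      proof (cases "\<sigma> i = i")
        case True
        then have "length (char_mat A (i, \<sigma> i)) = 2"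
          using monic_char_mat_diag[OF A i(1)] by (simp only: monic_def)
        then show ?thesis using True by simp
      next
        case False
        then show ?thesis using length_char_mat_offdiag[OF A i] by simp
      qed
    qed simp
    moreover have "(\<Sum>i\<in>{..<l}. ?b i) < (\<Sum>i\<in>{..<l}. 1)"
      by (rule sum_strict_mono_ex1) (use k kl in auto)
    ultimately have "length (?p \<sigma>) \<le> l" by simp
    then show ?thesis
      using pc s by (simp add: UP.add_pow_sign univ_poly_a_inv_length[OF carrier_is_subring])
  qed
  have id: "?t id = (\<Otimes>\<^bsub>RX\<^esub>i\<in>{..<l}. char_mat A (i, i))"
    using pc[of id] by (simp add: UP.add_pow_sign permutes_id)
  have "monic R (\<Sum>i\<in>{..<l}. 1) (\<Otimes>\<^bsub>RX\<^esub>i\<in>{..<l}. char_mat A (i, i))"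
    by (intro monic_finprod finite_lessThan monic_char_mat_diag[OF A]) simp
  then have m: "monic R l (?t id)" unfolding id by simp
  have fin: "finite (?P - {id})" using finite_permutes by blast
  have "mat_char_poly R l A = (\<Oplus>\<^bsub>RX\<^esub>\<sigma>\<in>insert id (?P - {id}). ?t \<sigma>)"
    unfolding mat_char_poly_eq mat_det_def by (rule arg_cong[where f = "finsum RX _"]) (auto simp: permutes_id)
  also have "\<dots> = ?t id \<oplus>\<^sub>X (\<Oplus>\<^bsub>RX\<^esub>\<sigma>\<in>?P - {id}. ?t \<sigma>)"
  proof (rule UP.finsum_insert[OF fin])
    show "?t id \<in> carrier RX" by (rule tc) (simp add: permutes_id)
  qed (use tc in blast)+
  finally have eq: "mat_char_poly R l A = ?t id \<oplus>\<^sub>X (\<Oplus>\<^bsub>RX\<^esub>\<sigma>\<in>?P - {id}. ?t \<sigma>)" .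
  show ?thesis
    unfolding eq
  proof (rule monic_add[OF m])
    show "(\<Oplus>\<^bsub>RX\<^esub>\<sigma>\<in>?P - {id}. ?t \<sigma>) \<in> carrier RX" by (rule UP.finsum_closed) (use tc in auto)
    show "length (\<Oplus>\<^bsub>RX\<^esub>\<sigma>\<in>?P - {id}. ?t \<sigma>) \<le> l"
      by (rule length_finsum_le[OF fin]) (use tc short in auto)
  qed
qed

text \<open>
  Modulo \<open>f\<close>, the row \<open>(1, X, \<dots>, X\<^sup>l\<^sup>-\<^sup>1) Q\<close> is a left eigenvector of \<open>A\<close> for the
  eigenvalue \<open>X\<close>.  Its entries generate the unit ideal, so \<open>f\<close> divides the characteristic
  polynomial.
\<close>

lemma companion_class_row_eigenvector:
  assumes Q: "Q \<in> GL l R" and f: "monic R l f" and j: "j < l"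
    and A: "A = inv\<^bsub>mat_ring R l\<^esub> Q \<otimes>\<^bsub>mat_ring R l\<^esub> companion l f \<otimes>\<^bsub>mat_ring R l\<^esub> Q"
  shows "(\<Oplus>\<^bsub>RX\<^esub>i\<in>{..<l}. act l X_pow Q i \<otimes>\<^sub>X char_mat A (i, j)) = f \<otimes>\<^sub>X poly_of_const (Q (l - 1, j))"
proof -
  interpret MM: Group.monoid "mat_ring R l" by (rule mat_monoid)
  note fc = monic_closed[OF f]
  note Dc = companion_closed[OF fc, of l]
  note Qc = MM.Units_closed[OF Q] and Qi = MM.Units_inv_closed[OF Q]
  let ?w = "act l X_pow Q"
  let ?\<delta> = "\<lambda>i. if i = l - 1 then \<one>\<^sub>X else \<zero>\<^sub>X"
  have Ac: "A \<in> Mat l R" unfolding A using Qc Qi Dc by simp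
  have wc: "?w i \<in> carrier RX" if "i < l" for i
    by (rule const.row_act_closed[OF X_pow_closed Qc that])
  have QA: "Q \<otimes>\<^bsub>mat_ring R l\<^esub> A = companion l f \<otimes>\<^bsub>mat_ring R l\<^esub> Q"
  proof -
    have "Q \<otimes>\<^bsub>mat_ring R l\<^esub> A = (Q \<otimes>\<^bsub>mat_ring R l\<^esub> inv\<^bsub>mat_ring R l\<^esub> Q) \<otimes>\<^bsub>mat_ring R l\<^esub> companion l f \<otimes>\<^bsub>mat_ring R l\<^esub> Q"
      unfolding A using Qc Qi Dc by (simp add: MM.m_assoc del: MM.Units_r_inv)
    then show ?thesis using Q Qc Dc by simp
  qed
  have "act l ?w A j = act l X_pow (Q \<otimes>\<^bsub>mat_ring R l\<^esub> A) j"
    by (rule const.row_act_mult[OF X_pow_closed Qc Ac j, symmetric])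
  also have "\<dots> = act l (act l X_pow (companion l f)) Q j"
    unfolding QA by (rule const.row_act_mult[OF X_pow_closed Dc Qc j])
  also have "\<dots> = act l (\<lambda>i. X \<otimes>\<^sub>X X_pow i \<oplus>\<^sub>X \<ominus>\<^bsub>RX\<^esub> f \<otimes>\<^sub>X ?\<delta> i) Q j"
    by (rule const.row_act_cong[OF act_X_row_companion[OF f] _ Qc j]) (use X_closed fc in auto)
  also have "\<dots> = act l (\<lambda>i. X \<otimes>\<^sub>X X_pow i) Q j \<oplus>\<^sub>X act l (\<lambda>i. \<ominus>\<^bsub>RX\<^esub> f \<otimes>\<^sub>X ?\<delta> i) Q j"
    by (rule const.row_act_add[OF _ _ Qc j]) (use X_closed fc in auto)
  also have "act l (\<lambda>i. X \<otimes>\<^sub>X X_pow i) Q j = X \<otimes>\<^sub>X ?w j"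
    by (rule const.row_act_scale[OF X_pow_closed X_closed Qc j])
  also have "act l (\<lambda>i. \<ominus>\<^bsub>RX\<^esub> f \<otimes>\<^sub>X ?\<delta> i) Q j = \<ominus>\<^bsub>RX\<^esub> f \<otimes>\<^sub>X act l ?\<delta> Q j"
    by (rule const.row_act_scale[OF _ _ Qc j]) (use fc in auto)
  also have "act l ?\<delta> Q j = \<one>\<^sub>X \<otimes>\<^sub>X poly_of_const (Q (l - 1, j))"
    by (rule const.row_act_single[OF _ Qc j]) (use j in auto)
  finally have wA: "act l ?w A j = X \<otimes>\<^sub>X ?w j \<oplus>\<^sub>X \<ominus>\<^bsub>RX\<^esub> f \<otimes>\<^sub>X (\<one>\<^sub>X \<otimes>\<^sub>X poly_of_const (Q (l - 1, j)))" .
  let ?q = "poly_of_const (Q (l - 1, j))"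
  have qc: "?q \<in> carrier RX" using j Qc by (simp add: mat_entry_closed)
  have Acc: "poly_of_const (A (i, j)) \<in> carrier RX" if "i < l" for i
    using mat_entry_closed[OF Ac that j] by simp
  have wAc: "act l ?w A j \<in> carrier RX" by (rule const.row_act_closed[OF wc Ac j])
  have "(\<Oplus>\<^bsub>RX\<^esub>i\<in>{..<l}. ?w i \<otimes>\<^sub>X char_mat A (i, j))
      = (\<Oplus>\<^bsub>RX\<^esub>i\<in>{..<l}. (if j = i then ?w i \<otimes>\<^sub>X X else \<zero>\<^sub>X) \<oplus>\<^sub>X \<ominus>\<^bsub>RX\<^esub> (?w i \<otimes>\<^sub>X poly_of_const (A (i, j))))"
  proof (rule UP.finsum_cong'[OF refl])
    fix i assume "i \<in> {..<l}"
    then show "?w i \<otimes>\<^sub>X char_mat A (i, j) =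
        (if j = i then ?w i \<otimes>\<^sub>X X else \<zero>\<^sub>X) \<oplus>\<^sub>X \<ominus>\<^bsub>RX\<^esub> (?w i \<otimes>\<^sub>X poly_of_const (A (i, j)))"
      using wc[of i] Acc[of i] X_closed by (auto simp: a_minus_def UP.r_distr UP.r_minus)
  qed (use wc Acc X_closed in auto)
  also have "\<dots> = (\<Oplus>\<^bsub>RX\<^esub>i\<in>{..<l}. if j = i then ?w i \<otimes>\<^sub>X X else \<zero>\<^sub>X)
      \<oplus>\<^sub>X (\<Oplus>\<^bsub>RX\<^esub>i\<in>{..<l}. \<ominus>\<^bsub>RX\<^esub> (?w i \<otimes>\<^sub>X poly_of_const (A (i, j))))"
    by (rule UP.finsum_addf) (use wc Acc X_closed in auto)
  also have "(\<Oplus>\<^bsub>RX\<^esub>i\<in>{..<l}. if j = i then ?w i \<otimes>\<^sub>X X else \<zero>\<^sub>X) = ?w j \<otimes>\<^sub>X X"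
    by (rule UP.finsum_singleton) (use j wc X_closed in auto)
  also have "(\<Oplus>\<^bsub>RX\<^esub>i\<in>{..<l}. \<ominus>\<^bsub>RX\<^esub> (?w i \<otimes>\<^sub>X poly_of_const (A (i, j)))) = \<ominus>\<^bsub>RX\<^esub> act l ?w A j"
    unfolding row_act_def[of _ _ _ _ A] by (rule UP.finsum_uminus) (use wc Acc in auto)
  also have "?w j \<otimes>\<^sub>X X \<oplus>\<^sub>X \<ominus>\<^bsub>RX\<^esub> act l ?w A j = f \<otimes>\<^sub>X ?q"
    unfolding wA using wc[OF j] X_closed fc qc
    by (simp add: UP.minus_add UP.l_minus UP.r_neg1 UP.r_neg2 UP.m_comm[of "?w j" X])
  finally show ?thesis .
qed

text \<open>With w = (1, X, ..., X^(l-1)) Q, each w_k times the characteristic polynomial is a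
  multiple of f by \<open>mat_det_row_combination\<close>. The first entry of w Q^(-1) is 1, so
  combining these multiples with the first column of Q^(-1) shows that f divides the characteristic
  polynomial; both are monic of degree l.\<close>

lemma mat_char_poly_companion_class:
  assumes A: "A \<in> companion_class l f" and f: "monic R l f" and l: "l \<ge> 1"
  shows "mat_char_poly R l A = f"
proof -
  interpret MM: Group.monoid "mat_ring R l" by (rule mat_monoid)
  note fc = monic_closed[OF f]
  obtain Q where Q: "Q \<in> GL l R" "A = inv\<^bsub>mat_ring R l\<^esub> Q \<otimes>\<^bsub>mat_ring R l\<^esub> companion l f \<otimes>\<^bsub>mat_ring R l\<^esub> Q"
    using companion_classE[OF A fc] .
  note Qc = MM.Units_closed[OF Q(1)] and Qi = MM.Units_inv_closed[OF Q(1)]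
  have Ac: "A \<in> Mat l R" using A companion_class_closed[OF fc] by blast
  let ?\<chi> = "mat_char_poly R l A"
  let ?w = "act l X_pow Q"
  let ?c = "\<lambda>k. poly_of_const ((inv\<^bsub>mat_ring R l\<^esub> Q) (k, 0))"
  have \<chi>: "monic R l ?\<chi>" by (rule monic_mat_char_poly[OF Ac l])
  note \<chi>c = monic_closed[OF \<chi>]
  have wc: "?w i \<in> carrier RX" if "i < l" for i
    by (rule const.row_act_closed[OF X_pow_closed Qc that])
  have cc: "?c k \<in> carrier RX" if "k < l" for k
    using mat_entry_closed[OF Qi that, of 0] l by simp
  have qc: "poly_of_const (Q (l - 1, j)) \<in> carrier RX" if "j < l" for j
    using mat_entry_closed[OF Qc _ that, of "l - 1"] l by simp
  have "\<exists>h\<in>carrier RX. ?w k \<otimes>\<^sub>X ?\<chi> = f \<otimes>\<^sub>X h" if k: "k < l" for k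
  proof -
    let ?P = "{\<sigma>. \<sigma> permutes {..<l}}"
    let ?N = "char_mat A"
    have lt: "\<sigma> i < l" if "\<sigma> \<in> ?P" "i < l" for \<sigma> i using that permutes_in_image by fastforce
    have Nc: "\<And>i j. i < l \<Longrightarrow> j < l \<Longrightarrow> ?N (i, j) \<in> carrier RX" by (rule char_mat_closed[OF Ac])
    have cof: "UP.row_cofactor l ?N k \<sigma> \<in> carrier RX" if "\<sigma> \<in> ?P" for \<sigma>
      by (rule UP.row_cofactor_closed[of l ?N, OF Nc]) (use that in auto)
    \<comment> \<open>Expansion along the replaced row: all entries of that row carry the factor f,
      and this is what remains after taking f out.\<close>
    let ?h = "\<Oplus>\<^bsub>RX\<^esub>\<sigma>\<in>?P. poly_of_const (Q (l - 1, \<sigma> k)) \<otimes>\<^sub>X UP.row_cofactor l ?N k \<sigma>"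
    have "?w k \<otimes>\<^sub>X ?\<chi> = mat_det RX l (UP.replace_row ?N k (\<lambda>j. \<Oplus>\<^bsub>RX\<^esub>i\<in>{..<l}. ?w i \<otimes>\<^sub>X ?N (i, j)))"
      unfolding mat_char_poly_eq by (rule UP.mat_det_row_combination[of l ?N ?w k, OF Nc wc k])
    also have "\<dots> = (\<Oplus>\<^bsub>RX\<^esub>\<sigma>\<in>?P. (\<Oplus>\<^bsub>RX\<^esub>i\<in>{..<l}. ?w i \<otimes>\<^sub>X ?N (i, \<sigma> k)) \<otimes>\<^sub>X UP.row_cofactor l ?N k \<sigma>)"
    proof (rule UP.mat_det_replace_row[of l ?N _ k, OF Nc _ k])
      fix j assume "j < l"
      then show "(\<Oplus>\<^bsub>RX\<^esub>i\<in>{..<l}. ?w i \<otimes>\<^sub>X ?N (i, j)) \<in> carrier RX"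
        using wc Nc by (intro UP.finsum_closed Pi_I UP.m_closed) auto
    qed
    also have "\<dots> = (\<Oplus>\<^bsub>RX\<^esub>\<sigma>\<in>?P. f \<otimes>\<^sub>X (poly_of_const (Q (l - 1, \<sigma> k)) \<otimes>\<^sub>X UP.row_cofactor l ?N k \<sigma>))"
    proof (rule UP.finsum_cong'[OF refl])
      fix \<sigma> assume s: "\<sigma> \<in> ?P"
      show "(\<Oplus>\<^bsub>RX\<^esub>i\<in>{..<l}. ?w i \<otimes>\<^sub>X ?N (i, \<sigma> k)) \<otimes>\<^sub>X UP.row_cofactor l ?N k \<sigma>
          = f \<otimes>\<^sub>X (poly_of_const (Q (l - 1, \<sigma> k)) \<otimes>\<^sub>X UP.row_cofactor l ?N k \<sigma>)"
        unfolding companion_class_row_eigenvector[OF Q(1) f lt[OF s k] Q(2)]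
        by (rule UP.m_assoc[OF fc qc[OF lt[OF s k]] cof[OF s]])
    qed (use fc qc lt k cof in auto)
    also have "\<dots> = f \<otimes>\<^sub>X ?h"
      by (rule UP.finsum_rdistr[symmetric]) (use finite_permutes fc qc lt k cof in auto)
    finally have "?w k \<otimes>\<^sub>X ?\<chi> = f \<otimes>\<^sub>X ?h" .
    moreover have "?h \<in> carrier RX" by (rule UP.finsum_closed) (use qc lt k cof in auto)
    ultimately show ?thesis by blast
  qed
  then obtain h where h: "\<And>k. k < l \<Longrightarrow> h k \<in> carrier RX"
    "\<And>k. k < l \<Longrightarrow> ?w k \<otimes>\<^sub>X ?\<chi> = f \<otimes>\<^sub>X h k" by metis
  have "\<one>\<^sub>X = act l X_pow \<one>\<^bsub>mat_ring R l\<^esub> 0"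
    using const.row_act_one[of l X_pow 0] X_pow_closed l by simp
  also have "\<one>\<^bsub>mat_ring R l\<^esub> = Q \<otimes>\<^bsub>mat_ring R l\<^esub> inv\<^bsub>mat_ring R l\<^esub> Q" using Q(1) by simp
  also have "act l X_pow (Q \<otimes>\<^bsub>mat_ring R l\<^esub> inv\<^bsub>mat_ring R l\<^esub> Q) 0 = act l ?w (inv\<^bsub>mat_ring R l\<^esub> Q) 0"
    by (rule const.row_act_mult[OF X_pow_closed Qc Qi]) (use l in simp)
  finally have one: "\<one>\<^sub>X = (\<Oplus>\<^bsub>RX\<^esub>k\<in>{..<l}. ?w k \<otimes>\<^sub>X ?c k)" by (simp add: row_act_def[of _ _ _ _ "inv\<^bsub>mat_ring R l\<^esub> Q"])
  have "?\<chi> = ?\<chi> \<otimes>\<^sub>X (\<Oplus>\<^bsub>RX\<^esub>k\<in>{..<l}. ?w k \<otimes>\<^sub>X ?c k)" unfolding one[symmetric] using \<chi>c by simp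
  also have "\<dots> = (\<Oplus>\<^bsub>RX\<^esub>k\<in>{..<l}. ?\<chi> \<otimes>\<^sub>X (?w k \<otimes>\<^sub>X ?c k))"
    by (rule UP.finsum_rdistr) (use \<chi>c wc cc in auto)
  also have "\<dots> = (\<Oplus>\<^bsub>RX\<^esub>k\<in>{..<l}. f \<otimes>\<^sub>X (h k \<otimes>\<^sub>X ?c k))"
  proof (rule UP.finsum_cong'[OF refl])
    fix k assume "k \<in> {..<l}"
    then have k: "k < l" by simp
    have "?\<chi> \<otimes>\<^sub>X (?w k \<otimes>\<^sub>X ?c k) = (?w k \<otimes>\<^sub>X ?\<chi>) \<otimes>\<^sub>X ?c k"
      using \<chi>c wc[OF k] cc[OF k] by (simp add: UP.m_ac)
    also have "\<dots> = f \<otimes>\<^sub>X (h k \<otimes>\<^sub>X ?c k)"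
      unfolding h(2)[OF k] by (rule UP.m_assoc[OF fc h(1)[OF k] cc[OF k]])
    finally show "?\<chi> \<otimes>\<^sub>X (?w k \<otimes>\<^sub>X ?c k) = f \<otimes>\<^sub>X (h k \<otimes>\<^sub>X ?c k)" .
  qed (use fc h(1) cc in auto)
  also have "\<dots> = f \<otimes>\<^sub>X (\<Oplus>\<^bsub>RX\<^esub>k\<in>{..<l}. h k \<otimes>\<^sub>X ?c k)"
    by (rule UP.finsum_rdistr[symmetric]) (use fc h(1) cc in auto)
  finally have "f divides\<^sub>X ?\<chi>"
    by (rule dividesI[rotated]) (use h(1) cc in \<open>auto intro!: UP.finsum_closed\<close>)
  then show ?thesis using monic_divides_eq[OF f \<chi>] by simp
qed

end

section \<open>Factorization into monic irreducibles\<close>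

definition monic_irreds :: "('a, 'm) ring_scheme \<Rightarrow> 'a list set" where
  "monic_irreds R = {f \<in> carrier (poly_ring R). pirreducible\<^bsub>R\<^esub> (carrier R) f \<and> lead_coeff f = \<one>\<^bsub>R\<^esub>}"

context field
begin

interpretation UP: principal_domain RX
  by (rule univ_poly_is_principal[OF carrier_is_subfield])

interpretation const: ring_hom_cring R RX poly_of_const
  by (rule poly_of_const_hom)

lemma monic_irreds_closed: "\<phi> \<in> monic_irreds R \<Longrightarrow> \<phi> \<in> carrier RX"
  by (simp add: monic_irreds_def)

lemma monic_irreds_degree:
  assumes "\<phi> \<in> monic_irreds R"
  shows "degree \<phi> \<ge> 1" "monic R (degree \<phi>) \<phi>"
proof -
  show 1: "degree \<phi> \<ge> 1"
    using assms pirreducible_degree[OF carrier_is_subfield, of \<phi>] by (simp add: monic_irreds_def)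
  then show "monic R (degree \<phi>) \<phi>"
    using assms by (auto simp: monic_irreds_def monic_def)
qed

lemma monic_irreds_prime:
  assumes "\<phi> \<in> monic_irreds R" "a \<in> carrier RX" "b \<in> carrier RX" "\<phi> divides\<^sub>X (a \<otimes>\<^sub>X b)"
  shows "\<phi> divides\<^sub>X a \<or> \<phi> divides\<^sub>X b"
proof -
  have "pprime (carrier R) \<phi>"
    using assms(1) pprime_iff_pirreducible[OF carrier_is_subfield] by (auto simp: monic_irreds_def)
  then show ?thesis
    using pprimeE(3)[OF carrier_is_subfield monic_irreds_closed[OF assms(1)] _ assms(2,3)] assms(4)
    by (simp add: pdivides_def)
qed

lemma RX_Units_iff_length:
  assumes p: "p \<in> carrier RX"
  shows "p \<in> Units RX \<longleftrightarrow> length p = 1"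
proof
  assume "length p = 1"
  then obtain k where k: "p = [k]" by (cases p) auto
  then show "p \<in> Units RX"
    using p unfolding univ_poly_units[OF carrier_is_subfield] by (auto simp: univ_poly_carrier[symmetric] polynomial_def)
next
  assume "p \<in> Units RX"
  then show "length p = 1" unfolding univ_poly_units[OF carrier_is_subfield] by auto
qed

lemma divides_trans_RX:
  "a \<in> carrier RX \<Longrightarrow> a divides\<^sub>X b \<Longrightarrow> b divides\<^sub>X c \<Longrightarrow> a divides\<^sub>X c"
  by (rule UP.divides_trans)

lemma monic_irreds_not_divides_one:
  assumes "\<phi> \<in> monic_irreds R"
  shows "\<not> \<phi> divides\<^sub>X \<one>\<^sub>X"
proof
  assume "\<phi> divides\<^sub>X \<one>\<^sub>X"
  then have "\<phi> \<in> Units RX" using monic_irreds_closed[OF assms] UP.divides_one by blast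
  then show False using RX_Units_iff_length[OF monic_irreds_closed[OF assms]] monic_irreds_degree[OF assms] by auto
qed

lemma monic_irreds_divides_eq:
  assumes "\<phi> \<in> monic_irreds R" "\<psi> \<in> monic_irreds R" "\<phi> divides\<^sub>X \<psi>"
  shows "\<phi> = \<psi>"
proof -
  have "\<phi> \<sim>\<^bsub>RX\<^esub> \<psi>"
    using divides_pirreducible_condition[of "carrier R" \<psi> \<phi>] assms
      RX_Units_iff_length[of \<phi>] monic_irreds_degree[OF assms(1)] by (auto simp: monic_irreds_def)
  then have "length \<phi> = length \<psi>"
    using associated_polynomials_imp_same_length[OF carrier_is_subring] assms monic_irreds_closed by blast
  then show ?thesis
    using monic_divides_eq[of "degree \<phi>" \<phi> \<psi>] monic_irreds_degree[OF assms(1)] monic_irreds_degree[OF assms(2)] assms(3)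
    by simp
qed

lemma monic_irreds_divides_finprod:
  assumes \<phi>: "\<phi> \<in> monic_irreds R" and "finite S" "S \<subseteq> monic_irreds R"
    and "\<phi> divides\<^sub>X (\<Otimes>\<^bsub>RX\<^esub>\<psi>\<in>S. \<psi>)"
  shows "\<phi> \<in> S"
  using assms(2-4)
proof (induction S rule: finite_induct)
  case empty
  then show ?case using monic_irreds_not_divides_one[OF \<phi>] by simp
next
  case (insert \<psi> S)
  have c: "(\<Otimes>\<^bsub>RX\<^esub>\<psi>\<in>S. \<psi>) \<in> carrier RX" "\<psi> \<in> carrier RX"
    using insert.prems(1) monic_irreds_closed by (auto intro!: UP.finprod_closed)
  have "(\<Otimes>\<^bsub>RX\<^esub>\<psi>\<in>insert \<psi> S. \<psi>) = \<psi> \<otimes>\<^sub>X (\<Otimes>\<^bsub>RX\<^esub>\<psi>\<in>S. \<psi>)"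
    by (rule UP.finprod_insert) (use insert monic_irreds_closed in auto)
  then have "\<phi> divides\<^sub>X \<psi> \<or> \<phi> divides\<^sub>X (\<Otimes>\<^bsub>RX\<^esub>\<psi>\<in>S. \<psi>)"
    using monic_irreds_prime[OF \<phi> c(2,1)] insert.prems(2) by simp
  then show ?case using insert monic_irreds_divides_eq[OF \<phi>] by auto
qed

lemma divides_finprod:
  assumes "finite S" "S \<subseteq> carrier RX" "\<phi> \<in> S"
  shows "\<phi> divides\<^sub>X (\<Otimes>\<^bsub>RX\<^esub>\<psi>\<in>S. \<psi>)"
proof -
  have "(\<Otimes>\<^bsub>RX\<^esub>\<psi>\<in>insert \<phi> (S - {\<phi>}). \<psi>) = \<phi> \<otimes>\<^sub>X (\<Otimes>\<^bsub>RX\<^esub>\<psi>\<in>S - {\<phi>}. \<psi>)"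
    by (rule UP.finprod_insert) (use assms in auto)
  moreover have "insert \<phi> (S - {\<phi>}) = S" using assms(3) by blast
  moreover have "(\<Otimes>\<^bsub>RX\<^esub>\<psi>\<in>S - {\<phi>}. \<psi>) \<in> carrier RX"
    by (rule UP.finprod_closed) (use assms in auto)
  ultimately show ?thesis by (intro dividesI) auto
qed

text \<open>Both sets consist of exactly the monic irreducible divisors of the common
  product.\<close>

lemma finprod_monic_irreds_inj:
  assumes "finite S" "S \<subseteq> monic_irreds R" "finite T" "T \<subseteq> monic_irreds R"
    and "(\<Otimes>\<^bsub>RX\<^esub>\<psi>\<in>S. \<psi>) = (\<Otimes>\<^bsub>RX\<^esub>\<psi>\<in>T. \<psi>)"
  shows "S = T"
proof -
  have S: "S \<subseteq> carrier RX" and T: "T \<subseteq> carrier RX" using assms monic_irreds_closed by auto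
  show ?thesis
  proof (intro equalityI subsetI)
    fix \<phi> assume "\<phi> \<in> S"
    then show "\<phi> \<in> T"
      using divides_finprod[OF assms(1) S, of \<phi>] assms monic_irreds_divides_finprod[of \<phi> T] by auto
  next
    fix \<phi> assume "\<phi> \<in> T"
    then show "\<phi> \<in> S"
      using divides_finprod[OF assms(3) T, of \<phi>] assms monic_irreds_divides_finprod[of \<phi> S] by auto
  qed
qed

text \<open>A new factor \<phi> is prime and does not divide the product of the other irreducibles,
  so it divides the cofactor of that product in h.\<close>

lemma finprod_monic_irreds_divides:
  assumes "finite S" "S \<subseteq> monic_irreds R" "h \<in> carrier RX" "\<And>\<phi>. \<phi> \<in> S \<Longrightarrow> \<phi> divides\<^sub>X h"
  shows "(\<Otimes>\<^bsub>RX\<^esub>\<psi>\<in>S. \<psi>) divides\<^sub>X h"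
  using assms
proof (induction S rule: finite_induct)
  case empty
  then show ?case by (auto intro!: dividesI[of h])
next
  case (insert \<phi> S)
  let ?s = "\<Otimes>\<^bsub>RX\<^esub>\<psi>\<in>S. \<psi>"
  have sc: "?s \<in> carrier RX" by (rule UP.finprod_closed) (use insert monic_irreds_closed in auto)
  have \<phi>: "\<phi> \<in> monic_irreds R" and \<phi>c: "\<phi> \<in> carrier RX" using insert monic_irreds_closed by auto
  obtain g where g: "g \<in> carrier RX" "h = ?s \<otimes>\<^sub>X g" using insert by (auto simp: factor_def)
  have "\<phi> divides\<^sub>X (?s \<otimes>\<^sub>X g)" using insert g by auto
  moreover have "\<not> \<phi> divides\<^sub>X ?s" using monic_irreds_divides_finprod[OF \<phi> insert.hyps(1)] insert by auto
  ultimately have "\<phi> divides\<^sub>X g" using monic_irreds_prime[OF \<phi> sc g(1)] by blast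
  then obtain k where k: "k \<in> carrier RX" "g = \<phi> \<otimes>\<^sub>X k" by (auto simp: factor_def)
  have "(\<Otimes>\<^bsub>RX\<^esub>\<psi>\<in>insert \<phi> S. \<psi>) = \<phi> \<otimes>\<^sub>X ?s"
    by (rule UP.finprod_insert) (use insert monic_irreds_closed in auto)
  then have "h = (\<Otimes>\<^bsub>RX\<^esub>\<psi>\<in>insert \<phi> S. \<psi>) \<otimes>\<^sub>X k"
    using g k sc \<phi>c by (simp add: UP.m_ac)
  then show ?case using k by (intro dividesI) auto
qed

text \<open>The factors of a reducible polynomial need not be monic; moving the leading coefficient
  of q into r makes the first factor monic and keeps the product.\<close>

lemma exists_monic_divisor_if_length:
  assumes q: "q \<in> carrier RX" "q \<noteq> []" and r: "r \<in> carrier RX"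
  shows "\<exists>q'. monic R (degree q) q' \<and> q' divides\<^sub>X (q \<otimes>\<^sub>X r)"
proof -
  let ?k = "lead_coeff q"
  have k: "?k \<in> carrier R" "?k \<noteq> \<zero>"
    using RX_polynomial[OF q(1)] q(2) by (cases q; auto simp: polynomial_def)+
  then have ik: "inv ?k \<in> carrier R" "inv ?k \<otimes> ?k = \<one>" "?k \<otimes> inv ?k = \<one>" "inv ?k \<noteq> \<zero>"
    using field_Units by (auto simp: Units_r_inv)
  let ?c = "poly_of_const (inv ?k)" and ?d = "poly_of_const ?k"
  have cd: "?c \<in> carrier RX" "?d \<in> carrier RX" "?c \<otimes>\<^sub>X ?d = \<one>\<^sub>X"
    using k ik const.hom_mult[of "inv ?k" ?k] by auto
  have c: "?c = [inv ?k]" using ik by (simp add: poly_of_const_def)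
  let ?q = "?c \<otimes>\<^sub>X q"
  have "length ?q = length q"
    using length_mult[of ?c q] cd q c by simp
  moreover have "lead_coeff ?q = inv ?k \<otimes> ?k"
    using poly_mult_lead_coeff[OF carrier_is_subring RX_polynomial RX_polynomial, of ?c q] cd q c
    by (simp add: univ_poly_mult)
  ultimately have "monic R (degree q) ?q" using cd q ik by (simp add: monic_def)
  moreover have "q \<otimes>\<^sub>X r = ?q \<otimes>\<^sub>X (?d \<otimes>\<^sub>X r)"
  proof -
    have "?q \<otimes>\<^sub>X (?d \<otimes>\<^sub>X r) = (?c \<otimes>\<^sub>X ?d) \<otimes>\<^sub>X (q \<otimes>\<^sub>X r)"
      using cd(1,2) q r by (simp add: UP.m_ac)
    then show ?thesis using cd(3) q r by simp
  qed
  ultimately show ?thesis using cd q r by (intro exI[of _ ?q] conjI dividesI[of "?d \<otimes>\<^sub>X r"]) auto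
qed

lemma exists_monic_irred_divisor:
  assumes "monic R n f" "n \<ge> 1"
  shows "\<exists>\<phi>\<in>monic_irreds R. \<phi> divides\<^sub>X f"
  using assms
proof (induction n arbitrary: f rule: less_induct)
  case (less n)
  note f = monic_closed[OF less.prems(1)]
  show ?case
  proof (cases "pirreducible (carrier R) f")
    case True
    then have "f \<in> monic_irreds R" using less.prems by (simp add: monic_irreds_def monic_def)
    then show ?thesis using UP.divides_refl[OF f] by blast
  next
    case False
    have "f \<notin> Units RX" using RX_Units_iff_length[OF f] less.prems by (simp add: monic_def)
    then obtain q r where qr: "q \<in> carrier RX" "r \<in> carrier RX" "f = q \<otimes>\<^sub>X r"
      "q \<notin> Units RX" "r \<notin> Units RX"
      using pirreducibleI[OF carrier_is_subring f] monic_nonzero[OF less.prems(1)] False by blast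
    have ne: "q \<noteq> []" "r \<noteq> []"
      using qr monic_nonzero[OF less.prems(1)] UP.l_null[of r] UP.r_null[of q] by (auto simp: univ_poly_zero)
    have "length q \<noteq> 1" "length r \<noteq> 1" using RX_Units_iff_length qr by auto
    then have "length q \<ge> 2" "length r \<ge> 2" using ne by (auto simp: Suc_le_eq numeral_2_eq_2 neq_Nil_conv)
    then have d: "degree q < n" "degree q \<ge> 1"
      using length_mult[OF qr(1,2) ne] qr(3) less.prems(1) by (auto simp: monic_def)
    obtain q' where q': "monic R (degree q) q'" "q' divides\<^sub>X f"
      using exists_monic_divisor_if_length[OF qr(1) ne(1) qr(2)] qr(3) by auto
    obtain \<phi> where "\<phi> \<in> monic_irreds R" "\<phi> divides\<^sub>X q'" using less.IH[OF d(1) q'(1) d(2)] by blast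
    then show ?thesis using q'(2) divides_trans_RX monic_irreds_closed by blast
  qed
qed

lemma monic_quotient:
  assumes f: "monic R n f" and \<phi>: "monic R d \<phi>" and g: "g \<in> carrier RX" and eq: "f = \<phi> \<otimes>\<^sub>X g"
  shows "d \<le> n" "monic R (n - d) g"
proof -
  have ne: "g \<noteq> []" using eq monic_nonzero[OF f] UP.r_null[OF monic_closed[OF \<phi>]] by (auto simp: univ_poly_zero)
  have len: "Suc (length f) = length \<phi> + length g"
    using length_mult[OF monic_closed[OF \<phi>] g monic_nonzero[OF \<phi>] ne] eq by simp
  moreover have "length g \<ge> 1" using ne by (cases g) auto
  ultimately show dn: "d \<le> n" using f \<phi> by (simp add: monic_def)
  have "lead_coeff f = lead_coeff \<phi> \<otimes> lead_coeff g"
    using poly_mult_lead_coeff[OF carrier_is_subring RX_polynomial RX_polynomial, of \<phi> g] monic_closed[OF \<phi>] g ne monic_nonzero[OF \<phi>] eq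
    by (simp add: univ_poly_mult)
  moreover have "lead_coeff g \<in> carrier R" using RX_set[OF g] ne by (cases g) auto
  ultimately have "lead_coeff g = \<one>" using f \<phi> by (simp add: monic_def)
  then show "monic R (n - d) g" using len f \<phi> g dn by (auto simp: monic_def)
qed

text \<open>Splitting off an irreducible \<phi> leaves a quotient that inherits squarefreeness.
  Squarefreeness of f keeps \<phi> out of the set obtained for the quotient, so the product runs
  over a set rather than a multiset.\<close>

lemma squarefree_monic_eq_finprod:
  assumes "monic R n f" "\<And>d \<phi>. d \<ge> 1 \<Longrightarrow> monic R d \<phi> \<Longrightarrow> \<not> (\<phi> \<otimes>\<^sub>X \<phi>) divides\<^sub>X f"
  shows "\<exists>S. finite S \<and> S \<subseteq> monic_irreds R \<and> f = (\<Otimes>\<^bsub>RX\<^esub>\<psi>\<in>S. \<psi>)"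
  using assms
proof (induction n arbitrary: f rule: less_induct)
  case (less n)
  note f = monic_closed[OF less.prems(1)]
  show ?case
  proof (cases "n = 0")
    case True
    then have "f = \<one>\<^sub>X" using less.prems(1) by (cases f) (auto simp: monic_def univ_poly_one)
    then show ?thesis by (intro exI[of _ "{}"]) simp
  next
    case False
    then obtain \<phi> where \<phi>: "\<phi> \<in> monic_irreds R" "\<phi> divides\<^sub>X f"
      using exists_monic_irred_divisor[OF less.prems(1)] by auto
    note \<phi>c = monic_irreds_closed[OF \<phi>(1)]
    obtain g where g: "g \<in> carrier RX" "f = \<phi> \<otimes>\<^sub>X g" using \<phi>(2) by (auto simp: factor_def)
    note mg = monic_quotient[OF less.prems(1) monic_irreds_degree(2)[OF \<phi>(1)] g]
    have gf: "g divides\<^sub>X f" using g \<phi>c by (intro dividesI[of \<phi>]) (auto simp: UP.m_comm)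
    have lt: "n - degree \<phi> < n" using monic_irreds_degree(1)[OF \<phi>(1)] False by linarith
    have "\<not> (\<psi> \<otimes>\<^sub>X \<psi>) divides\<^sub>X g" if "d \<ge> 1" "monic R d \<psi>" for d \<psi>
      using less.prems(2)[OF that] divides_trans_RX[of "\<psi> \<otimes>\<^sub>X \<psi>" g f] gf monic_closed[OF that(2)] by auto
    then obtain S where S: "finite S" "S \<subseteq> monic_irreds R" "g = (\<Otimes>\<^bsub>RX\<^esub>\<psi>\<in>S. \<psi>)"
      using less.IH[OF lt mg(2)] by blast
    have Sc: "S \<subseteq> carrier RX" using S(2) monic_irreds_closed by blast
    have "\<phi> \<notin> S"
    proof
      assume "\<phi> \<in> S"
      then have "\<phi> divides\<^sub>X g" using divides_finprod[OF S(1) Sc] S(3) by simp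
      then obtain k where k: "k \<in> carrier RX" "g = \<phi> \<otimes>\<^sub>X k" by (auto simp: factor_def)
      then have "f = (\<phi> \<otimes>\<^sub>X \<phi>) \<otimes>\<^sub>X k" using g \<phi>c by (simp add: UP.m_assoc)
      then show False
        using less.prems(2)[OF monic_irreds_degree[OF \<phi>(1)]] k(1) by (auto simp: factor_def)
    qed
    moreover have "(\<Otimes>\<^bsub>RX\<^esub>\<psi>\<in>insert \<phi> S. \<psi>) = \<phi> \<otimes>\<^sub>X (\<Otimes>\<^bsub>RX\<^esub>\<psi>\<in>S. \<psi>)" if "\<phi> \<notin> S"
      by (rule UP.finprod_insert) (use that S(1) Sc \<phi>c in auto)
    ultimately show ?thesis using S \<phi> g by (intro exI[of _ "insert \<phi> S"]) auto
  qed
qed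

end

section \<open>The Frobenius map\<close>

lemma (in cring) binomial:
  assumes a: "a \<in> carrier R" and b: "b \<in> carrier R"
  shows "(a \<oplus> b) [^] (n::nat) = (\<Oplus>k\<in>{..n}. add_pow R (n choose k) (a [^] k \<otimes> b [^] (n - k)))"
proof (induction n)
  case 0
  then show ?case by (simp add: finsum_singleton)
next
  case (Suc n)
  let ?t = "\<lambda>n k. add_pow R (n choose k) (a [^] k \<otimes> b [^] (n - k))"
  \<comment> \<open>\<open>?u\<close> and \<open>?v\<close> are the two halves of Pascal's rule,
    from multiplication by a and by b. Each gets a vanishing end term, at k = 0 and k =
    \<open>Suc n\<close> respectively, so that both sums run over the same range and add up
    termwise.\<close>
  let ?u = "\<lambda>k. add_pow R (case k of 0 \<Rightarrow> 0 | Suc i \<Rightarrow> n choose i) (a [^] k \<otimes> b [^] (Suc n - k))"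
  let ?v = "\<lambda>k. add_pow R (n choose k) (a [^] k \<otimes> b [^] (Suc n - k))"
  have c: "a [^] i \<otimes> b [^] j \<in> carrier R" for i j :: nat using a b by simp
  have tc: "?t n k \<in> carrier R" "?u k \<in> carrier R" "?v k \<in> carrier R" for k
    using c by (simp_all del: nat_pow_Suc)
  have "(\<Oplus>k\<in>{..n}. ?t n k) \<otimes> a = (\<Oplus>k\<in>{..n}. ?u (Suc k))"
  proof -
    have "(\<Oplus>k\<in>{..n}. ?t n k) \<otimes> a = (\<Oplus>k\<in>{..n}. ?t n k \<otimes> a)"
      by (rule finsum_ldistr) (use a tc in auto)
    also have "\<dots> = (\<Oplus>k\<in>{..n}. ?u (Suc k))"
    proof (rule finsum_cong'[OF refl])
      fix k
      have "a [^] k \<otimes> b [^] (n - k) \<otimes> a = a [^] Suc k \<otimes> b [^] (Suc n - Suc k)"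
        using a b by (simp add: m_ac)
      then show "?t n k \<otimes> a = ?u (Suc k)" using add_pow_ldistr[OF c a, of "n choose k"] by simp
    qed (use tc in blast)
    finally show ?thesis .
  qed
  also have "\<dots> = (\<Oplus>k\<in>{..Suc n}. ?u k)"
  proof -
    have "(\<Oplus>k\<in>{..Suc n}. ?u k) = (\<Oplus>k\<in>{..n}. ?u (Suc k)) \<oplus> ?u 0"
      by (rule finsum_Suc2) (use tc in blast)
    moreover have "?u 0 = \<zero>" by simp
    moreover have "(\<Oplus>k\<in>{..n}. ?u (Suc k)) \<in> carrier R" by (rule finsum_closed) (use tc in blast)
    ultimately show ?thesis by (simp only: r_zero)
  qed
  finally have A: "(\<Oplus>k\<in>{..n}. ?t n k) \<otimes> a = (\<Oplus>k\<in>{..Suc n}. ?u k)" .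
  have "(\<Oplus>k\<in>{..n}. ?t n k) \<otimes> b = (\<Oplus>k\<in>{..n}. ?v k)"
  proof -
    have "(\<Oplus>k\<in>{..n}. ?t n k) \<otimes> b = (\<Oplus>k\<in>{..n}. ?t n k \<otimes> b)"
      by (rule finsum_ldistr) (use b tc in auto)
    also have "\<dots> = (\<Oplus>k\<in>{..n}. ?v k)"
    proof (rule finsum_cong'[OF refl])
      fix k assume "k \<in> {..n}"
      then have "a [^] k \<otimes> b [^] (n - k) \<otimes> b = a [^] k \<otimes> b [^] (Suc n - k)"
        using a b by (simp add: m_assoc Suc_diff_le)
      then show "?t n k \<otimes> b = ?v k" using add_pow_ldistr[OF c b, of "n choose k"] by simp
    qed (use tc in blast)
    finally show ?thesis .
  qed
  also have "\<dots> = (\<Oplus>k\<in>{..Suc n}. ?v k)"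
  proof -
    have "(\<Oplus>k\<in>{..Suc n}. ?v k) = ?v (Suc n) \<oplus> (\<Oplus>k\<in>{..n}. ?v k)"
      by (rule finsum_Suc) (use tc in blast)
    moreover have "?v (Suc n) = \<zero>" by (simp add: binomial_eq_0)
    moreover have "(\<Oplus>k\<in>{..n}. ?v k) \<in> carrier R" by (rule finsum_closed) (use tc in blast)
    ultimately show ?thesis by (simp only: l_zero)
  qed
  finally have B: "(\<Oplus>k\<in>{..n}. ?t n k) \<otimes> b = (\<Oplus>k\<in>{..Suc n}. ?v k)" .
  have tsum: "(\<Oplus>k\<in>{..n}. ?t n k) \<in> carrier R" by (rule finsum_closed) (use tc in auto)
  have "(a \<oplus> b) [^] Suc n = (\<Oplus>k\<in>{..n}. ?t n k) \<otimes> a \<oplus> (\<Oplus>k\<in>{..n}. ?t n k) \<otimes> b"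
    using Suc a b tsum by (simp add: r_distr)
  also have "\<dots> = (\<Oplus>k\<in>{..Suc n}. ?u k \<oplus> ?v k)"
    unfolding A B by (rule finsum_addf[symmetric]) (use tc in auto)
  also have "\<dots> = (\<Oplus>k\<in>{..Suc n}. ?t (Suc n) k)"
  proof (rule finsum_cong'[OF refl])
    fix k assume "k \<in> {..Suc n}"
    have "(case k of 0 \<Rightarrow> 0 | Suc i \<Rightarrow> n choose i) + (n choose k) = Suc n choose k" by (cases k) auto
    then show "?u k \<oplus> ?v k = ?t (Suc n) k"
      using add.nat_pow_mult[OF c, of "case k of 0 \<Rightarrow> 0 | Suc i \<Rightarrow> n choose i" k "Suc n - k" "n choose k"] by simp
  qed (use c in \<open>auto simp del: nat_pow_Suc\<close>)
  finally show ?case .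
qed

lemma (in cring) add_pow_multiple_eq_zero:
  assumes "add_pow R (p::nat) \<one> = \<zero>" "x \<in> carrier R" "p dvd n"
  shows "add_pow R n x = \<zero>"
proof -
  have "add_pow R p x = add_pow R p \<one> \<otimes> x" using assms(2) by (simp add: add_pow_ldistr)
  then have z: "add_pow R p x = \<zero>" using assms by simp
  obtain k where "n = p * k" using assms(3) by blast
  then show ?thesis using add.nat_pow_pow[of x k p] assms(2) z by simp
qed

lemma (in cring) frobenius_add:
  assumes p: "Factorial_Ring.prime (p::nat)" and char: "add_pow R p \<one> = \<zero>"
    and a: "a \<in> carrier R" and b: "b \<in> carrier R"
  shows "(a \<oplus> b) [^] p = a [^] p \<oplus> b [^] p"
proof -
  \<comment> \<open>As p is at least 2, the terms for k = 0 and k = p are distinct and can be split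
    off at the two ends; the inner coefficients are divisible by p.\<close>
  obtain n where n: "p = Suc (Suc n)"
    using prime_ge_2_nat[OF p] by (metis add_2_eq_Suc le_Suc_ex)
  let ?t = "\<lambda>k. add_pow R (p choose k) (a [^] k \<otimes> b [^] (p - k))"
  have c: "a [^] i \<otimes> b [^] j \<in> carrier R" for i j :: nat using a b by simp
  have tc: "?t k \<in> carrier R" for k using c by simp
  have z: "?t k = \<zero>" if "0 < k" "k < p" for k
    using that p c by (intro add_pow_multiple_eq_zero[OF char] dvd_choose_prime) auto
  have "(a \<oplus> b) [^] p = (\<Oplus>k\<in>{..Suc (Suc n)}. ?t k)" using binomial[OF a b, of p] n by simp
  also have "\<dots> = ?t (Suc (Suc n)) \<oplus> ((\<Oplus>k\<in>{..n}. ?t (Suc k)) \<oplus> ?t 0)"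
  proof -
    have "(\<Oplus>k\<in>{..Suc (Suc n)}. ?t k) = ?t (Suc (Suc n)) \<oplus> (\<Oplus>k\<in>{..Suc n}. ?t k)"
      by (rule finsum_Suc) (use tc in blast)
    also have "(\<Oplus>k\<in>{..Suc n}. ?t k) = (\<Oplus>k\<in>{..n}. ?t (Suc k)) \<oplus> ?t 0"
      by (rule finsum_Suc2) (use tc in blast)
    finally show ?thesis .
  qed
  also have "(\<Oplus>k\<in>{..n}. ?t (Suc k)) = (\<Oplus>k\<in>{..n}. \<zero>)"
  proof (rule finsum_cong'[OF refl])
    fix k assume "k \<in> {..n}"
    then show "?t (Suc k) = \<zero>" using n by (intro z) auto
  qed simp
  also have "?t (Suc (Suc n)) = a [^] p" using a n by (simp del: nat_pow_Suc)
  finally show ?thesis using a b n by (simp add: finsum_zero del: nat_pow_Suc)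
qed

lemma (in cring) frobenius_power_add:
  assumes p: "Factorial_Ring.prime (p::nat)" and char: "add_pow R p \<one> = \<zero>"
    and a: "a \<in> carrier R" and b: "b \<in> carrier R"
  shows "(a \<oplus> b) [^] (p ^ e) = a [^] (p ^ e) \<oplus> b [^] (p ^ e)"
proof (induction e)
  case (Suc e)
  have "(a \<oplus> b) [^] (p ^ Suc e) = ((a \<oplus> b) [^] (p ^ e)) [^] p"
    using a b by (simp add: nat_pow_pow mult.commute)
  also have "\<dots> = (a [^] (p ^ e)) [^] p \<oplus> (b [^] (p ^ e)) [^] p"
    unfolding Suc using a b by (intro frobenius_add[OF p char]) auto
  finally show ?case using a b by (simp add: nat_pow_pow mult.commute)
qed (use a b in simp)

lemma (in cring) frobenius_power_finsum:
  assumes p: "Factorial_Ring.prime (p::nat)" and char: "add_pow R p \<one> = \<zero>"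
    and "finite A" "\<And>x. x \<in> A \<Longrightarrow> f x \<in> carrier R"
  shows "(\<Oplus>x\<in>A. f x) [^] (p ^ e) = (\<Oplus>x\<in>A. f x [^] (p ^ e))"
  using assms(3,4)
proof (induction A rule: finite_induct)
  case empty
  have "p ^ e > 0" using prime_gt_0_nat[OF p] by simp
  then show ?case by (simp add: finsum_empty nat_pow_zero)
next
  case (insert x A)
  have "(\<Oplus>y\<in>insert x A. f y) = f x \<oplus> (\<Oplus>y\<in>A. f y)"
    by (rule finsum_insert) (use insert in auto)
  moreover have "(\<Oplus>y\<in>insert x A. f y [^] (p ^ e)) = f x [^] (p ^ e) \<oplus> (\<Oplus>y\<in>A. f y [^] (p ^ e))"
    by (rule finsum_insert) (use insert in auto)
  moreover have "(f x \<oplus> (\<Oplus>y\<in>A. f y)) [^] (p ^ e) = f x [^] (p ^ e) \<oplus> (\<Oplus>y\<in>A. f y) [^] (p ^ e)"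
    by (rule frobenius_power_add[OF p char]) (use insert in \<open>auto intro!: finsum_closed\<close>)
  ultimately show ?case using insert by simp
qed

lemma (in cring) pow_minus_one_divides:
  assumes y: "y \<in> carrier R" and ab: "(a::nat) dvd b"
  shows "(y [^] a \<ominus> \<one>) divides (y [^] b \<ominus> \<one>)"
proof -
  obtain k where b: "b = a * k" using ab by blast
  let ?z = "y [^] a"
  have zc: "?z \<in> carrier R" using y by simp
  have "\<exists>g\<in>carrier R. ?z [^] k \<ominus> \<one> = (?z \<ominus> \<one>) \<otimes> g" for k :: nat
  proof (induction k)
    case 0
    then show ?case using zc by (intro bexI[of _ \<zero>]) (auto simp: minus_eq r_neg)
  next
    case (Suc k)
    then obtain g where g: "g \<in> carrier R" "?z [^] k \<ominus> \<one> = (?z \<ominus> \<one>) \<otimes> g" by blast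
    have "?z [^] Suc k \<ominus> \<one> = (?z [^] k \<ominus> \<one>) \<otimes> ?z \<oplus> (?z \<ominus> \<one>)"
      using zc by (simp add: minus_eq l_distr l_minus a_assoc r_neg1)
    also have "\<dots> = (?z \<ominus> \<one>) \<otimes> (g \<otimes> ?z \<oplus> \<one>)"
      unfolding g(2) using zc g(1) by (simp add: r_distr m_assoc)
    finally show ?case using zc g(1) by (intro bexI[of _ "g \<otimes> ?z \<oplus> \<one>"]) auto
  qed
  then obtain g where "g \<in> carrier R" "?z [^] k \<ominus> \<one> = (?z \<ominus> \<one>) \<otimes> g" by blast
  then show ?thesis using y unfolding b by (intro dividesI[of g]) (auto simp: nat_pow_pow)
qed

text \<open>Euclid on exponents: q^m - 1 = q^(m-d) (q^d - 1) + (q^(m-d) - 1) lowers m by d until m <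
  d, where only m = 0 is possible.\<close>

lemma dvd_if_power_minus_one_dvd:
  fixes q :: nat
  assumes q: "q \<ge> 2" and d: "d \<ge> 1" and dvd: "(q ^ d - 1) dvd (q ^ m - 1)"
  shows "d dvd m"
  using dvd
proof (induction m rule: less_induct)
  case (less m)
  show ?case
  proof (cases "m < d")
    case True
    then have "q ^ m < q ^ d" using q by (intro power_strict_increasing) auto
    moreover have "q ^ m \<ge> 1" using q by simp
    ultimately have "q ^ m - 1 < q ^ d - 1" by linarith
    then have "q ^ m - 1 = 0" using less.prems by (auto dest: dvd_imp_le)
    then have "q ^ m = 1" using \<open>q ^ m \<ge> 1\<close> by linarith
    then show ?thesis using q by simp
  next
    case False
    have ge: "q ^ (m - d) \<ge> 1" "q ^ d \<ge> 1" using q by simp_all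
    have "q ^ m = q ^ (m - d) * q ^ d" using False by (simp flip: power_add)
    then have "q ^ m - 1 = q ^ (m - d) * (q ^ d - 1) + (q ^ (m - d) - 1)"
      using ge by (simp add: diff_mult_distrib2)
    then have "(q ^ d - 1) dvd (q ^ (m - d) - 1)"
      using less.prems dvd_add_right_iff[of "q ^ d - 1" "q ^ (m - d) * (q ^ d - 1)"] by simp
    moreover have "m - d < m" using False d by simp
    ultimately have "d dvd m - d" using less.IH by blast
    then show ?thesis using dvd_add[OF _ dvd_refl[of d], of "m - d"] False by simp
  qed
qed

section \<open>Irreducible polynomials over a finite field\<close>

text \<open>
  For an irreducible \<open>\<phi> \<noteq> X\<close> this says that the multiplicative order of its roots is prime to \<open>L\<close>.
\<close>

definition coprime_order :: "('a, 'm) ring_scheme \<Rightarrow> nat \<Rightarrow> 'a list \<Rightarrow> bool" where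
  "coprime_order R L \<phi> \<longleftrightarrow> (\<exists>n>0. coprime n L \<and>
     \<phi> divides\<^bsub>poly_ring R\<^esub> (X\<^bsub>R\<^esub> [^]\<^bsub>poly_ring R\<^esub> (n::nat) \<ominus>\<^bsub>poly_ring R\<^esub> \<one>\<^bsub>poly_ring R\<^esub>))"

lemma (in ring_hom_cring) hom_nat_pow:
  "x \<in> carrier R \<Longrightarrow> h (x [^] (n::nat)) = h x [^]\<^bsub>S\<^esub> n"
  by (induction n) simp_all

context field
begin

interpretation UP: principal_domain RX
  by (rule univ_poly_is_principal[OF carrier_is_subfield])

text \<open>Turns congruences modulo f into equations in the quotient ring, where homomorphisms and
  the unit group are available.\<close>

lemma rupture_surj_eq_iff:
  assumes f: "f \<in> carrier RX" and a: "a \<in> carrier RX" and b: "b \<in> carrier RX"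
  shows "rupture_surj (carrier R) f a = rupture_surj (carrier R) f b \<longleftrightarrow> f divides\<^sub>X (a \<ominus>\<^sub>X b)"
proof -
  have "f divides\<^sub>X (a \<ominus>\<^sub>X b) \<longleftrightarrow> a \<ominus>\<^sub>X b \<in> PIdl\<^bsub>RX\<^esub> f"
    using f by (auto simp: cgenideal_def factor_def UP.m_comm)
  then show ?thesis
    using UP.quotient_eq_iff_same_a_r_cos[OF UP.cgenideal_ideal[OF f] a b] by simp
qed

lemma rupture_surj_hom_cring:
  assumes f: "f \<in> carrier RX"
  shows "ring_hom_cring RX (Rupt (carrier R) f) (rupture_surj (carrier R) f)"
proof -
  have "cring (Rupt (carrier R) f)"
    unfolding rupture_def by (rule ideal.quotient_is_cring[OF UP.cgenideal_ideal[OF f] UP.is_cring])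
  then show ?thesis
    using rupture_surj_hom(1)[OF carrier_is_subring f]
    by (intro ring_hom_cring.intro ring_hom_cring_axioms.intro UP.is_cring) auto
qed

lemma rupture_field:
  assumes "\<phi> \<in> monic_irreds R"
  shows "field (Rupt (carrier R) \<phi>)"
  using assms rupture_is_field_iff_pirreducible[OF carrier_is_subfield, of \<phi>] by (simp add: monic_irreds_def)

lemma rupture_carrier:
  assumes "f \<in> carrier RX" "f \<noteq> []"
  shows "carrier (Rupt (carrier R) f) = rupture_surj (carrier R) f ` {q \<in> carrier RX. length q \<le> degree f}"
  using rupture_carrier_as_pmod_image[OF carrier_is_subfield assms(1)]
    pmod_image_characterization[OF carrier_is_subfield assms] by simp

lemma card_rupture:
  assumes "finite (carrier R)" "f \<in> carrier RX" "f \<noteq> []"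
  shows "card (carrier (Rupt (carrier R) f)) = card (carrier R) ^ degree f"
proof -
  have "inj_on (rupture_surj (carrier R) f) {q \<in> carrier RX. length q \<le> degree f}"
    using rupture_surj_inj_on[OF carrier_is_subfield assms(2)]
      pmod_image_characterization[OF carrier_is_subfield assms(2,3)] by simp
  then show ?thesis
    unfolding rupture_carrier[OF assms(2,3)] by (simp add: card_image card_length_le[OF assms(1)])
qed

lemma X_in_monic_irreds: "X \<in> monic_irreds R"
proof -
  have "degree X = 1" by (simp add: var_def)
  then show ?thesis
    using degree_one_imp_pirreducible[OF carrier_is_subfield X_closed] X_closed
    by (simp add: monic_irreds_def var_def)
qed

lemma poly_eq_X_sum:
  assumes g: "g \<in> carrier RX"
  shows "g = (\<Oplus>\<^bsub>RX\<^esub>i\<in>{..<length g}. X_pow i \<otimes>\<^sub>X poly_of_const (coeff g i))"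
proof (rule poly_eqI[OF g])
  show "(\<Oplus>\<^bsub>RX\<^esub>i\<in>{..<length g}. X_pow i \<otimes>\<^sub>X poly_of_const (coeff g i)) \<in> carrier RX"
    using coeff_closed[OF g] by (rule X_sum_closed)
  show "coeff g i = coeff (\<Oplus>\<^bsub>RX\<^esub>i\<in>{..<length g}. X_pow i \<otimes>\<^sub>X poly_of_const (coeff g i)) i" for i
    using coeff_X_sum[of "length g" "coeff g" i] coeff_closed[OF g] coeff_eq_zero[of g i] by simp
qed

lemma finite_field_pow_card:
  assumes fin: "finite (carrier R)" and a: "a \<in> carrier R"
  shows "a [^] card (carrier R) = a"
proof (cases "a = \<zero>")
  case True
  then show ?thesis using fin a by (metis card_0_eq empty_iff nat_pow_zero)
next
  case False
  interpret M: group "Multiplicative_Group.mult_of R" by (rule field_mult_group)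
  have "a [^] (card (carrier R) - 1) = \<one>"
    using M.pow_order_eq_1[of a] a False fin order_mult_of[OF fin] by (simp add: Multiplicative_Group.nat_pow_mult_of order_def)
  moreover have "card (carrier R) = Suc (card (carrier R) - 1)" 
    using fin a card_gt_0_iff[of "carrier R"] by auto
  ultimately show ?thesis using a by (metis l_one nat_pow_Suc)
qed

end

locale galois_field = field R for R (structure) +
  fixes p e :: nat
  assumes prime_p: "Factorial_Ring.prime p" and card_carrier: "card (carrier R) = p ^ e"
begin

interpretation UP: principal_domain RX
  by (rule univ_poly_is_principal[OF carrier_is_subfield])

interpretation const: ring_hom_cring R RX poly_of_const
  by (rule poly_of_const_hom)

abbreviation q where "q \<equiv> card (carrier R)"

lemma finite_carrier: "finite (carrier R)"
  using card_carrier prime_gt_0_nat[OF prime_p] by (intro card_ge_0_finite) simp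

lemma q_ge_2: "q \<ge> 2"
proof -
  have "card {\<zero>, \<one>} \<le> q" by (rule card_mono[OF finite_carrier]) auto
  then show ?thesis using zero_not_one by simp
qed

text \<open>The additive group has order q = p^e, so (p 1)^e = p^e 1 = 0, and a field has no nonzero
  nilpotent elements.\<close>

lemma characteristic: "add_pow R p \<one> = \<zero>"
proof -
  have mult: "add_pow R m \<one> \<otimes> add_pow R n \<one> = add_pow R (n * m) \<one>" for m n :: nat
    using add_pow_ldistr[of \<one> "add_pow R n \<one>" m] add.nat_pow_pow[of \<one> m n] by simp
  have pow: "add_pow R (p ^ k) \<one> = (add_pow R p \<one>) [^] k" for k :: nat
    by (induction k) (simp_all add: mult[symmetric])
  have "add_pow R q \<one> = \<zero>" using add.pow_order_eq_1[of \<one>] by (simp add: order_def)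
  then have "(add_pow R p \<one>) [^] e = \<zero>" using pow card_carrier by simp
  moreover have "x [^] e \<noteq> \<zero>" if "x \<in> carrier R" "x \<noteq> \<zero>" for x
    using that by (induction e) (auto simp: integral_iff)
  ultimately show ?thesis by (metis add.nat_pow_closed one_closed)
qed

lemma characteristic_RX: "add_pow RX p \<one>\<^sub>X = \<zero>\<^sub>X"
proof -
  have "poly_of_const (add_pow R n \<one>) = add_pow RX n \<one>\<^sub>X" for n :: nat
    by (induction n) simp_all
  then show ?thesis using characteristic const.hom_zero by metis
qed

lemma pow_q_pow:
  assumes "a \<in> carrier R"
  shows "a [^] (q ^ m) = a"
proof (induction m)
  case (Suc m)
  have "a [^] (q ^ Suc m) = (a [^] (q ^ m)) [^] q" using assms by (simp add: nat_pow_pow mult.commute)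
  then show ?case using Suc finite_field_pow_card[OF finite_carrier assms] by simp
qed (use assms in simp)

text \<open>
  Modulo \<open>f\<close>, the \<open>q\<^sup>m\<close>-th power map is a ring endomorphism that fixes constants, so it is the
  identity as soon as it fixes \<open>X\<close>.
\<close>

lemma divides_frobenius_minus:
  assumes f: "f \<in> carrier RX" and d: "f divides\<^sub>X (X_pow (q ^ m) \<ominus>\<^sub>X X)" and g: "g \<in> carrier RX"
  shows "f divides\<^sub>X (g [^]\<^bsub>RX\<^esub> (q ^ m) \<ominus>\<^sub>X g)"
proof -
  let ?\<pi> = "rupture_surj (carrier R) f" and ?K = "Rupt (carrier R) f"
  interpret \<pi>: ring_hom_cring RX ?K ?\<pi> by (rule rupture_surj_hom_cring[OF f])
  have Q: "q ^ m = p ^ (e * m)" by (simp add: card_carrier power_mult)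
  have cc: "poly_of_const (coeff g i) \<in> carrier RX" for i using coeff_closed[OF g] by simp
  have \<pi>X: "?\<pi> X [^]\<^bsub>?K\<^esub> (q ^ m) = ?\<pi> X"
    using rupture_surj_eq_iff[OF f _ X_closed, of "X_pow (q ^ m)"] d X_closed \<pi>.hom_nat_pow by simp
  let ?s = "\<lambda>i. X_pow i \<otimes>\<^sub>X poly_of_const (coeff g i)"
  have sc: "?s i \<in> carrier RX" for i using cc X_closed by simp
  have s: "?\<pi> (?s i [^]\<^bsub>RX\<^esub> (q ^ m)) = ?\<pi> (?s i)" for i
  proof -
    have "?s i [^]\<^bsub>RX\<^esub> (q ^ m) = (X_pow (q ^ m)) [^]\<^bsub>RX\<^esub> i \<otimes>\<^sub>X poly_of_const (coeff g i)"
      using cc X_closed pow_q_pow[OF coeff_closed[OF g]] const.hom_nat_pow[OF coeff_closed[OF g], of i "q ^ m"]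
      by (simp add: UP.nat_pow_distrib UP.nat_pow_pow mult.commute)
    then have "?\<pi> (?s i [^]\<^bsub>RX\<^esub> (q ^ m)) = (?\<pi> X [^]\<^bsub>?K\<^esub> (q ^ m)) [^]\<^bsub>?K\<^esub> i \<otimes>\<^bsub>?K\<^esub> ?\<pi> (poly_of_const (coeff g i))"
      using cc X_closed by (simp add: \<pi>.hom_nat_pow)
    then show ?thesis unfolding \<pi>X using cc X_closed by (simp add: \<pi>.hom_nat_pow)
  qed
  have "?\<pi> (g [^]\<^bsub>RX\<^esub> (q ^ m)) = ?\<pi> ((\<Oplus>\<^bsub>RX\<^esub>i\<in>{..<length g}. ?s i) [^]\<^bsub>RX\<^esub> (q ^ m))"
    using poly_eq_X_sum[OF g] by simp
  also have "(\<Oplus>\<^bsub>RX\<^esub>i\<in>{..<length g}. ?s i) [^]\<^bsub>RX\<^esub> (q ^ m) = (\<Oplus>\<^bsub>RX\<^esub>i\<in>{..<length g}. ?s i [^]\<^bsub>RX\<^esub> (q ^ m))"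
    unfolding Q by (rule UP.frobenius_power_finsum[OF prime_p characteristic_RX]) (use sc in auto)
  also have "?\<pi> \<dots> = (\<Oplus>\<^bsub>?K\<^esub>i\<in>{..<length g}. ?\<pi> (?s i [^]\<^bsub>RX\<^esub> (q ^ m)))"
    using sc by (simp add: \<pi>.hom_finsum Pi_iff o_def)
  also have "\<dots> = (\<Oplus>\<^bsub>?K\<^esub>i\<in>{..<length g}. ?\<pi> (?s i))" unfolding s ..
  also have "\<dots> = ?\<pi> (\<Oplus>\<^bsub>RX\<^esub>i\<in>{..<length g}. ?s i)"
    using sc by (simp add: \<pi>.hom_finsum Pi_iff o_def)
  also have "\<dots> = ?\<pi> g" using poly_eq_X_sum[OF g] by simp
  finally show ?thesis using rupture_surj_eq_iff[OF f UP.nat_pow_closed[OF g] g] by blast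
qed


text \<open>The residue field modulo \<phi> has q^(deg \<phi>) elements and a cyclic unit group. A
  generator is fixed by the q^m-th power map, hence its order q^(deg \<phi>) - 1 divides q^m -
  1.\<close>

lemma degree_dvd_if_divides_frobenius_minus:
  assumes \<phi>: "\<phi> \<in> monic_irreds R" and d: "\<phi> divides\<^sub>X (X_pow (q ^ m) \<ominus>\<^sub>X X)"
  shows "degree \<phi> dvd m"
proof -
  note \<phi>c = monic_irreds_closed[OF \<phi>]
  let ?\<pi> = "rupture_surj (carrier R) \<phi>" and ?K = "Rupt (carrier R) \<phi>"
  interpret K: field ?K by (rule rupture_field[OF \<phi>])
  interpret \<pi>: ring_hom_cring RX ?K ?\<pi> by (rule rupture_surj_hom_cring[OF \<phi>c])
  have ne: "\<phi> \<noteq> []" using monic_irreds_degree[OF \<phi>] by auto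
  have cardK: "card (carrier ?K) = q ^ degree \<phi>" by (rule card_rupture[OF finite_carrier \<phi>c ne])
  have finK: "finite (carrier ?K)" using cardK q_ge_2 by (intro card_ge_0_finite) simp
  interpret M: group "Multiplicative_Group.mult_of ?K" by (rule K.field_mult_group)
  have finM: "finite (carrier (Multiplicative_Group.mult_of ?K))" using finK by simp
  obtain a where a: "a \<in> carrier (Multiplicative_Group.mult_of ?K)"
    and gen: "carrier (Multiplicative_Group.mult_of ?K) = {a [^]\<^bsub>?K\<^esub> i | i::nat. i \<in> UNIV}"
    using K.finite_field_mult_group_has_gen[OF finK] by blast
  have "M.ord a = card (generate (Multiplicative_Group.mult_of ?K) {a})" by (rule M.generate_pow_card[OF a])
  also have "generate (Multiplicative_Group.mult_of ?K) {a} = carrier (Multiplicative_Group.mult_of ?K)"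
    unfolding M.generate_pow_on_finite_carrier[OF finM a] gen by (simp add: Multiplicative_Group.nat_pow_mult_of)
  also have "card \<dots> = q ^ degree \<phi> - 1" using finK cardK by simp
  finally have ord: "M.ord a = q ^ degree \<phi> - 1" .
  have ac: "a \<in> carrier ?K" "a \<noteq> \<zero>\<^bsub>?K\<^esub>" using a by auto
  have "a \<in> ?\<pi> ` {r \<in> carrier RX. length r \<le> degree \<phi>}"
    using ac(1) rupture_carrier[OF \<phi>c ne] by (simp only:)
  then obtain g where g: "g \<in> carrier RX" "a = ?\<pi> g" by blast
  have "?\<pi> (g [^]\<^bsub>RX\<^esub> (q ^ m)) = ?\<pi> g"
    using rupture_surj_eq_iff[OF \<phi>c UP.nat_pow_closed[OF g(1)] g(1)] divides_frobenius_minus[OF \<phi>c d g(1)] by blast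
  then have "a [^]\<^bsub>?K\<^esub> (q ^ m) = a" unfolding g(2) \<pi>.hom_nat_pow[OF g(1)] .
  moreover have "q ^ m = Suc (q ^ m - 1)" using q_ge_2 by simp
  ultimately have "a [^]\<^bsub>?K\<^esub> Suc (q ^ m - 1) = a" by metis
  then have "a [^]\<^bsub>?K\<^esub> (q ^ m - 1) \<otimes>\<^bsub>?K\<^esub> a = \<one>\<^bsub>?K\<^esub> \<otimes>\<^bsub>?K\<^esub> a"
    using ac by (simp only: K.nat_pow_Suc K.l_one)
  then have "a [^]\<^bsub>?K\<^esub> (q ^ m - 1) = \<one>\<^bsub>?K\<^esub>"
    using K.m_rcancel[OF ac(2) ac(1) K.nat_pow_closed[OF ac(1)] K.one_closed] by blast
  then have "M.ord a dvd q ^ m - 1"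
    using M.pow_eq_id[OF a, of "q ^ m - 1"] by (simp only: Multiplicative_Group.nat_pow_mult_of Multiplicative_Group.one_mult_of simp_thms)
  then show ?thesis
    unfolding ord by (rule dvd_if_power_minus_one_dvd[OF q_ge_2 monic_irreds_degree(1)[OF \<phi>]])
qed

section \<open>Factorization of X^n - 1 and orders of roots\<close>

lemma monic_X_pow_minus_one:
  assumes "n \<ge> 1"
  shows "monic R n (X_pow n \<ominus>\<^sub>X \<one>\<^sub>X)"
proof -
  have "length (\<ominus>\<^bsub>RX\<^esub> \<one>\<^sub>X) = length \<one>\<^sub>X"
    by (rule univ_poly_a_inv_length[OF carrier_is_subring UP.one_closed])
  also have "\<dots> = 1" by (simp add: univ_poly_one)
  finally show ?thesis
    unfolding a_minus_def by (intro monic_add[OF monic_X_pow] UP.a_inv_closed UP.one_closed) (use assms in linarith)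
qed

lemma X_pow_minus_one_divides_frobenius_minus:
  assumes "n dvd q ^ m - 1"
  shows "(X_pow n \<ominus>\<^sub>X \<one>\<^sub>X) divides\<^sub>X (X_pow (q ^ m) \<ominus>\<^sub>X X)"
proof -
  have "q ^ m = Suc (q ^ m - 1)" using q_ge_2 by simp
  then have "X_pow (q ^ m) = X_pow (Suc (q ^ m - 1))" by (rule arg_cong)
  then have "X_pow (q ^ m) = X_pow (q ^ m - 1) \<otimes>\<^sub>X X" by (simp only: UP.nat_pow_Suc)
  then have "X_pow (q ^ m) \<ominus>\<^sub>X X = (X_pow (q ^ m - 1) \<ominus>\<^sub>X \<one>\<^sub>X) \<otimes>\<^sub>X X"
    using X_closed by (simp add: UP.minus_eq UP.l_distr UP.l_minus)
  then have "(X_pow (q ^ m - 1) \<ominus>\<^sub>X \<one>\<^sub>X) divides\<^sub>X (X_pow (q ^ m) \<ominus>\<^sub>X X)"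
    using X_closed by (auto simp: factor_def)
  then show ?thesis
    using X_closed by (intro divides_trans_RX[OF _ UP.pow_minus_one_divides[OF X_closed assms]]) simp_all
qed

text \<open>X^n - 1 is squarefree: a square \<psi>^2 dividing it would divide X^(q^m) - X, hence
  \<psi>^(q^m) - \<psi>, and, as q^m \<ge> 2, also \<psi> itself. So X^n - 1 is the product of its
  distinct monic irreducible divisors, and the degrees are compared.\<close>

lemma sum_degree_divisors_X_pow_minus_one:
  assumes n: "n dvd q ^ m - 1" "n \<ge> 1" and m: "m \<ge> 1"
  shows "(\<Sum>\<phi> | \<phi> \<in> monic_irreds R \<and> \<phi> divides\<^sub>X (X_pow n \<ominus>\<^sub>X \<one>\<^sub>X). degree \<phi>) = n"
proof -
  let ?f = "X_pow n \<ominus>\<^sub>X \<one>\<^sub>X"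
  have mf: "monic R n ?f" by (rule monic_X_pow_minus_one[OF n(2)])
  have "\<not> (\<psi> \<otimes>\<^sub>X \<psi>) divides\<^sub>X ?f" if d: "d \<ge> 1" and \<psi>: "monic R d \<psi>" for d \<psi>
  proof
    note \<psi>c = monic_closed[OF \<psi>]
    let ?s = "\<psi> \<otimes>\<^sub>X \<psi>"
    have sc: "?s \<in> carrier RX" using \<psi>c by simp
    assume "?s divides\<^sub>X ?f"
    then have "?s divides\<^sub>X (X_pow (q ^ m) \<ominus>\<^sub>X X)"
      using divides_trans_RX[OF sc] X_pow_minus_one_divides_frobenius_minus[OF n(1)] by blast
    from divides_frobenius_minus[OF sc this \<psi>c]
    obtain h where h: "h \<in> carrier RX" "\<psi> [^]\<^bsub>RX\<^esub> (q ^ m) \<ominus>\<^sub>X \<psi> = ?s \<otimes>\<^sub>X h"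
      by (auto simp: factor_def)
    have "q ^ 1 \<le> q ^ m" using q_ge_2 m by (intro power_increasing) auto
    then have "2 \<le> q ^ m" using q_ge_2 by simp
    then obtain k where k: "q ^ m = Suc (Suc k)" by (auto simp: le_iff_add)
    let ?r = "\<psi> [^]\<^bsub>RX\<^esub> k"
    have pw: "\<psi> [^]\<^bsub>RX\<^esub> (q ^ m) = ?s \<otimes>\<^sub>X ?r" unfolding k using \<psi>c by (simp add: UP.m_ac)
    have "\<psi> = \<psi> [^]\<^bsub>RX\<^esub> (q ^ m) \<ominus>\<^sub>X (\<psi> [^]\<^bsub>RX\<^esub> (q ^ m) \<ominus>\<^sub>X \<psi>)"
      using \<psi>c by (simp add: UP.minus_eq UP.minus_add UP.r_neg2)
    also have "\<dots> = ?s \<otimes>\<^sub>X ?r \<ominus>\<^sub>X ?s \<otimes>\<^sub>X h" unfolding h(2) unfolding pw ..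
    also have "\<dots> = ?s \<otimes>\<^sub>X (?r \<ominus>\<^sub>X h)"
      using sc \<psi>c h(1) by (simp add: UP.minus_eq UP.r_distr UP.r_minus)
    finally have "?s divides\<^sub>X \<psi>"
      by (rule dividesI[rotated]) (use \<psi>c h(1) in simp)
    moreover have "length \<psi> \<le> d + d" using \<psi> d by (simp add: monic_def)
    ultimately have "\<psi> = \<zero>\<^sub>X" using monic_divides_small[OF monic_mult[OF \<psi> \<psi>] \<psi>c] by blast
    then show False using monic_nonzero[OF \<psi>] by (simp add: univ_poly_zero)
  qed
  then obtain S where S: "finite S" "S \<subseteq> monic_irreds R" "?f = (\<Otimes>\<^bsub>RX\<^esub>\<psi>\<in>S. \<psi>)"
    using squarefree_monic_eq_finprod[OF mf] by blast
  have Sc: "S \<subseteq> carrier RX" using S(2) monic_irreds_closed by blast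
  have S_eq: "S = {\<phi>. \<phi> \<in> monic_irreds R \<and> \<phi> divides\<^sub>X ?f}"
  proof (intro equalityI subsetI CollectI conjI)
    fix \<phi> assume "\<phi> \<in> S"
    then show "\<phi> \<in> monic_irreds R" "\<phi> divides\<^sub>X ?f"
      unfolding S(3) using S(2) divides_finprod[OF S(1) Sc] by blast+
  next
    fix \<phi> assume "\<phi> \<in> {\<phi>. \<phi> \<in> monic_irreds R \<and> \<phi> divides\<^sub>X ?f}"
    then show "\<phi> \<in> S" unfolding S(3) by (intro monic_irreds_divides_finprod[OF _ S(1,2)]) auto
  qed
  have "monic R (\<Sum>\<psi>\<in>S. degree \<psi>) ?f"
    unfolding S(3) by (rule monic_finprod[OF S(1)]) (use S(2) monic_irreds_degree(2) in blast)
  then have "Suc n = Suc (\<Sum>\<psi>\<in>S. degree \<psi>)" using mf by (simp only: monic_def)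
  then show ?thesis unfolding S_eq by simp
qed

lemma X_not_divides_X_pow_minus_one:
  assumes "n > 0"
  shows "\<not> X divides\<^sub>X (X_pow n \<ominus>\<^sub>X \<one>\<^sub>X)"
proof
  assume "X divides\<^sub>X (X_pow n \<ominus>\<^sub>X \<one>\<^sub>X)"
  then obtain h where h: "h \<in> carrier RX" "X_pow n \<ominus>\<^sub>X \<one>\<^sub>X = X \<otimes>\<^sub>X h" by (auto simp: factor_def)
  obtain k where k: "n = Suc k" using assms by (cases n) auto
  have "\<one>\<^sub>X = X_pow n \<ominus>\<^sub>X (X_pow n \<ominus>\<^sub>X \<one>\<^sub>X)"
    using X_closed by (simp add: UP.minus_eq UP.minus_add UP.r_neg2)
  also have "\<dots> = X \<otimes>\<^sub>X X_pow k \<ominus>\<^sub>X X \<otimes>\<^sub>X h"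
    unfolding h(2) unfolding k using X_closed by (simp add: UP.m_comm)
  also have "\<dots> = X \<otimes>\<^sub>X (X_pow k \<ominus>\<^sub>X h)"
    using X_closed h(1) by (simp add: UP.minus_eq UP.r_distr UP.r_minus)
  finally have "X divides\<^sub>X \<one>\<^sub>X" by (rule dividesI[rotated]) (use X_closed h(1) in simp)
  then show False using monic_irreds_not_divides_one[OF X_in_monic_irreds] by blast
qed

text \<open>The order of X modulo \<phi> divides q^(deg \<phi>) - 1 and hence q^m - 1 = L^v n. If it
  also divides some k prime to L, it is prime to L and divides n.\<close>

lemma coprime_order_divisors_eq:
  assumes m: "q ^ m - 1 = L ^ v * n" "coprime n L" "n \<ge> 1" and L: "Factorial_Ring.prime L"
  shows "{\<phi>. \<phi> \<in> monic_irreds R \<and> \<phi> divides\<^sub>X (X_pow n \<ominus>\<^sub>X \<one>\<^sub>X)}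
    = {\<phi>. \<phi> \<in> monic_irreds R \<and> coprime_order R L \<phi> \<and> degree \<phi> dvd m}"
proof (intro Collect_cong conj_cong refl iffI conjI)
  fix \<phi> assume \<phi>: "\<phi> \<in> monic_irreds R" and d: "\<phi> divides\<^sub>X (X_pow n \<ominus>\<^sub>X \<one>\<^sub>X)"
  show "coprime_order R L \<phi>" using d m unfolding coprime_order_def by (intro exI[of _ n]) auto
  have "n dvd q ^ m - 1" using m(1) by simp
  then show "degree \<phi> dvd m"
    using degree_dvd_if_divides_frobenius_minus[OF \<phi>] X_pow_minus_one_divides_frobenius_minus[of n m]
      divides_trans_RX[OF monic_irreds_closed[OF \<phi>] d] by blast
next
  fix \<phi> assume \<phi>: "\<phi> \<in> monic_irreds R" and "coprime_order R L \<phi> \<and> degree \<phi> dvd m"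
  then obtain k :: nat where k: "k > 0" "coprime k L" "\<phi> divides\<^sub>X (X_pow k \<ominus>\<^sub>X \<one>\<^sub>X)"
    and dm: "degree \<phi> dvd m" by (auto simp: coprime_order_def)
  note \<phi>c = monic_irreds_closed[OF \<phi>]
  let ?\<pi> = "rupture_surj (carrier R) \<phi>" and ?K = "Rupt (carrier R) \<phi>"
  interpret K: field ?K by (rule rupture_field[OF \<phi>])
  interpret \<pi>: ring_hom_cring RX ?K ?\<pi> by (rule rupture_surj_hom_cring[OF \<phi>c])
  have ne: "\<phi> \<noteq> []" using monic_irreds_degree[OF \<phi>] by auto
  have cardK: "card (carrier ?K) = q ^ degree \<phi>" by (rule card_rupture[OF finite_carrier \<phi>c ne])
  have finK: "finite (carrier ?K)" using cardK q_ge_2 by (intro card_ge_0_finite) simp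
  interpret M: group "Multiplicative_Group.mult_of ?K" by (rule K.field_mult_group)
  have pw: "?\<pi> X [^]\<^bsub>?K\<^esub> j = \<one>\<^bsub>?K\<^esub> \<longleftrightarrow> \<phi> divides\<^sub>X (X_pow j \<ominus>\<^sub>X \<one>\<^sub>X)" for j :: nat
    using rupture_surj_eq_iff[OF \<phi>c UP.nat_pow_closed[OF X_closed] UP.one_closed, of j]
    by (simp add: \<pi>.hom_nat_pow X_closed)
  have "?\<pi> X \<noteq> \<zero>\<^bsub>?K\<^esub>"
  proof
    assume "?\<pi> X = \<zero>\<^bsub>?K\<^esub>"
    then have "?\<pi> X [^]\<^bsub>?K\<^esub> k = \<zero>\<^bsub>?K\<^esub>" using k(1) K.nat_pow_zero by simp
    then show False using pw[of k] k(3) by simp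
  qed
  then have x: "?\<pi> X \<in> carrier (Multiplicative_Group.mult_of ?K)" using X_closed by simp
  have ordn: "M.ord (?\<pi> X) dvd j \<longleftrightarrow> \<phi> divides\<^sub>X (X_pow j \<ominus>\<^sub>X \<one>\<^sub>X)" for j :: nat
    using M.pow_eq_id[OF x, of j] pw[of j] by (simp add: Multiplicative_Group.nat_pow_mult_of)
  have "M.ord (?\<pi> X) dvd q ^ degree \<phi> - 1"
    using M.ord_dvd_group_order[OF x] K.order_mult_of[OF finK] cardK by (simp add: order_def)
  also have "q ^ degree \<phi> - 1 dvd q ^ m - 1"
  proof -
    obtain j where j: "m = degree \<phi> * j" using dm by blast
    show ?thesis
      using power_minus_one_eq[of "q ^ degree \<phi>" j] q_ge_2 unfolding j power_mult by simp
  qed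
  finally have "M.ord (?\<pi> X) dvd n * L ^ v" unfolding m(1) by (simp add: mult.commute)
  moreover have "coprime (M.ord (?\<pi> X)) (L ^ v)"
    using ordn[of k] k coprime_divisors[of "M.ord (?\<pi> X)" k L L] by simp
  ultimately have "M.ord (?\<pi> X) dvd n" using coprime_dvd_mult_left_iff by blast
  then show "\<phi> divides\<^sub>X (X_pow n \<ominus>\<^sub>X \<one>\<^sub>X)" using ordn by blast
qed

end

section \<open>Squarefree characteristic polynomials\<close>

context galois_field
begin

interpretation UP: principal_domain RX
  by (rule univ_poly_is_principal[OF carrier_is_subfield])

lemma finite_monic_irreds_degree: "finite {\<phi> \<in> monic_irreds R. degree \<phi> = d}"
  by (rule finite_subset[OF _ finite_monic[OF finite_carrier, of d]]) (use monic_irreds_degree(2) in auto)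

lemma sum_degree_coprime_order:
  assumes L: "Factorial_Ring.prime L" and m: "m \<ge> 1"
  shows "real (\<Sum>d | d dvd m. d * card {\<phi> \<in> {\<phi> \<in> monic_irreds R. coprime_order R L \<phi>}. degree \<phi> = d})
    = (real q ^ m - 1) / real (L ^ multiplicity L (q ^ m - 1))"
proof -
  let ?P = "{\<phi> \<in> monic_irreds R. coprime_order R L \<phi>}"
  let ?v = "multiplicity L (q ^ m - 1)"
  have "q ^ 1 \<le> q ^ m" using q_ge_2 m by (intro power_increasing) auto
  then have gt: "q ^ m > 1" using q_ge_2 by simp
  then have ne: "q ^ m - 1 \<noteq> 0" by simp
  obtain n where n: "q ^ m - 1 = L ^ ?v * n" "\<not> L dvd n"
    using multiplicity_decompose'[OF ne, of L] L by (metis not_prime_unit)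
  have cop: "coprime n L" using prime_imp_coprime[OF L n(2)] by (subst coprime_commute)
  have n1: "n \<ge> 1" using n ne by (cases n) auto
  have fin: "finite {d. d dvd m}" using m by simp
  have "(\<Sum>d | d dvd m. d * card {\<phi> \<in> ?P. degree \<phi> = d}) = (\<Sum>d | d dvd m. \<Sum>\<phi>\<in>{\<phi> \<in> ?P. degree \<phi> = d}. degree \<phi>)"
  proof (rule sum.cong[OF refl])
    fix d
    have "(\<Sum>\<phi>\<in>{\<phi> \<in> ?P. degree \<phi> = d}. degree \<phi>) = (\<Sum>\<phi>\<in>{\<phi> \<in> ?P. degree \<phi> = d}. d)"
      by (rule sum.cong) auto
    then show "d * card {\<phi> \<in> ?P. degree \<phi> = d} = (\<Sum>\<phi>\<in>{\<phi> \<in> ?P. degree \<phi> = d}. degree \<phi>)" by simp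
  qed
  also have "\<dots> = (\<Sum>\<phi>\<in>(\<Union>d\<in>{d. d dvd m}. {\<phi> \<in> ?P. degree \<phi> = d}). degree \<phi>)"
  proof (rule sum.UNION_disjoint[symmetric, OF fin])
    show "\<forall>d\<in>{d. d dvd m}. finite {\<phi> \<in> ?P. degree \<phi> = d}"
      by (intro ballI finite_subset[OF _ finite_monic_irreds_degree]) auto
  qed auto
  also have "(\<Union>d\<in>{d. d dvd m}. {\<phi> \<in> ?P. degree \<phi> = d})
      = {\<phi>. \<phi> \<in> monic_irreds R \<and> coprime_order R L \<phi> \<and> degree \<phi> dvd m}" by auto
  also have "\<dots> = {\<phi>. \<phi> \<in> monic_irreds R \<and> \<phi> divides\<^sub>X (X_pow n \<ominus>\<^sub>X \<one>\<^sub>X)}"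
    by (rule coprime_order_divisors_eq[OF n(1) cop n1 L, symmetric])
  also have "(\<Sum>\<phi>\<in>\<dots>. degree \<phi>) = n"
    by (rule sum_degree_divisors_X_pow_minus_one[OF _ n1 m]) (metis n(1) dvd_triv_right)
  finally have "(\<Sum>d | d dvd m. d * card {\<phi> \<in> ?P. degree \<phi> = d}) = n" .
  moreover have "real q ^ m - 1 = real (L ^ ?v) * real n"
  proof -
    have "real q ^ m - 1 = real (q ^ m - 1)" using gt by (simp add: of_nat_diff)
    then show ?thesis by (subst (asm) n(1)) simp
  qed
  moreover have "real (L ^ ?v) \<noteq> 0" using prime_gt_0_nat[OF L] by simp
  ultimately show ?thesis by simp
qed

text \<open>The sets correspond to the squarefree monic polynomials of degree l prime to X, which
  are the intended characteristic polynomials. The cap on the weights is the total degree l, the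
  largest degree that a member can have.\<close>

abbreviation char_sets :: "nat \<Rightarrow> 'a list set set" where
  "char_sets l \<equiv> wsets (monic_irreds R - {X}) degree l l"

abbreviation coprime_char_sets :: "nat \<Rightarrow> nat \<Rightarrow> 'a list set set" where
  "coprime_char_sets L l \<equiv> wsets {\<phi> \<in> monic_irreds R. coprime_order R L \<phi>} degree l l"

abbreviation poly_of_set :: "'a list set \<Rightarrow> 'a list" where
  "poly_of_set S \<equiv> (\<Otimes>\<^bsub>RX\<^esub>\<psi>\<in>S. \<psi>)"

lemma char_setsD:
  assumes "S \<in> char_sets l"
  shows "finite S" "S \<subseteq> monic_irreds R" "X \<notin> S" "monic R l (poly_of_set S)"
proof -
  show S: "finite S" "S \<subseteq> monic_irreds R" "X \<notin> S" using assms by (auto simp: wsets_def)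
  have "monic R (\<Sum>\<psi>\<in>S. degree \<psi>) (poly_of_set S)"
    by (rule monic_finprod[OF S(1)]) (use S(2) monic_irreds_degree(2) in blast)
  then show "monic R l (poly_of_set S)" using assms by (simp add: wsets_def)
qed

lemma finite_char_sets: "finite (char_sets l)"
  by (rule finite_wsets) (rule finite_subset[OF _ finite_monic_irreds_degree], auto)

text \<open>The polynomial X is excluded automatically, since it divides no X^n - 1 with n >
  0.\<close>

lemma coprime_char_sets_subset: "coprime_char_sets L l \<subseteq> char_sets l"
proof -
  have "\<not> coprime_order R L X" using X_not_divides_X_pow_minus_one by (auto simp: coprime_order_def)
  then show ?thesis by (auto simp: wsets_def)
qed

lemma coprime_char_sets_eq: "coprime_char_sets L l = {S \<in> char_sets l. \<forall>\<phi>\<in>S. coprime_order R L \<phi>}"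
proof (intro equalityI subsetI)
  fix S assume S: "S \<in> coprime_char_sets L l"
  then show "S \<in> {S \<in> char_sets l. \<forall>\<phi>\<in>S. coprime_order R L \<phi>}"
    using coprime_char_sets_subset by (auto simp: wsets_def)
next
  fix S assume "S \<in> {S \<in> char_sets l. \<forall>\<phi>\<in>S. coprime_order R L \<phi>}"
  then show "S \<in> coprime_char_sets L l" by (auto simp: wsets_def)
qed

text \<open>A monic f of degree l that is not such a product is X g, with q^(l-1) choices, or
  \<phi>^2 g with d = deg \<phi> \<ge> 1, with at most q^(l-d) \<le> q^(l-1) choices. At most l
  values of d occur, which gives the factor l + 1.\<close>

lemma card_char_sets_ge:
  assumes l: "l \<ge> 1"
  shows "q ^ l \<le> card (char_sets l) + (l + 1) * q ^ (l - 1)"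
proof -
  let ?M = "\<lambda>n. {f. monic R n f}"
  let ?B = "\<lambda>d. (\<lambda>(\<phi>, g). \<phi> \<otimes>\<^sub>X \<phi> \<otimes>\<^sub>X g) ` (?M d \<times> ?M (l - 2 * d))"
  let ?D = "{d. 1 \<le> d \<and> 2 * d \<le> l}"
  note finM = finite_monic[OF finite_carrier]
  have D: "?D \<subseteq> {1..l}" by auto
  have finD: "finite ?D" by (rule finite_subset[OF D]) simp
  have cardD: "card ?D \<le> l" using card_mono[OF _ D] by simp
  have "?M l \<subseteq> poly_of_set ` char_sets l \<union> (\<lambda>g. X \<otimes>\<^sub>X g) ` ?M (l - 1) \<union> (\<Union>d\<in>?D. ?B d)"
  proof
    fix f assume "f \<in> ?M l"
    then have f: "monic R l f" by simp
    show "f \<in> poly_of_set ` char_sets l \<union> (\<lambda>g. X \<otimes>\<^sub>X g) ` ?M (l - 1) \<union> (\<Union>d\<in>?D. ?B d)"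
    proof (cases "\<exists>d\<ge>1. \<exists>\<phi>. monic R d \<phi> \<and> (\<phi> \<otimes>\<^sub>X \<phi>) divides\<^sub>X f")
      case True
      then obtain d \<phi> where d: "d \<ge> 1" "monic R d \<phi>" "(\<phi> \<otimes>\<^sub>X \<phi>) divides\<^sub>X f" by blast
      then obtain g where g: "g \<in> carrier RX" "f = \<phi> \<otimes>\<^sub>X \<phi> \<otimes>\<^sub>X g" by (auto simp: factor_def)
      note mq = monic_quotient[OF f monic_mult[OF d(2) d(2)] g]
      have "d \<in> ?D" using d(1) mq(1) by simp
      moreover have "f \<in> ?B d" using d(2) mq(2) g(2) by (auto simp: mult_2 intro!: image_eqI[of _ _ "(\<phi>, g)"])
      ultimately show ?thesis by blast
    next
      case False
      then obtain S where S: "finite S" "S \<subseteq> monic_irreds R" "f = poly_of_set S"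
        using squarefree_monic_eq_finprod[OF f] by blast
      have Sc: "S \<subseteq> carrier RX" using S(2) monic_irreds_closed by blast
      show ?thesis
      proof (cases "X \<in> S")
        case True
        then obtain g where g: "g \<in> carrier RX" "f = X \<otimes>\<^sub>X g"
          using divides_finprod[OF S(1) Sc] S(3) by (auto simp: factor_def)
        have "monic R 1 X" using monic_irreds_degree(2)[OF X_in_monic_irreds] by (simp add: var_def)
        then have "monic R (l - 1) g" using monic_quotient(2)[OF f _ g] by blast
        then show ?thesis using g(2) by blast
      next
        case False
        have "monic R (\<Sum>\<psi>\<in>S. degree \<psi>) f"
          unfolding S(3) by (rule monic_finprod[OF S(1)]) (use S(2) monic_irreds_degree(2) in blast)
        then have sum: "(\<Sum>\<psi>\<in>S. degree \<psi>) = l" using f by (simp add: monic_def)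
        have "degree \<psi> \<in> {1..l}" if "\<psi> \<in> S" for \<psi>
        proof -
          have "degree \<psi> \<le> (\<Sum>\<psi>\<in>S. degree \<psi>)" by (rule member_le_sum[OF that _ S(1)]) simp
          moreover have "degree \<psi> \<ge> 1" using monic_irreds_degree(1) S(2) that by blast
          ultimately show ?thesis using sum by simp
        qed
        then have "S \<in> char_sets l" using S(1,2) False sum by (auto simp: wsets_def)
        then show ?thesis using S(3) by blast
      qed
    qed
  qed
  then have "card (?M l) \<le> card (poly_of_set ` char_sets l \<union> (\<lambda>g. X \<otimes>\<^sub>X g) ` ?M (l - 1) \<union> (\<Union>d\<in>?D. ?B d))"
    using finM finite_char_sets finD by (intro card_mono finite_UnI finite_UN_I finite_imageI finite_cartesian_product) auto
  also have "\<dots> \<le> card (poly_of_set ` char_sets l) + card ((\<lambda>g. X \<otimes>\<^sub>X g) ` ?M (l - 1)) + card (\<Union>d\<in>?D. ?B d)"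
    by (meson add_le_mono card_Un_le le_refl order_trans)
  also have "\<dots> \<le> card (char_sets l) + q ^ (l - 1) + l * q ^ (l - 1)"
  proof (intro add_mono)
    show "card (poly_of_set ` char_sets l) \<le> card (char_sets l)" by (rule card_image_le[OF finite_char_sets])
    show "card ((\<lambda>g. X \<otimes>\<^sub>X g) ` ?M (l - 1)) \<le> q ^ (l - 1)"
      using card_image_le[OF finM[of "l - 1"]] card_monic[OF finite_carrier, of "l - 1"] by metis
    have "card (\<Union>d\<in>?D. ?B d) \<le> (\<Sum>d\<in>?D. card (?B d))" by (rule card_UN_le[OF finD])
    also have "\<dots> \<le> (\<Sum>d\<in>?D. q ^ (l - 1))"
    proof (rule sum_mono)
      fix d assume d: "d \<in> ?D"
      have "card (?B d) \<le> card (?M d \<times> ?M (l - 2 * d))"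
        by (rule card_image_le) (intro finite_cartesian_product finM)
      also have "\<dots> = q ^ (d + (l - 2 * d))"
        by (simp only: card_cartesian_product card_monic[OF finite_carrier] power_add)
      also have "\<dots> \<le> q ^ (l - 1)" using d q_ge_2 by (intro power_increasing) auto
      finally show "card (?B d) \<le> q ^ (l - 1)" .
    qed
    also have "\<dots> \<le> l * q ^ (l - 1)" using cardD by simp
    finally show "card (\<Union>d\<in>?D. ?B d) \<le> l * q ^ (l - 1)" .
  qed
  finally show ?thesis by (simp add: card_monic[OF finite_carrier] algebra_simps)
qed

text \<open>X^(L^n) - X = X (X^k - 1) with k = L^n - 1, which is prime to L. As \<phi> is prime and
  differs from X, it divides the second factor.\<close>

lemma coprime_order_if_divides_periodic:
  assumes \<phi>: "\<phi> \<in> monic_irreds R" "\<phi> \<noteq> X" and L: "Factorial_Ring.prime L" and n: "n > 0"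
    and d: "\<phi> divides\<^sub>X (X_pow (L ^ n) \<ominus>\<^sub>X X)"
  shows "coprime_order R L \<phi>"
proof -
  have "L ^ n \<ge> L ^ 1" using prime_gt_0_nat[OF L] n by (intro power_increasing) auto
  then have gt: "L ^ n > 1" using prime_gt_1_nat[OF L] by simp
  then obtain k where k: "L ^ n = Suc k" "k > 0" by (cases "L ^ n") auto
  have "X_pow (L ^ n) \<ominus>\<^sub>X X = X \<otimes>\<^sub>X (X_pow k \<ominus>\<^sub>X \<one>\<^sub>X)"
    unfolding k using X_closed by (simp add: UP.minus_eq UP.r_distr UP.r_minus UP.m_comm)
  then have "\<phi> divides\<^sub>X X \<or> \<phi> divides\<^sub>X (X_pow k \<ominus>\<^sub>X \<one>\<^sub>X)"
    using monic_irreds_prime[OF \<phi>(1) X_closed] d X_closed by simp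
  moreover have "\<not> \<phi> divides\<^sub>X X" using monic_irreds_divides_eq[OF \<phi>(1) X_in_monic_irreds] \<phi>(2) by blast
  moreover have "coprime k L"
  proof -
    have "coprime k (Suc k)" by simp
    moreover have "L dvd Suc k" using k(1) n by (metis dvd_power)
    ultimately show ?thesis using coprime_divisors[of k k L "Suc k"] by simp
  qed
  ultimately show ?thesis using k(2) unfolding coprime_order_def by blast
qed

text \<open>The product of the individual exponents is a common multiple that is still prime to L,
  and distinct irreducibles dividing X^n - 1 divide it jointly.\<close>

lemma coprime_order_imp_divides_X_pow_minus_one:
  assumes S: "finite S" "S \<subseteq> monic_irreds R" and c: "\<And>\<phi>. \<phi> \<in> S \<Longrightarrow> coprime_order R L \<phi>"
  shows "\<exists>n>0. coprime n L \<and> poly_of_set S divides\<^sub>X (X_pow n \<ominus>\<^sub>X \<one>\<^sub>X)"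
proof -
  have "\<forall>\<phi>\<in>S. \<exists>n::nat. n > 0 \<and> coprime n L \<and> \<phi> divides\<^sub>X (X_pow n \<ominus>\<^sub>X \<one>\<^sub>X)"
    using c unfolding coprime_order_def by blast
  from bchoice[OF this] obtain N :: "'a list \<Rightarrow> nat" where N: "\<And>\<phi>. \<phi> \<in> S \<Longrightarrow> N \<phi> > 0"
    "\<And>\<phi>. \<phi> \<in> S \<Longrightarrow> coprime (N \<phi>) L"
    "\<And>\<phi>. \<phi> \<in> S \<Longrightarrow> \<phi> divides\<^sub>X (X_pow (N \<phi>) \<ominus>\<^sub>X \<one>\<^sub>X)" by blast
  let ?n = "prod N S"
  have "?n > 0" using N(1) by (intro prod_pos) auto
  moreover have "coprime ?n L" using N(2) by (intro prod_coprime_left) auto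
  moreover have "poly_of_set S divides\<^sub>X (X_pow ?n \<ominus>\<^sub>X \<one>\<^sub>X)"
  proof (rule finprod_monic_irreds_divides[OF S])
    show "X_pow ?n \<ominus>\<^sub>X \<one>\<^sub>X \<in> carrier RX" using X_closed by simp
    fix \<phi> assume \<phi>: "\<phi> \<in> S"
    then have "N \<phi> dvd ?n" using S(1) by (simp add: dvd_prodI)
    then have "(X_pow (N \<phi>) \<ominus>\<^sub>X \<one>\<^sub>X) divides\<^sub>X (X_pow ?n \<ominus>\<^sub>X \<one>\<^sub>X)"
      by (rule UP.pow_minus_one_divides[OF X_closed])
    then show "\<phi> divides\<^sub>X (X_pow ?n \<ominus>\<^sub>X \<one>\<^sub>X)"
      using divides_trans_RX[OF _ N(3)[OF \<phi>]] S(2) \<phi> monic_irreds_closed by blast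
  qed
  ultimately show ?thesis by blast
qed

lemma mat_pow_map_funpow:
  assumes A: "A \<in> Mat l R"
  shows "(mat_pow_map R l L ^^ n) A = A [^]\<^bsub>mat_ring R l\<^esub> (L ^ n)"
proof -
  interpret MM: Group.monoid "mat_ring R l" by (rule mat_monoid)
  show ?thesis using A by (induction n) (simp_all add: mat_pow_map_def MM.nat_pow_pow mult.commute)
qed

text \<open>Periodicity makes the polynomial of S divide X^(L^n) - X, and so does each of its
  irreducible factors.\<close>

lemma Per_imp_coprime_char_set:
  assumes S: "S \<in> char_sets l" and A: "A \<in> companion_class l (poly_of_set S)" and l: "l \<ge> 1"
    and L: "Factorial_Ring.prime L" and Per: "A \<in> Per (mat_pow_map R l L) (Mat l R)"
  shows "S \<in> coprime_char_sets L l"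
proof -
  interpret MM: Group.monoid "mat_ring R l" by (rule mat_monoid)
  note Sd = char_setsD[OF S]
  have Sc: "S \<subseteq> carrier RX" using Sd(2) monic_irreds_closed by blast
  have Ac: "A \<in> Mat l R" using A companion_class_closed[OF monic_closed[OF Sd(4)]] by blast
  obtain n where n: "n > 1" "A [^]\<^bsub>mat_ring R l\<^esub> (L ^ n) = A"
    using Per mat_pow_map_funpow[OF Ac] by (auto simp: Per_def)
  then have "A [^]\<^bsub>mat_ring R l\<^esub> (L ^ n) = A [^]\<^bsub>mat_ring R l\<^esub> (1::nat)" using Ac by simp
  then have d: "poly_of_set S divides\<^sub>X (X_pow (L ^ n) \<ominus>\<^sub>X X)"
    using companion_class_pow_eq_iff[OF A Sd(4) l, of "L ^ n" 1] X_closed by simp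
  have "coprime_order R L \<phi>" if \<phi>: "\<phi> \<in> S" for \<phi>
  proof (rule coprime_order_if_divides_periodic[OF _ _ L])
    show "\<phi> \<in> monic_irreds R" "\<phi> \<noteq> X" "n > 0" using \<phi> Sd n by auto
    show "\<phi> divides\<^sub>X (X_pow (L ^ n) \<ominus>\<^sub>X X)"
      using divides_trans_RX[OF _ divides_finprod[OF Sd(1) Sc \<phi>] d] \<phi> Sc by blast
  qed
  then show ?thesis unfolding coprime_char_sets_eq using S by blast
qed

text \<open>The polynomial of S divides some X^n - 1 with n prime to L, so A^n = 1 and taking L-th
  powers permutes the powers of A. The equation A^n = 1 also makes A invertible.\<close>

lemma coprime_char_set_imp_Per:
  assumes S: "S \<in> coprime_char_sets L l" and A: "A \<in> companion_class l (poly_of_set S)" and l: "l \<ge> 1" and L: "L > 0"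
  shows "A \<in> Per (mat_pow_map R l L) (Mat l R)" "A \<in> regular_semisimple R l"
proof -
  interpret MM: Group.monoid "mat_ring R l" by (rule mat_monoid)
  have S': "S \<in> char_sets l" and c: "\<And>\<phi>. \<phi> \<in> S \<Longrightarrow> coprime_order R L \<phi>"
    using S unfolding coprime_char_sets_eq by auto
  note Sd = char_setsD[OF S']
  have Ac: "A \<in> Mat l R" using A companion_class_closed[OF monic_closed[OF Sd(4)]] by blast
  obtain n :: nat where n: "n > 0" "coprime n L" "poly_of_set S divides\<^sub>X (X_pow n \<ominus>\<^sub>X \<one>\<^sub>X)"
    using coprime_order_imp_divides_X_pow_minus_one[OF Sd(1,2) c] by blast
  then have An: "A [^]\<^bsub>mat_ring R l\<^esub> n = \<one>\<^bsub>mat_ring R l\<^esub>"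
    using companion_class_pow_eq_iff[OF A Sd(4) l, of n 0] by simp
  \<comment> \<open>\<open>Per\<close> asks for an exponent above 1, while \<open>totient n\<close>
    may be 1; doubling the exponent from Euler's theorem covers this case.\<close>
  let ?k = "2 * totient n"
  have "totient n > 0" using n(1) by simp
  then have k: "?k > 1" by linarith
  have "n dvd L ^ ?k - 1"
  proof (rule cong_to_1_nat)
    show "[L ^ ?k = 1] (mod n)"
    proof -
      have "coprime L n" using n(2) by (subst coprime_commute)
      then have "[(L ^ totient n) ^ 2 = 1 ^ 2] (mod n)" by (intro cong_pow euler_theorem)
      then show ?thesis by (simp only: power_mult[symmetric] power_one mult.commute)
    qed
  qed
  moreover have "L ^ ?k \<ge> 1" using L by simp
  ultimately obtain j where "L ^ ?k - 1 = n * j" "L ^ ?k \<ge> 1" by (auto elim: dvdE)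
  then have j: "L ^ ?k = 1 + n * j" by linarith
  have "A [^]\<^bsub>mat_ring R l\<^esub> (L ^ ?k) = A [^]\<^bsub>mat_ring R l\<^esub> (1::nat) \<otimes>\<^bsub>mat_ring R l\<^esub> (A [^]\<^bsub>mat_ring R l\<^esub> n) [^]\<^bsub>mat_ring R l\<^esub> j"
    unfolding j using Ac by (simp only: MM.nat_pow_mult[symmetric] MM.nat_pow_pow)
  also have "\<dots> = A" unfolding An using Ac by simp
  finally have "(mat_pow_map R l L ^^ ?k) A = A" unfolding mat_pow_map_funpow[OF Ac] .
  then have "\<exists>k>1. (mat_pow_map R l L ^^ k) A = A" using k by (rule exI[of _ ?k, OF conjI, rotated])
  then show "A \<in> Per (mat_pow_map R l L) (Mat l R)" unfolding Per_def using Ac by simp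
  obtain i where i: "n = Suc i" using n(1) by (cases n) auto
  have "A [^]\<^bsub>mat_ring R l\<^esub> i \<otimes>\<^bsub>mat_ring R l\<^esub> A = \<one>\<^bsub>mat_ring R l\<^esub>" using An unfolding i by simp
  moreover have "A \<otimes>\<^bsub>mat_ring R l\<^esub> A [^]\<^bsub>mat_ring R l\<^esub> i = \<one>\<^bsub>mat_ring R l\<^esub>"
    using An Ac unfolding i by (simp only: MM.nat_pow_Suc2)
  ultimately have "A \<in> GL l R" using Ac unfolding Units_def by blast
  moreover have "\<forall>f\<in>S. f \<in> carrier RX \<and> pirreducible (carrier R) f \<and> lead_coeff f = \<one>"
    using Sd(2) by (auto simp: monic_irreds_def)
  moreover have "mat_char_poly R l A = poly_of_set S" by (rule mat_char_poly_companion_class[OF A Sd(4) l])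
  ultimately show "A \<in> regular_semisimple R l" using Sd(1) unfolding regular_semisimple_def by blast
qed

end

section \<open>Proportions of periodic matrices\<close>

context galois_field
begin

text \<open>Each class has at least |GL| / q^l elements, and classes of different sets are disjoint
  because their characteristic polynomials differ. Multiplying by q^l keeps the inequality in the
  natural numbers.\<close>

lemma card_char_sets_GL_le:
  assumes W: "W \<subseteq> char_sets l" and l: "l \<ge> 1"
  shows "card W * card (GL l R) \<le> card (\<Union>S\<in>W. companion_class l (poly_of_set S)) * q ^ l"
proof -
  have finW: "finite W" by (rule finite_subset[OF W finite_char_sets])
  have m: "monic R l (poly_of_set S)" if "S \<in> W" for S using char_setsD(4) W that by blast
  have finC: "finite (companion_class l (poly_of_set S))" if "S \<in> W" for S
    by (rule finite_subset[OF companion_class_closed[OF monic_closed[OF m[OF that]]] finite_Mat[OF finite_carrier]])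
  have disj: "companion_class l (poly_of_set S) \<inter> companion_class l (poly_of_set T) = {}"
    if "S \<in> W" "T \<in> W" "S \<noteq> T" for S T
  proof (rule ccontr)
    assume "\<not> ?thesis"
    then obtain A where A: "A \<in> companion_class l (poly_of_set S)" "A \<in> companion_class l (poly_of_set T)" by blast
    have "poly_of_set S = poly_of_set T"
      using mat_char_poly_companion_class[OF A(1) m[OF that(1)] l] mat_char_poly_companion_class[OF A(2) m[OF that(2)] l]
      by simp
    then have "S = T"
      using char_setsD(1,2)[of S l] char_setsD(1,2)[of T l] W that by (intro finprod_monic_irreds_inj) auto
    then show False using that(3) by simp
  qed
  have "card W * card (GL l R) = (\<Sum>S\<in>W. card (GL l R))" by simp
  also have "\<dots> \<le> (\<Sum>S\<in>W. card (companion_class l (poly_of_set S)) * q ^ l)"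
    by (rule sum_mono) (rule card_GL_le_companion_class[OF finite_carrier monic_closed[OF m] l])
  also have "\<dots> = (\<Sum>S\<in>W. card (companion_class l (poly_of_set S))) * q ^ l" by (simp add: sum_distrib_right)
  also have "(\<Sum>S\<in>W. card (companion_class l (poly_of_set S))) = card (\<Union>S\<in>W. companion_class l (poly_of_set S))"
    by (rule card_UN_disjoint[symmetric, OF finW]) (use finC disj in auto)
  finally show ?thesis .
qed

lemma Per_GL: "Per (mat_pow_map R l L) (GL l R) = Per (mat_pow_map R l L) (Mat l R) \<inter> GL l R"
  by (auto simp: Per_def Units_def)

text \<open>The first bound adds up the periodic classes. The other two are packing arguments: the
  classes outside \<open>coprime_char_sets L l\<close> miss \<open>per\<close>, and all classes of
  \<open>char_sets l\<close> miss the periodic matrices that are not regular semisimple, so each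
  pair fits disjointly into the q^(l^2) matrices.\<close>

lemma periodic_matrix_counts:
  assumes l: "l \<ge> 1" and L: "Factorial_Ring.prime L"
  defines "per \<equiv> Per (mat_pow_map R l L) (Mat l R)"
  shows "card (coprime_char_sets L l) * card (GL l R) \<le> card per * q ^ l"
    and "card per * q ^ l + card (char_sets l - coprime_char_sets L l) * card (GL l R) \<le> q ^ (l * l) * q ^ l"
    and "card (per - regular_semisimple R l) * q ^ l + card (char_sets l) * card (GL l R) \<le> q ^ (l * l) * q ^ l"
proof -
  let ?C = "\<lambda>W. \<Union>S\<in>W. companion_class l (poly_of_set S)"
  have L0: "L > 0" by (rule prime_gt_0_nat[OF L])
  have perM: "per \<subseteq> Mat l R" by (auto simp: per_def Per_def)
  note finM = finite_Mat[OF finite_carrier, of l]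
  have finper: "finite per" by (rule finite_subset[OF perM finM])
  have CM: "?C W \<subseteq> Mat l R" if "W \<subseteq> char_sets l" for W
    using companion_class_closed[OF monic_closed] char_setsD(4) that by blast
  have good: "?C (coprime_char_sets L l) \<subseteq> per" "?C (coprime_char_sets L l) \<subseteq> regular_semisimple R l"
    using coprime_char_set_imp_Per[OF _ _ l L0] unfolding per_def by blast+
  have bad: "?C (char_sets l - coprime_char_sets L l) \<inter> per = {}"
    using Per_imp_coprime_char_set[OF _ _ l L] unfolding per_def by blast
  have "card (coprime_char_sets L l) * card (GL l R) \<le> card (?C (coprime_char_sets L l)) * q ^ l"
    by (rule card_char_sets_GL_le[OF coprime_char_sets_subset l])
  also have "\<dots> \<le> card per * q ^ l" by (intro mult_right_mono card_mono finper good(1)) simp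
  finally show "card (coprime_char_sets L l) * card (GL l R) \<le> card per * q ^ l" .
  have split: "card B * q ^ l + card W * card (GL l R) \<le> q ^ (l * l) * q ^ l"
    if W: "W \<subseteq> char_sets l" and B: "B \<subseteq> Mat l R" "?C W \<inter> B = {}" for B W
  proof -
    have "card B * q ^ l + card W * card (GL l R) \<le> (card B + card (?C W)) * q ^ l"
      using card_char_sets_GL_le[OF W l] by (simp add: add_mult_distrib)
    also have "card B + card (?C W) = card (B \<union> ?C W)"
      by (rule card_Un_disjoint[symmetric]) (use B CM[OF W] finM finite_subset in \<open>blast+\<close>)
    also have "\<dots> \<le> card (Mat l R)" by (rule card_mono[OF finM]) (use B CM[OF W] in blast)
    finally show ?thesis by (simp add: card_Mat[OF finite_carrier])
  qed
  show "card per * q ^ l + card (char_sets l - coprime_char_sets L l) * card (GL l R) \<le> q ^ (l * l) * q ^ l"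
    by (rule split[OF _ perM bad]) blast
  \<comment> \<open>A class from \<open>coprime_char_sets L l\<close> is regular semisimple, and any
    other class contains no periodic matrix.\<close>
  have disj: "?C (char_sets l) \<inter> (per - regular_semisimple R l) = {}" using good(2) bad by blast
  show "card (per - regular_semisimple R l) * q ^ l + card (char_sets l) * card (GL l R) \<le> q ^ (l * l) * q ^ l"
    by (rule split[OF order_refl _ disj]) (use perM in blast)
qed

text \<open>The counts are turned into proportions with errors of order 1/Q: l/Q from singular
  matrices and (l+1)/Q from polynomials that are not squarefree or are multiples of X. With \<gamma>
  near 1, the proportion \<pi> is squeezed between quantities close to \<rho>.\<close>

lemma periodic_matrix_proportions:
  fixes l L :: nat
  assumes l: "l \<ge> 1" and L: "Factorial_Ring.prime L"
  defines "Q \<equiv> real q"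
    and "per \<equiv> Per (mat_pow_map R l L) (Mat l R)"
  defines "\<gamma> \<equiv> card (GL l R) / Q ^ (l * l)"
    and "\<pi> \<equiv> card per / Q ^ (l * l)"
    and "\<rho> \<equiv> card (coprime_char_sets L l) / Q ^ l"
  shows "1 - l / Q \<le> \<gamma>" "\<gamma> \<le> 1" "\<rho> * \<gamma> \<le> \<pi>" "\<pi> \<le> 1 - (1 - (l + 1) / Q - \<rho>) * \<gamma>"
    "card (per - regular_semisimple R l) / Q ^ (l * l) \<le> 1 - (1 - (l + 1) / Q) * \<gamma>"
    "\<pi> - (1 - \<gamma>) \<le> card (Per (mat_pow_map R l L) (GL l R)) / Q ^ (l * l)"
    "card (Per (mat_pow_map R l L) (GL l R)) / Q ^ (l * l) \<le> \<pi>"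
proof -
  let ?g = "card (GL l R)" and ?W = "char_sets l" and ?WR = "coprime_char_sets L l"
  have Q: "Q > 0" using q_ge_2 by (simp add: Q_def)
  have Q1: "Q ^ (l * l - 1) / Q ^ (l * l) = 1 / Q" "Q ^ (l - 1) / Q ^ l = 1 / Q"
    using Q l power_diff[of Q 1 "l * l"] power_diff[of Q 1 l] by (auto simp: field_simps)
  note finM = finite_Mat[OF finite_carrier, of l]
  have cM: "real (card (Mat l R)) = Q ^ (l * l)" by (simp add: card_Mat[OF finite_carrier] Q_def)
  have GLM: "GL l R \<subseteq> Mat l R" by (auto simp: Units_def)
  have perM: "per \<subseteq> Mat l R" by (auto simp: per_def Per_def)
  have non: "real (card (Mat l R - GL l R)) = Q ^ (l * l) - ?g"
    using card_Diff_subset[OF finite_subset[OF GLM finM] GLM] card_mono[OF finM GLM] cM by (simp add: of_nat_diff)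
  have "real (card (Mat l R - GL l R)) \<le> real (l * q ^ (l * l - 1))"
    using card_nonunits_le[OF finite_carrier l] by (rule of_nat_mono)
  then have "Q ^ (l * l) - ?g \<le> l * Q ^ (l * l - 1)" unfolding non by (simp add: Q_def)
  then have "(Q ^ (l * l) - ?g) / Q ^ (l * l) \<le> l * Q ^ (l * l - 1) / Q ^ (l * l)"
    using Q by (intro divide_right_mono) auto
  also have "l * Q ^ (l * l - 1) / Q ^ (l * l) = l / Q" using Q1(1) by (metis times_divide_eq_right mult.right_neutral)
  finally show "1 - l / Q \<le> \<gamma>" using Q by (simp add: \<gamma>_def diff_divide_distrib)
  have "real ?g \<le> Q ^ (l * l)" using card_mono[OF finM GLM] cM by simp
  then show g1: "\<gamma> \<le> 1" using Q by (simp add: \<gamma>_def)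
  have g0: "\<gamma> \<ge> 0" using Q by (simp add: \<gamma>_def)
  note counts = periodic_matrix_counts[OF l L, folded per_def]
  have scale: "a / Q ^ (l * l) + b / Q ^ l * \<gamma> \<le> 1" if "a * q ^ l + b * ?g \<le> q ^ (l * l) * q ^ l" for a b :: nat
  proof -
    have "real (a * q ^ l + b * ?g) \<le> real (q ^ (l * l) * q ^ l)" using that by (rule of_nat_mono)
    then have "(a * Q ^ l + b * real ?g) / (Q ^ (l * l) * Q ^ l) \<le> 1" using Q by (simp add: Q_def)
    moreover have "(a * Q ^ l + b * real ?g) / (Q ^ (l * l) * Q ^ l) = a / Q ^ (l * l) + b / Q ^ l * \<gamma>"
      using Q by (simp add: \<gamma>_def add_divide_distrib)
    ultimately show ?thesis by simp
  qed
  have "real (card ?WR * ?g) \<le> real (card per * q ^ l)" using counts(1) by (rule of_nat_mono)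
  then have "card ?WR * real ?g / (Q ^ l * Q ^ (l * l)) \<le> card per * Q ^ l / (Q ^ l * Q ^ (l * l))"
    using Q by (intro divide_right_mono) (auto simp: Q_def)
  then show "\<rho> * \<gamma> \<le> \<pi>" using Q by (simp add: \<rho>_def \<gamma>_def \<pi>_def)
  have "real (q ^ l) \<le> real (card ?W + (l + 1) * q ^ (l - 1))" using card_char_sets_ge[OF l] by (rule of_nat_mono)
  then have "Q ^ l - (l + 1) * Q ^ (l - 1) \<le> card ?W" by (simp add: Q_def algebra_simps)
  then have "(Q ^ l - (l + 1) * Q ^ (l - 1)) / Q ^ l \<le> card ?W / Q ^ l"
    using Q by (intro divide_right_mono) auto
  moreover have "(Q ^ l - (l + 1) * Q ^ (l - 1)) / Q ^ l = 1 - (l + 1) * (Q ^ (l - 1) / Q ^ l)"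
    using Q by (simp add: diff_divide_distrib)
  ultimately have W: "1 - (l + 1) / Q \<le> card ?W / Q ^ l" unfolding Q1 by simp
  have "real (card (?W - ?WR)) = real (card ?W) - card ?WR"
    using card_Diff_subset[OF finite_subset[OF coprime_char_sets_subset finite_char_sets] coprime_char_sets_subset]
      card_mono[OF finite_char_sets coprime_char_sets_subset, of L l] by (simp add: of_nat_diff)
  then have "card (?W - ?WR) / Q ^ l = card ?W / Q ^ l - \<rho>" by (simp add: \<rho>_def diff_divide_distrib)
  then have "\<pi> + (card ?W / Q ^ l - \<rho>) * \<gamma> \<le> 1" using scale[OF counts(2)] by (simp add: \<pi>_def)
  moreover have "(1 - (l + 1) / Q - \<rho>) * \<gamma> \<le> (card ?W / Q ^ l - \<rho>) * \<gamma>"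
    using W g0 by (intro mult_right_mono) auto
  ultimately show "\<pi> \<le> 1 - (1 - (l + 1) / Q - \<rho>) * \<gamma>" by linarith
  have "(1 - (l + 1) / Q) * \<gamma> \<le> card ?W / Q ^ l * \<gamma>" using W g0 by (rule mult_right_mono)
  then show "card (per - regular_semisimple R l) / Q ^ (l * l) \<le> 1 - (1 - (l + 1) / Q) * \<gamma>"
    using scale[OF counts(3)] by linarith
  \<comment> \<open>Passing from all matrices to invertible ones loses at most the singular
    matrices, whose proportion is 1 - \<gamma>.\<close>
  have "real (card per) - real (card (Mat l R - GL l R)) \<le> card (per \<inter> GL l R)"
  proof -
    have "card per \<le> card ((per \<inter> GL l R) \<union> (Mat l R - GL l R))"
      by (rule card_mono) (use finM perM GLM finite_subset in \<open>blast+\<close>)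
    also have "\<dots> \<le> card (per \<inter> GL l R) + card (Mat l R - GL l R)" by (rule card_Un_le)
    finally show ?thesis by simp
  qed
  then have "(card per - (Q ^ (l * l) - ?g)) / Q ^ (l * l) \<le> card (per \<inter> GL l R) / Q ^ (l * l)"
    unfolding non using Q by (intro divide_right_mono) auto
  moreover have "(card per - (Q ^ (l * l) - ?g)) / Q ^ (l * l) = \<pi> - (1 - \<gamma>)"
    using Q by (simp add: \<pi>_def \<gamma>_def diff_divide_distrib)
  ultimately show "\<pi> - (1 - \<gamma>) \<le> card (Per (mat_pow_map R l L) (GL l R)) / Q ^ (l * l)"
    unfolding Per_GL per_def by simp
  have "card (per \<inter> GL l R) \<le> card per" by (rule card_mono) (use finM perM finite_subset in \<open>blast+\<close>)
  then show "card (Per (mat_pow_map R l L) (GL l R)) / Q ^ (l * l) \<le> \<pi>"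
    unfolding Per_GL \<pi>_def using Q by (intro divide_right_mono) (auto simp: per_def)
qed

end

section \<open>Passage to the limit along the admissible q\<close>

lemma admissible_qD:
  assumes "q \<in> admissible_q L c" and "c \<ge> 1"
  shows "primepow q" "q > 1" "L dvd q - 1" "multiplicity L (q - 1) = c"
proof -
  obtain p d where p: "Factorial_Ring.prime p" "d > 0" "q = p ^ d" and m: "multiplicity L (q - 1) = c"
    using assms(1) by (auto simp: admissible_q_def)
  show "primepow q" unfolding primepow_def using p by blast
  show "q > 1" unfolding p(3) using prime_gt_1_nat[OF p(1)] p(2) by (rule one_less_power)
  show "multiplicity L (q - 1) = c" by (rule m)
  have "L ^ c dvd q - 1" using multiplicity_dvd[of L "q - 1"] m by simp
  then show "L dvd q - 1" using assms(2) by (meson dvd_power dvd_trans less_le_trans zero_less_one)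
qed

lemma eventually_q_to_infinityI:
  "(\<And>q. q \<in> admissible_q L c \<Longrightarrow> P q) \<Longrightarrow> eventually P (q_to_infinity L c)"
  by (simp add: q_to_infinity_def eventually_inf_principal)

lemma real_q_to_infinity: "filterlim real at_top (q_to_infinity L c)"
  unfolding q_to_infinity_def
  by (rule filterlim_mono[OF filterlim_real_sequentially order_refl inf_le1])

theorem proposition3p5:
  fixes l L c :: nat
    and F :: "nat \<Rightarrow> 'a ring"
  assumes l: "l \<ge> 2"
    and L: "Factorial_Ring.prime L" "L \<noteq> 2"
    and c: "c \<ge> 1"
    and F: "\<And>q. primepow q \<Longrightarrow> field (F q) \<and> card (carrier (F q)) = q"
  shows "(\<exists>\<Lambda>::real.
            ((\<lambda>q. real (card (Per (mat_pow_map (F q) l L) (Mat l (F q)))) / real (card (Mat l (F q))))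
               \<longlongrightarrow> \<Lambda>) (q_to_infinity L c) \<and>
            ((\<lambda>q. real (card (Per (mat_pow_map (F q) l L) (GL l (F q)))) / real (card (GL l (F q))))
               \<longlongrightarrow> \<Lambda>) (q_to_infinity L c)) \<and>
         ((\<lambda>q. real (card (Per (mat_pow_map (F q) l L) (Mat l (F q)) - regular_semisimple (F q) l))
                 / real (card (Mat l (F q))))
            \<longlongrightarrow> 0) (q_to_infinity L c)"
proof -
  let ?G = "q_to_infinity L c"
  let ?P = "\<lambda>q. {\<phi> \<in> monic_irreds (F q). coprime_order (F q) L \<phi>}"
  let ?per = "\<lambda>q. Per (mat_pow_map (F q) l L) (Mat l (F q))"
  let ?perGL = "\<lambda>q. Per (mat_pow_map (F q) l L) (GL l (F q))"
  define \<gamma> where "\<gamma> q = card (GL l (F q)) / real q ^ (l * l)" for q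
  define \<pi> where "\<pi> q = card (?per q) / real q ^ (l * l)" for q
  define \<pi>GL where "\<pi>GL q = card (?perGL q) / real q ^ (l * l)" for q
  define \<beta> where "\<beta> q = card (?per q - regular_semisimple (F q) l) / real q ^ (l * l)" for q
  define \<rho> where "\<rho> q = card (wsets (?P q) degree l l) / real q ^ l" for q
  have l1: "l \<ge> 1" using l by simp
  have card_F: "card (carrier (F q)) = q" if "q \<in> admissible_q L c" for q
    using F admissible_qD(1)[OF that c] by blast
  have gf: "\<exists>p e. galois_field (F q) p e" if q: "q \<in> admissible_q L c" for q
  proof -
    obtain p e where "Factorial_Ring.prime p" "q = p ^ e" using q by (auto simp: admissible_q_def)
    moreover have "field (F q)" using F admissible_qD(1)[OF q c] by blast
    ultimately show ?thesis
      using card_F[OF q] by (auto simp: galois_field_def galois_field_axioms_def)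
  qed
  have card_M: "real (card (Mat l (F q))) = real q ^ (l * l)" if q: "q \<in> admissible_q L c" for q
  proof -
    have "finite (carrier (F q))" using card_F[OF q] admissible_qD(2)[OF q c] by (intro card_ge_0_finite) simp
    then show ?thesis by (simp add: card_Mat card_F[OF q])
  qed
  have bounds: "1 - l * (1 / real q) \<le> \<gamma> q" "\<gamma> q \<le> 1" "\<rho> q * \<gamma> q \<le> \<pi> q"
      "\<pi> q \<le> 1 - (1 - (l + 1) * (1 / real q) - \<rho> q) * \<gamma> q" "\<beta> q \<le> 1 - (1 - (l + 1) * (1 / real q)) * \<gamma> q"
      "\<pi> q - (1 - \<gamma> q) \<le> \<pi>GL q" "\<pi>GL q \<le> \<pi> q" if q: "q \<in> admissible_q L c" for q
  proof -
    obtain p e where "galois_field (F q) p e" using gf[OF q] by blast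
    then interpret galois_field "F q" p e .
    show "1 - l * (1 / real q) \<le> \<gamma> q" "\<gamma> q \<le> 1" "\<rho> q * \<gamma> q \<le> \<pi> q"
      "\<pi> q \<le> 1 - (1 - (l + 1) * (1 / real q) - \<rho> q) * \<gamma> q" "\<beta> q \<le> 1 - (1 - (l + 1) * (1 / real q)) * \<gamma> q"
      "\<pi> q - (1 - \<gamma> q) \<le> \<pi>GL q" "\<pi>GL q \<le> \<pi> q"
      using periodic_matrix_proportions[OF l1 L(1), unfolded card_F[OF q]]
      unfolding \<gamma>_def \<pi>_def \<pi>GL_def \<beta>_def \<rho>_def by simp_all
  qed
  have inv: "((\<lambda>q. 1 / real q) \<longlongrightarrow> 0) ?G"
    using tendsto_inverse_power_at_top[OF real_q_to_infinity, of 1] by simp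
  have "\<exists>\<Lambda>. (\<rho> \<longlongrightarrow> \<Lambda>) ?G"
    unfolding \<rho>_def
  proof (rule card_wsets_tendsto[OF real_q_to_infinity])
    show "\<forall>\<^sub>F q in ?G. \<forall>d\<ge>1. finite {x \<in> ?P q. degree x = d}"
    proof (rule eventually_q_to_infinityI)
      fix q assume "q \<in> admissible_q L c"
      then obtain p e where "galois_field (F q) p e" using gf by blast
      then interpret galois_field "F q" p e .
      show "\<forall>d\<ge>1. finite {x \<in> ?P q. degree x = d}"
        by (intro allI impI finite_subset[OF _ finite_monic_irreds_degree]) auto
    qed
    fix m :: nat assume "m \<ge> 1"
    then show "\<exists>\<nu>. ((\<lambda>q. card {x \<in> ?P q. degree x = m} / real q ^ m) \<longlongrightarrow> \<nu>) ?G"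
    \<comment> \<open>Since c is fixed, the L-part of q^m - 1 is L^(c + v_L(m)) for every admissible
      q. The denominator r(m) therefore does not vary with q, which is what the inversion lemma
      requires.\<close>
    proof (rule divisor_sum_inversion_tendsto[OF real_q_to_infinity, where r = "\<lambda>m. real (L ^ (c + multiplicity L m))", rotated])
      fix m :: nat assume m: "m \<ge> 1"
      show "\<forall>\<^sub>F q in ?G. real (\<Sum>d | d dvd m. d * card {x \<in> ?P q. degree x = d})
          = (real q ^ m - 1) / real (L ^ (c + multiplicity L m))"
      proof (rule eventually_q_to_infinityI)
        fix q assume q: "q \<in> admissible_q L c"
        then obtain p e where "galois_field (F q) p e" using gf by blast
        then interpret galois_field "F q" p e .
        have "multiplicity L (q ^ m - 1) = c + multiplicity L m"
          using multiplicity_power_minus_one[OF L admissible_qD(2,3)[OF q c], of m] admissible_qD(4)[OF q c] m by simp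
        then show "real (\<Sum>d | d dvd m. d * card {x \<in> ?P q. degree x = d})
          = (real q ^ m - 1) / real (L ^ (c + multiplicity L m))"
          using sum_degree_coprime_order[OF L(1) m, unfolded card_F[OF q]] by simp
      qed
    qed
  qed
  then obtain \<Lambda> where \<rho>: "(\<rho> \<longlongrightarrow> \<Lambda>) ?G" by blast
  note ev = eventually_q_to_infinityI[of L c]
  have lim1: "((\<lambda>q. 1 - real k * (1 / real q)) \<longlongrightarrow> 1) ?G" for k
    using tendsto_diff[OF tendsto_const tendsto_mult[OF tendsto_const inv], of 1 "real k"] by simp
  have \<gamma>: "(\<gamma> \<longlongrightarrow> 1) ?G"
    by (rule tendsto_sandwich[OF ev[OF bounds(1)] ev[OF bounds(2)] lim1 tendsto_const])
  have \<pi>: "(\<pi> \<longlongrightarrow> \<Lambda>) ?G"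
  \<comment> \<open>Both bounds share the limit of \<rho>: the lower one tends to \<Lambda> times 1,
    the upper one to 1 - (1 - \<Lambda>).\<close>
  proof (rule tendsto_sandwich[OF ev[OF bounds(3)] ev[OF bounds(4)]])
    show "((\<lambda>q. \<rho> q * \<gamma> q) \<longlongrightarrow> \<Lambda>) ?G" using tendsto_mult[OF \<rho> \<gamma>] by simp
    show "((\<lambda>q. 1 - (1 - real (l + 1) * (1 / real q) - \<rho> q) * \<gamma> q) \<longlongrightarrow> \<Lambda>) ?G"
      using tendsto_diff[OF tendsto_const tendsto_mult[OF tendsto_diff[OF lim1[of "l + 1"] \<rho>] \<gamma>], of 1] by simp
  qed
  have \<pi>GL: "(\<pi>GL \<longlongrightarrow> \<Lambda>) ?G"
  proof (rule tendsto_sandwich[OF ev[OF bounds(6)] ev[OF bounds(7)] _ \<pi>])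
    show "((\<lambda>q. \<pi> q - (1 - \<gamma> q)) \<longlongrightarrow> \<Lambda>) ?G"
      using tendsto_diff[OF \<pi> tendsto_diff[OF tendsto_const \<gamma>], of 1] by simp
  qed
  have \<beta>: "(\<beta> \<longlongrightarrow> 0) ?G"
  proof (rule tendsto_sandwich[OF _ ev[OF bounds(5)] tendsto_const])
    show "((\<lambda>q. 1 - (1 - real (l + 1) * (1 / real q)) * \<gamma> q) \<longlongrightarrow> 0) ?G"
      using tendsto_diff[OF tendsto_const tendsto_mult[OF lim1[of "l + 1"] \<gamma>], of 1] by simp
    show "\<forall>\<^sub>F q in ?G. 0 \<le> \<beta> q" by (simp add: \<beta>_def)
  qed
  have "((\<lambda>q. real (card (?per q)) / real (card (Mat l (F q)))) \<longlongrightarrow> \<Lambda>) ?G"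
    by (rule Lim_transform_eventually[OF \<pi>]) (rule eventually_q_to_infinityI, simp add: \<pi>_def card_M)
  moreover have "((\<lambda>q. real (card (?perGL q)) / real (card (GL l (F q)))) \<longlongrightarrow> \<Lambda>) ?G"
  proof (rule Lim_transform_eventually)
    \<comment> \<open>\<open>\<pi>GL\<close> is normalised by the number of all matrices; dividing
      by \<open>\<gamma>\<close>, which tends to 1, replaces this denominator by the order of
      \<open>GL\<close>.\<close>
    show "((\<lambda>q. \<pi>GL q / \<gamma> q) \<longlongrightarrow> \<Lambda>) ?G" using tendsto_divide[OF \<pi>GL \<gamma>] by simp
    show "\<forall>\<^sub>F q in ?G. \<pi>GL q / \<gamma> q = real (card (?perGL q)) / real (card (GL l (F q)))"
      by (rule eventually_q_to_infinityI) (use admissible_qD(2) c in \<open>fastforce simp: \<pi>GL_def \<gamma>_def\<close>)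
  qed
  moreover have "((\<lambda>q. real (card (?per q - regular_semisimple (F q) l)) / real (card (Mat l (F q)))) \<longlongrightarrow> 0) ?G"
    by (rule Lim_transform_eventually[OF \<beta>]) (rule eventually_q_to_infinityI, simp add: \<beta>_def card_M)
  ultimately show ?thesis by blast
qed

end
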